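(* Let $X\subseteq\mathbb{N}\setminus\{0\}$ be either a $\Sigma_2$ set or a $\Pi_2$ set, where each $k\in X$ is identified with the finite order-type $\mathbf{k}$ of a $k$-element linear order. Let $C\subseteq\mathbb{N}$ be a co-c.e. cohesive set. Then there is a computable linear order $\mathcal{M}$ of order-type $\omega$ such that the cohesive power $\Pi_C\mathcal{M}$ has order-type $\omega+\boldsymbol{\sigma}(X\cup\{\alpha\})$, where $\alpha=\omega+\zeta\eta+\omega^*$. Moreover, if $X$ is finite and non-empty, then there is also a computable linear order $\mathcal{M}$ of order-type $\omega$ such that $\Pi_C\mathcal{M}$ has order-type $\omega+\boldsymbol{\sigma}(X)$.
   Context: A set $C\subseteq\mathbb{N}$ is cohesive if it is infinite and for every c.e. set $W$, either $C\setminus W$ or $C\cap W$ is finite; co-c.e. means $\mathbb{N}\setminus C$ is c.e. Write $X\subseteq^* Y$ if $X\setminus Y$ is finite. A computable linear order $\mathcal{L}=(L,\prec_{\mathcal{L}})$ has computable domain $L\subseteq\mathbb{N}$ and computable order. The cohesive power $\Pi_C\mathcal{L}$ has as elements the classes $[\varphi]$ of partial computable $\varphi\colon\mathbb{N}\to L$ with $C\subseteq^*\mathrm{dom}(\varphi)$ under $\varphi=_C\psi$ iff $C\subseteq^*\{x:\varphi(x)\downarrow=\psi(x)\downarrow\}$, ordered by $[\varphi]\prec[\psi]$ iff $C\subseteq^*\{x:\varphi(x)\downarrow,\psi(x)\downarrow,\varphi(x)\prec_{\mathcal{L}}\psi(x)\}$. $\omega,\zeta,\eta$ are the order-types of $\mathbb{N},\mathbb{Z},\mathbb{Q}$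 with usual order; $\omega^*$ is the reverse of $\omega$; the product $\zeta\eta$ means $\eta$-many copies of $\zeta$ ordered lexicographically. Shuffle: for a non-empty at most countable set $X$ of order-types, choose a coloring of $\mathbb{Q}$ with $|X|$ colors in which each color class is dense in $\mathbb{Q}$, assign distinct colors to the members of $X$, and replace each rational $q$ by a copy of the order-type assigned to its color (ordered lexicographically); the resulting order-type is independent of choices and is denoted $\boldsymbol{\sigma}(X)$. *)

theory Defs
  imports Complex_Main "HOL-Library.Nat_Bijection"
begin

section \<open>Computability\<close>

text \<open>
  Partial functions are maps \<open>nat \<rightharpoonup> nat\<close>. A function of several arguments is presented as a
  unary one through the pairing bijection \<^const>\<open>prod_encode\<close>; the partial computable functions are
  then Kleene's partial recursive functions: zero, successor and the projections, closed under
  pairing, composition, primitive recursion and unbounded search.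
\<close>

primrec prim_rec :: "(nat \<rightharpoonup> nat) \<Rightarrow> (nat \<rightharpoonup> nat) \<Rightarrow> nat \<Rightarrow> nat \<Rightarrow> nat option" where
  "prim_rec f g a 0 = f a"
| "prim_rec f g a (Suc k) =
     Option.bind (prim_rec f g a k) (\<lambda>v. g (prod_encode (a, prod_encode (k, v))))"

text \<open>The search diverges as soon as it meets a divergent value before the first zero.\<close>

definition mu_zero :: "(nat \<rightharpoonup> nat) \<Rightarrow> nat \<Rightarrow> nat \<Rightarrow> bool" where
  "mu_zero f x n \<longleftrightarrow> f (prod_encode (x, n)) = Some 0 \<and>
     (\<forall>m<n. \<exists>v. f (prod_encode (x, m)) = Some (Suc v))"

definition mu_search :: "(nat \<rightharpoonup> nat) \<Rightarrow> (nat \<rightharpoonup> nat)" where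
  "mu_search f x = (if \<exists>n. mu_zero f x n then Some (LEAST n. mu_zero f x n) else None)"

inductive partial_computable :: "(nat \<rightharpoonup> nat) \<Rightarrow> bool" where
  pc_zero: "partial_computable (\<lambda>x. Some 0)"
| pc_suc: "partial_computable (\<lambda>x. Some (Suc x))"
| pc_fst: "partial_computable (\<lambda>x. Some (fst (prod_decode x)))"
| pc_snd: "partial_computable (\<lambda>x. Some (snd (prod_decode x)))"
| pc_pair: "partial_computable f \<Longrightarrow> partial_computable g \<Longrightarrow>
    partial_computable
      (\<lambda>x. Option.bind (f x) (\<lambda>a. Option.bind (g x) (\<lambda>b. Some (prod_encode (a, b)))))"
| pc_comp: "partial_computable f \<Longrightarrow> partial_computable g \<Longrightarrow>
    partial_computable (\<lambda>x. Option.bind (g x) f)"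
| pc_rec: "partial_computable f \<Longrightarrow> partial_computable g \<Longrightarrow>
    partial_computable (\<lambda>x. prim_rec f g (fst (prod_decode x)) (snd (prod_decode x)))"
| pc_mu: "partial_computable f \<Longrightarrow> partial_computable (mu_search f)"

definition computable_set :: "nat set \<Rightarrow> bool" where
  "computable_set A \<longleftrightarrow> partial_computable (\<lambda>x. Some (if x \<in> A then 1 else 0))"

definition computable_rel :: "nat rel \<Rightarrow> bool" where
  "computable_rel R \<longleftrightarrow> computable_set (prod_encode ` R)"

definition ce_set :: "nat set \<Rightarrow> bool" where
  "ce_set W \<longleftrightarrow> (\<exists>f. partial_computable f \<and> W = dom f)"

definition co_ce_set :: "nat set \<Rightarrow> bool" where
  "co_ce_set A \<longleftrightarrow> ce_set (- A)"

definition Sigma2_set :: "nat set \<Rightarrow> bool" where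
  "Sigma2_set A \<longleftrightarrow> (\<exists>R. computable_set R \<and>
     A = {x. \<exists>y. \<forall>z. prod_encode (x, prod_encode (y, z)) \<in> R})"

definition Pi2_set :: "nat set \<Rightarrow> bool" where
  "Pi2_set A \<longleftrightarrow> (\<exists>R. computable_set R \<and>
     A = {x. \<forall>y. \<exists>z. prod_encode (x, prod_encode (y, z)) \<in> R})"

definition almost_subset :: "nat set \<Rightarrow> nat set \<Rightarrow> bool" (infix \<open>\<subseteq>*\<close> 50) where
  "A \<subseteq>* B \<longleftrightarrow> finite (A - B)"

definition cohesive :: "nat set \<Rightarrow> bool" where
  "cohesive C \<longleftrightarrow> infinite C \<and> (\<forall>W. ce_set W \<longrightarrow> finite (C - W) \<or> finite (C \<inter> W))"


section \<open>Linear orders and their order-types\<close>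

text \<open>
  An order is a carrier with a strict relation on it. The carrier is kept explicitly because it
  cannot be recovered from a strict relation (for instance for one-element orders). Equality of
  order-types is isomorphism, and an order-type is given by a concrete representative.
\<close>

record 'a ord_struct =
  elems :: "'a set"
  less_rel :: "'a rel"

definition linear_order_struct :: "'a ord_struct \<Rightarrow> bool" where
  "linear_order_struct M \<longleftrightarrow>
     less_rel M \<subseteq> elems M \<times> elems M \<and> strict_linear_order_on (elems M) (less_rel M)"

definition computable_linear_order :: "nat ord_struct \<Rightarrow> bool" where
  "computable_linear_order M \<longleftrightarrow>
     linear_order_struct M \<and> computable_set (elems M) \<and> computable_rel (less_rel M)"

definition ord_iso :: "'a ord_struct \<Rightarrow> 'b ord_struct \<Rightarrow> bool" (infix \<open>\<simeq>\<close> 50) where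
  "M \<simeq> N \<longleftrightarrow> (\<exists>f. bij_betw f (elems M) (elems N) \<and>
     (\<forall>x\<in>elems M. \<forall>y\<in>elems M. (x, y) \<in> less_rel M \<longleftrightarrow> (f x, f y) \<in> less_rel N))"

definition std_order :: "'a::linorder set \<Rightarrow> 'a ord_struct" where
  "std_order A = \<lparr>elems = A, less_rel = {(x, y). x \<in> A \<and> y \<in> A \<and> x < y}\<rparr>"

definition reverse_order :: "'a ord_struct \<Rightarrow> 'a ord_struct" where
  "reverse_order M = \<lparr>elems = elems M, less_rel = (less_rel M)\<inverse>\<rparr>"

definition copy_order :: "('a \<Rightarrow> 'b) \<Rightarrow> 'a ord_struct \<Rightarrow> 'b ord_struct" where
  "copy_order f M = \<lparr>elems = f ` elems M, less_rel = map_prod f f ` less_rel M\<rparr>"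

definition ord_plus :: "'a ord_struct \<Rightarrow> 'b ord_struct \<Rightarrow> ('a + 'b) ord_struct" (infixr \<open>\<oplus>\<close> 65) where
  "M \<oplus> N = \<lparr>elems = elems M <+> elems N,
     less_rel = map_prod Inl Inl ` less_rel M \<union> map_prod Inr Inr ` less_rel N \<union>
       (Inl ` elems M) \<times> (Inr ` elems N)\<rparr>"

text \<open>Each point \<open>i\<close> of \<open>I\<close> is replaced by a copy of \<open>K i\<close>.\<close>

definition ord_lex_sum :: "'i ord_struct \<Rightarrow> ('i \<Rightarrow> 'a ord_struct) \<Rightarrow> ('i \<times> 'a) ord_struct" where
  "ord_lex_sum I K = \<lparr>elems = (SIGMA i:elems I. elems (K i)),
     less_rel = {((i, x), (j, y)).
       i \<in> elems I \<and> x \<in> elems (K i) \<and> j \<in> elems I \<and> y \<in> elems (K j) \<and>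
       ((i, j) \<in> less_rel I \<or> i = j \<and> (x, y) \<in> less_rel (K i))}\<rparr>"

definition omega :: "nat ord_struct" where "omega = std_order UNIV"
definition zeta :: "int ord_struct" where "zeta = std_order UNIV"
definition eta :: "rat ord_struct" where "eta = std_order UNIV"
definition fin_order :: "nat \<Rightarrow> nat ord_struct" where "fin_order k = std_order {..<k}"

definition alpha :: "(nat + (rat \<times> int) + nat) ord_struct" where
  "alpha = omega \<oplus> ord_lex_sum eta (\<lambda>_. zeta) \<oplus> reverse_order omega"

text \<open>
  In a shuffle the members of \<open>S\<close> serve as the colors themselves. They should represent pairwise
  distinct order-types, on a common element type. The order-type of the result does not depend
  on the coloring chosen by \<open>SOME\<close>, which exists whenever \<open>S\<close> is non-empty and at most countable;
  for other \<open>S\<close> the value of \<open>shuffle S\<close> carries no meaning.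
\<close>

definition dense_coloring :: "'c set \<Rightarrow> (rat \<Rightarrow> 'c) \<Rightarrow> bool" where
  "dense_coloring S c \<longleftrightarrow> range c \<subseteq> S \<and> (\<forall>K\<in>S. \<forall>a b. a < b \<longrightarrow> (\<exists>q. a < q \<and> q < b \<and> c q = K))"

definition shuffle :: "'a ord_struct set \<Rightarrow> (rat \<times> 'a) ord_struct" where
  "shuffle S = ord_lex_sum eta (SOME c. dense_coloring S c)"


section \<open>Cohesive powers\<close>

definition power_funs :: "nat set \<Rightarrow> nat ord_struct \<Rightarrow> (nat \<rightharpoonup> nat) set" where
  "power_funs C M = {\<phi>. partial_computable \<phi> \<and> ran \<phi> \<subseteq> elems M \<and> C \<subseteq>* dom \<phi>}"

definition power_eq :: "nat set \<Rightarrow> nat ord_struct \<Rightarrow> (nat \<rightharpoonup> nat) rel" where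
  "power_eq C M = {(\<phi>, \<psi>). \<phi> \<in> power_funs C M \<and> \<psi> \<in> power_funs C M \<and>
     C \<subseteq>* {x. \<exists>a. \<phi> x = Some a \<and> \<psi> x = Some a}}"

definition cohesive_power :: "nat set \<Rightarrow> nat ord_struct \<Rightarrow> (nat \<rightharpoonup> nat) set ord_struct" where
  "cohesive_power C M = \<lparr>elems = power_funs C M // power_eq C M,
     less_rel = {(power_eq C M `` {\<phi>}, power_eq C M `` {\<psi>}) | \<phi> \<psi>.
       \<phi> \<in> power_funs C M \<and> \<psi> \<in> power_funs C M \<and>
       C \<subseteq>* {x. \<exists>a b. \<phi> x = Some a \<and> \<psi> x = Some b \<and> (a, b) \<in> less_rel M}}\<rparr>"

end

theory Submission
  imports Defs "HOL-Library.Countable_Set"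
begin

text \<open>
  Let \<open>n j\<close> be the \<open>2 * j\<close>-th element of \<open>C\<close>. It is computable from below, and if \<open>u\<close> and \<open>h\<close> are
  computable and \<open>u\<close> tends to infinity along \<open>C\<close>, then \<open>h x \<le> n (u x)\<close> for almost all \<open>x \<in> C\<close>:
  cohesiveness makes \<open>u\<close> eventually increasing on \<open>C\<close>, and makes \<open>C\<close> so sparse that every computable
  function of an element of \<open>C\<close> is exceeded by the next one. No enumeration of the partial
  computable functions is needed.

  The order \<open>M\<close> consists of finite blocks placed at the dyadic rationals \<open>d > 0\<close> whose depth (one less
  than the exponent of the denominator) is at most \<open>n \<lfloor>d\<rfloor>\<close>. There are finitely many of them below each
  integer, so \<open>M\<close> has type \<open>\<omega>\<close>, and being c.e. it has a computable copy. In the cohesive power the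
  constants form the initial \<open>\<omega>\<close>. Any two nonstandard points in different blocks are separated by
  dyadic rationals of every prescribed computable, sufficiently large depth, as \<open>n\<close> dominates these
  depths; so the size of a block is read off its depth in such a way that every wanted size occurs
  densely. For \<open>\<Sigma>\<^sub>2\<close> sets the depth codes \<open>k\<close> with a candidate witness, and the block grows
  from \<open>k\<close> to a size tending to infinity once the witness is refuted within the bound \<open>n\<close>; for
  \<open>\<Pi>\<^sub>2\<close> sets a block of size \<open>k\<close> is inserted only once enough instances have been confirmed
  within \<open>n\<close>. Blocks of nonstandard size have type \<open>\<omega> + \<zeta>\<eta> + \<omega>\<^sup>*\<close>.
\<close>

section \<open>Computable functions\<close>

text \<open>Two demands pull against each other: only finitely many points may lie below each
  integer, yet between any two nonstandard blocks of the power every colour has to occur. A cap on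
  the depths that is finite at each integer but beats all computable functions along
  \<open>C\<close> meets both; such a cap cannot be computable, and sizes that depend on it need not
  be either. Two devices cope with this. A point once enumerated cannot be withdrawn, so sizes may
  only grow with the lower bound for \<open>n\<close> known so far: a refuted guess enlarges its
  block instead of deleting it, whereas a Pi_2 block waits until it is confirmed. And along
  \<open>C\<close> the size of a block that is present agrees almost everywhere with a computable
  function, since \<open>n\<close> exceeds every computably found witness. By cohesiveness that
  function is constant or tends to infinity. Wrong guesses and unbounded codes \<open>k\<close> lead
  to the second case, which accounts for \<alpha>; for finite \<open>X\<close>, membership is
  decidable and the codes are bounded, so that case does not arise.\<close>

abbreviation pi1 :: "nat \<Rightarrow> nat" where "pi1 z \<equiv> fst (prod_decode z)"
abbreviation pi2 :: "nat \<Rightarrow> nat" where "pi2 z \<equiv> snd (prod_decode z)"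

definition computable :: "(nat \<Rightarrow> nat) \<Rightarrow> bool" where
  "computable f \<longleftrightarrow> partial_computable (\<lambda>x. Some (f x))"

definition decidable :: "(nat \<Rightarrow> bool) \<Rightarrow> bool" where
  "decidable P \<longleftrightarrow> computable (\<lambda>x. if P x then 1 else 0)"

definition computable2 :: "(nat \<Rightarrow> nat \<Rightarrow> nat) \<Rightarrow> bool" where
  "computable2 f \<longleftrightarrow> computable (\<lambda>z. f (pi1 z) (pi2 z))"

definition decidable2 :: "(nat \<Rightarrow> nat \<Rightarrow> bool) \<Rightarrow> bool" where
  "decidable2 P \<longleftrightarrow> decidable (\<lambda>z. P (pi1 z) (pi2 z))"

section \<open>Closure of the computable functions under composition, recursion and
  arithmetic\<close>

lemma computable_comp: "computable f \<Longrightarrow> computable g \<Longrightarrow> computable (\<lambda>x. f (g x))"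
  unfolding computable_def using pc_comp[of "\<lambda>x. Some (f x)" "\<lambda>x. Some (g x)"] by simp

lemma computable_pair:
  "computable f \<Longrightarrow> computable g \<Longrightarrow> computable (\<lambda>x. prod_encode (f x, g x))"
  unfolding computable_def using pc_pair[of "\<lambda>x. Some (f x)" "\<lambda>x. Some (g x)"] by simp

lemma computable_Suc: "computable f \<Longrightarrow> computable (\<lambda>x. Suc (f x))"
  using computable_comp[of Suc f] pc_suc by (simp add: computable_def)

lemma computable_pi1: "computable f \<Longrightarrow> computable (\<lambda>x. pi1 (f x))"
  using computable_comp[of pi1 f] pc_fst by (simp add: computable_def)

lemma computable_pi2: "computable f \<Longrightarrow> computable (\<lambda>x. pi2 (f x))"
  using computable_comp[of pi2 f] pc_snd by (simp add: computable_def)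

lemma computable_const: "computable (\<lambda>x. c)"
proof (induction c)
  case 0
  then show ?case using pc_zero by (simp add: computable_def)
next
  case (Suc c)
  then show ?case by (rule computable_Suc)
qed

lemma computable_id: "computable (\<lambda>x. x)"
  using computable_pair[OF computable_pi1 computable_pi2, of "\<lambda>x. x" "\<lambda>x. x"]
    pc_fst pc_snd computable_pair[of pi1 pi2] by (simp add: computable_def)

lemma computable2_comp:
  "computable2 f \<Longrightarrow> computable a \<Longrightarrow> computable b \<Longrightarrow> computable (\<lambda>x. f (a x) (b x))"
  using computable_comp[of "\<lambda>z. f (pi1 z) (pi2 z)" "\<lambda>x. prod_encode (a x, b x)"]
  by (simp add: computable2_def computable_pair)

lemma decidable_comp: "decidable P \<Longrightarrow> computable a \<Longrightarrow> decidable (\<lambda>x. P (a x))"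
  unfolding decidable_def by (rule computable_comp)

lemma decidable2_comp:
  "decidable2 P \<Longrightarrow> computable a \<Longrightarrow> computable b \<Longrightarrow> decidable (\<lambda>x. P (a x) (b x))"
  using decidable_comp[of "\<lambda>z. P (pi1 z) (pi2 z)" "\<lambda>x. prod_encode (a x, b x)"]
  by (simp add: decidable2_def computable_pair)

text \<open>The bridge from Kleene's recursion to the recursor of HOL: below, a function is shown to
  be computable by writing it as a \<open>rec_nat\<close> term whose step may use the parameter, the
  counter and the previous value.\<close>

lemma computable_rec_nat:
  assumes "computable a" "computable n" "computable (\<lambda>z. G (pi1 z) (pi1 (pi2 z)) (pi2 (pi2 z)))"
  shows "computable (\<lambda>x. rec_nat (a x) (G x) (n x))"
proof -
  let ?f = "\<lambda>x. Some (a x)" and ?g = "\<lambda>z. Some (G (pi1 z) (pi1 (pi2 z)) (pi2 (pi2 z)))"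
  have "prim_rec ?f ?g x k = Some (rec_nat (a x) (G x) k)" for x k
    by (induction k) simp_all
  then have "computable (\<lambda>z. rec_nat (a (pi1 z)) (G (pi1 z)) (pi2 z))"
    using pc_rec[of ?f ?g] assms by (simp add: computable_def)
  from computable_comp[OF this computable_pair[OF computable_id assms(2)]] show ?thesis by simp
qed

lemma computable_add:
  assumes "computable f" "computable g" shows "computable (\<lambda>x. f x + g x)"
proof -
  have "rec_nat (f x) (\<lambda>k v. Suc v) n = f x + n" for x n by (induction n) simp_all
  moreover have "computable (\<lambda>x. rec_nat (f x) (\<lambda>k v. Suc v) (g x))"
    by (intro computable_rec_nat assms computable_Suc computable_pi2 computable_id)
  ultimately show ?thesis by simp
qed

lemma computable_mult:
  assumes "computable f" "computable g" shows "computable (\<lambda>x. f x * g x)"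
proof -
  have "rec_nat 0 (\<lambda>k v. v + f x) n = f x * n" for x n by (induction n) simp_all
  moreover have "computable (\<lambda>x. rec_nat 0 (\<lambda>k v. v + f x) (g x))"
    by (intro computable_rec_nat assms computable_const computable_add
        computable_comp[OF assms(1)] computable_pi1 computable_pi2 computable_id)
  ultimately show ?thesis by simp
qed

lemma computable_power:
  assumes "computable f" "computable g" shows "computable (\<lambda>x. f x ^ g x)"
proof -
  have "rec_nat 1 (\<lambda>k v. v * f x) n = f x ^ n" for x n by (induction n) simp_all
  moreover have "computable (\<lambda>x. rec_nat 1 (\<lambda>k v. v * f x) (g x))"
    by (intro computable_rec_nat assms computable_const computable_mult
        computable_comp[OF assms(1)] computable_pi1 computable_pi2 computable_id)
  ultimately show ?thesis by simp
qed

lemma computable_diff: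
  assumes "computable f" "computable g" shows "computable (\<lambda>x. f x - g x)"
proof -
  \<comment> \<open>Truncated subtraction iterates the predecessor, and the predecessor is the
    recursion that returns its counter.\<close>
  have pred: "computable (\<lambda>x. h x - 1)" if "computable h" for h
  proof -
    have "rec_nat 0 (\<lambda>k v. k) n = n - 1" for n :: nat by (induction n) simp_all
    moreover have "computable (\<lambda>x. rec_nat 0 (\<lambda>k v. k) (h x))"
      by (intro computable_rec_nat that computable_const computable_pi1 computable_pi2
          computable_id)
    ultimately show ?thesis by simp
  qed
  have "rec_nat (f x) (\<lambda>k v. v - 1) n = f x - n" for x n by (induction n) simp_all
  moreover have "computable (\<lambda>x. rec_nat (f x) (\<lambda>k v. v - 1) (g x))"
    by (intro computable_rec_nat assms pred computable_pi2 computable_id)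
  ultimately show ?thesis by simp
qed

lemma computable_if:
  assumes "decidable P" "computable f" "computable g"
  shows "computable (\<lambda>x. if P x then f x else g x)"
proof -
  have "(if P x then f x else g x) =
      f x * (if P x then 1 else 0) + g x * (1 - (if P x then 1 else 0))" for x
    by simp
  then show ?thesis
    using assms computable_add computable_mult computable_diff computable_const
    by (simp only: decidable_def)
qed

lemma decidable_not: "decidable P \<Longrightarrow> decidable (\<lambda>x. \<not> P x)"
proof -
  assume "decidable P"
  then have "computable (\<lambda>x. if P x then 0 else 1)" by (intro computable_if computable_const)
  then show ?thesis
    unfolding decidable_def by (rule back_subst[of computable]) auto
qed

lemma decidable_const: "decidable (\<lambda>x. b)"
  unfolding decidable_def by (rule computable_const)

lemma decidable_conj: "decidable P \<Longrightarrow> decidable Q \<Longrightarrow> decidable (\<lambda>x. P x \<and> Q x)"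
proof -
  assume "decidable P" "decidable Q"
  then have "computable (\<lambda>x. if P x then if Q x then 1 else 0 else 0)"
    by (intro computable_if computable_const)
  then show ?thesis
    unfolding decidable_def by (rule back_subst[of computable]) auto
qed

lemma decidable_disj: "decidable P \<Longrightarrow> decidable Q \<Longrightarrow> decidable (\<lambda>x. P x \<or> Q x)"
  using decidable_not[OF decidable_conj[OF decidable_not decidable_not], of P Q]
  by (simp only: de_Morgan_conj not_not)

lemma decidable_imp: "decidable P \<Longrightarrow> decidable Q \<Longrightarrow> decidable (\<lambda>x. P x \<longrightarrow> Q x)"
  using decidable_disj[OF decidable_not, of P Q] by (simp only: imp_conv_disj)

lemma decidable_zero: "computable f \<Longrightarrow> decidable (\<lambda>x. f x = 0)"
proof -
  assume "computable f"
  then have "computable (\<lambda>x. 1 - f x)" by (intro computable_diff computable_const)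
  then show ?thesis
    unfolding decidable_def by (rule back_subst[of computable]) auto
qed

lemma decidable_le: "computable f \<Longrightarrow> computable g \<Longrightarrow> decidable (\<lambda>x. f x \<le> g x)"
  using decidable_zero[OF computable_diff, of f g] by (simp only: diff_is_0_eq)

lemma decidable_less: "computable f \<Longrightarrow> computable g \<Longrightarrow> decidable (\<lambda>x. f x < g x)"
  using decidable_not[OF decidable_le, of g f] by (simp only: not_le)

lemma decidable_eq: "computable f \<Longrightarrow> computable g \<Longrightarrow> decidable (\<lambda>x. f x = g x)"
  using decidable_conj[OF decidable_le decidable_le, of f g g f] by (simp only: eq_iff)

lemmas computable_intros =
  decidable_less decidable_le decidable_eq decidable_not decidable_conj decidable_disj
  decidable_imp computable_if computable_power computable_mult computable_add computable_diff
  computable_Suc computable_pi1 computable_pi2 computable_pair computable_id computable_const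
  decidable_const

text \<open>Counting serves twice: a bounded quantifier compares a count with 0, and the number of
  elements of \<open>C\<close> below a bound is approximated by such counts.\<close>

lemma computable_count:
  assumes "computable b" "decidable2 P"
  shows "computable (\<lambda>x. card {y. y < b x \<and> P x y})"
proof -
  have "rec_nat 0 (\<lambda>k v. if P x k then Suc v else v) n = card {y. y < n \<and> P x y}" for x n
  proof (induction n)
    case (Suc n)
    have "{y. y < Suc n \<and> P x y} =
        (if P x n then insert n {y. y < n \<and> P x y} else {y. y < n \<and> P x y})"
      by (auto simp: less_Suc_eq)
    then show ?case using Suc by simp
  qed simp
  moreover have "computable (\<lambda>x. rec_nat 0 (\<lambda>k v. if P x k then Suc v else v) (b x))"
    by (intro computable_rec_nat assms(1) computable_intros decidable2_comp[OF assms(2)])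
  ultimately show ?thesis by simp
qed

lemma decidable_bex:
  assumes "computable b" "decidable2 P"
  shows "decidable (\<lambda>x. \<exists>y<b x. P x y)"
proof -
  have "(\<exists>y<b x. P x y) \<longleftrightarrow> 0 < card {y. y < b x \<and> P x y}" for x
    by (auto simp: card_gt_0_iff)
  moreover have "decidable (\<lambda>x. 0 < card {y. y < b x \<and> P x y})"
    by (intro decidable_less computable_const computable_count assms)
  ultimately show ?thesis by simp
qed

lemma decidable_ball:
  assumes "computable b" "decidable2 P"
  shows "decidable (\<lambda>x. \<forall>y<b x. P x y)"
proof -
  have "decidable (\<lambda>x. \<not> (\<exists>y<b x. \<not> P x y))"
    by (intro decidable_not decidable_bex assms(1))
      (use assms(2) in \<open>simp only: decidable2_def decidable_not\<close>)
  then show ?thesis by simp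
qed

lemma decidable_bex_le:
  assumes "computable b" "decidable2 P"
  shows "decidable (\<lambda>x. \<exists>y\<le>b x. P x y)"
  using decidable_bex[OF computable_Suc[OF assms(1)] assms(2)] by (simp only: less_Suc_eq_le)

lemma decidable_ball_le:
  assumes "computable b" "decidable2 P"
  shows "decidable (\<lambda>x. \<forall>y\<le>b x. P x y)"
  using decidable_ball[OF computable_Suc[OF assms(1)] assms(2)] by (simp only: less_Suc_eq_le)

text \<open>\<open>mu_search\<close> looks for a zero, hence the inverted truth values; as the
  function searched is total, nothing can block the search before the first witness.\<close>

lemma mu_search_decidable:
  "mu_search (\<lambda>z. Some (if P (pi1 z) (pi2 z) then 0 else 1)) x =
     (if \<exists>n. P x n then Some (LEAST n. P x n) else None)"
proof -
  have *: "mu_zero (\<lambda>z. Some (if P (pi1 z) (pi2 z) then 0 else 1)) x n \<longleftrightarrow>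
      P x n \<and> (\<forall>m<n. \<not> P x m)" for n
    by (auto simp: mu_zero_def)
  have "(\<exists>n. P x n \<and> (\<forall>m<n. \<not> P x m)) \<longleftrightarrow> (\<exists>n. P x n)"
    using exists_least_iff[of "P x"] by blast
  moreover have "(LEAST n. P x n \<and> (\<forall>m<n. \<not> P x m)) = (LEAST n. P x n)" if "\<exists>n. P x n"
    by (rule Least_equality) (use that in \<open>auto intro: LeastI2_ex dest: not_less_Least
       simp: not_less[symmetric]\<close>)
  ultimately show ?thesis unfolding mu_search_def * by auto
qed

lemma partial_computable_search:
  assumes "decidable2 P"
  shows "partial_computable (\<lambda>x. if \<exists>n. P x n then Some (LEAST n. P x n) else None)"
proof -
  have "computable (\<lambda>z. if P (pi1 z) (pi2 z) then 0 else 1)"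
    using assms unfolding decidable2_def by (intro computable_if computable_const)
  then have "partial_computable (mu_search (\<lambda>z. Some (if P (pi1 z) (pi2 z) then 0 else 1)))"
    unfolding computable_def by (rule pc_mu)
  then show ?thesis by (simp only: mu_search_decidable[abs_def])
qed

lemma computable_Least:
  assumes "decidable2 P" "\<And>x. \<exists>n. P x n"
  shows "computable (\<lambda>x. LEAST n. P x n)"
  using partial_computable_search[OF assms(1)] assms(2) by (simp add: computable_def)

lemma computable_div:
  assumes "computable f" "computable g"
  shows "computable (\<lambda>x. f x div g x)"
proof -
  \<comment> \<open>The disjunct \<open>g x = 0\<close> makes the search stop at 0, the value of a
    division by zero in HOL.\<close>
  let ?P = "\<lambda>x q. g x = 0 \<or> f x < Suc q * g x"
  have "decidable2 ?P" unfolding decidable2_def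
    by (intro computable_intros computable_comp[OF assms(1)] computable_comp[OF assms(2)])
  moreover have *: "(LEAST q. ?P x q) = f x div g x" for x
  proof (cases "g x = 0")
    case False
    show ?thesis
    proof (rule Least_equality)
      show "?P x (f x div g x)" using False dividend_less_div_times[of "g x" "f x"]
        by (simp add: add.commute mult.commute)
      fix q assume "?P x q"
      then show "f x div g x \<le> q"
        using False by (metis less_mult_imp_div_less less_Suc_eq_le)
    qed
  qed (simp add: Least_equality)
  moreover have "\<exists>q. ?P x q" for x
    by (rule exI[of _ "f x"]) (cases "g x", auto)
  ultimately show ?thesis using computable_Least[of ?P] by simp
qed

text \<open>A step-bounded evaluator: \<open>F x t\<close> is \<open>Suc y\<close> if the value \<open>y\<close> is found within \<open>t\<close> steps, and
  \<open>0\<close> otherwise.\<close>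

definition approximates :: "(nat \<Rightarrow> nat \<Rightarrow> nat) \<Rightarrow> (nat \<rightharpoonup> nat) \<Rightarrow> bool" where
  "approximates F f \<longleftrightarrow> computable2 F \<and> (\<forall>x t y. F x t = Suc y \<longrightarrow> f x = Some y) \<and>
     (\<forall>x y. f x = Some y \<longrightarrow> (\<forall>\<^sub>F t in sequentially. F x t = Suc y))"

lemma approximatesI:
  assumes "computable2 F" "\<And>x t y. F x t = Suc y \<Longrightarrow> f x = Some y"
    "\<And>x y. f x = Some y \<Longrightarrow> \<forall>\<^sub>F t in sequentially. F x t = Suc y"
  shows "approximates F f"
  using assms by (simp add: approximates_def)

lemma approximatesD:
  assumes "approximates F f"
  shows "computable2 F" "F x t = Suc y \<Longrightarrow> f x = Some y"
    "f x = Some y \<Longrightarrow> \<forall>\<^sub>F t in sequentially. F x t = Suc y"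
  using assms by (auto simp: approximates_def)

lemma approximates_total: "computable f \<Longrightarrow> approximates (\<lambda>x t. Suc (f x)) (\<lambda>x. Some (f x))"
  by (rule approximatesI)
    (auto simp: computable2_def intro!: computable_intros computable_comp[of f])

lemma approximates_pair:
  assumes F: "approximates F f" and G: "approximates G g"
  shows "approximates
      (\<lambda>x t. if F x t = 0 \<or> G x t = 0 then 0 else Suc (prod_encode (F x t - 1, G x t - 1)))
      (\<lambda>x. Option.bind (f x) (\<lambda>a. Option.bind (g x) (\<lambda>b. Some (prod_encode (a, b)))))"
proof (rule approximatesI)
  show "computable2
      (\<lambda>x t. if F x t = 0 \<or> G x t = 0 then 0 else Suc (prod_encode (F x t - 1, G x t - 1)))"
    unfolding computable2_def
    by (intro computable_intros computable2_comp[OF approximatesD(1)[OF F]]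
        computable2_comp[OF approximatesD(1)[OF G]])
next
  fix x t y
  assume "(if F x t = 0 \<or> G x t = 0 then 0 else Suc (prod_encode (F x t - 1, G x t - 1))) = Suc y"
  then obtain a b where "F x t = Suc a" "G x t = Suc b" "y = prod_encode (a, b)"
    by (cases "F x t"; cases "G x t") auto
  then show "Option.bind (f x) (\<lambda>a. Option.bind (g x) (\<lambda>b. Some (prod_encode (a, b)))) = Some y"
    using approximatesD(2)[OF F] approximatesD(2)[OF G] by simp
next
  fix x y
  assume "Option.bind (f x) (\<lambda>a. Option.bind (g x) (\<lambda>b. Some (prod_encode (a, b)))) = Some y"
  then obtain a b where "f x = Some a" "g x = Some b" "y = prod_encode (a, b)"
    by (auto simp: bind_eq_Some_conv)
  then show "\<forall>\<^sub>F t in sequentially.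
      (if F x t = 0 \<or> G x t = 0 then 0 else Suc (prod_encode (F x t - 1, G x t - 1))) = Suc y"
    using eventually_conj[OF approximatesD(3)[OF F, of x a] approximatesD(3)[OF G, of x b]]
    by (auto elim: eventually_mono)
qed

lemma approximates_comp:
  assumes F: "approximates F f" and G: "approximates G g"
  shows "approximates (\<lambda>x t. if G x t = 0 then 0 else F (G x t - 1) t) (\<lambda>x. Option.bind (g x) f)"
proof (rule approximatesI)
  show "computable2 (\<lambda>x t. if G x t = 0 then 0 else F (G x t - 1) t)"
    unfolding computable2_def
    by (intro computable_intros computable2_comp[OF approximatesD(1)[OF F]]
        computable2_comp[OF approximatesD(1)[OF G]])
next
  fix x t y
  assume "(if G x t = 0 then 0 else F (G x t - 1) t) = Suc y"
  then obtain b where "G x t = Suc b" "F b t = Suc y" by (cases "G x t") auto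
  then show "Option.bind (g x) f = Some y"
    using approximatesD(2)[OF F] approximatesD(2)[OF G] by simp
next
  fix x y
  assume "Option.bind (g x) f = Some y"
  then obtain b where "g x = Some b" "f b = Some y"
    by (auto simp: bind_eq_Some_conv)
  then show "\<forall>\<^sub>F t in sequentially. (if G x t = 0 then 0 else F (G x t - 1) t) = Suc y"
    using eventually_conj[OF approximatesD(3)[OF F, of b y] approximatesD(3)[OF G, of x b]]
    by (auto elim: eventually_mono)
qed

text \<open>An unfinished round has the value 0, which the guard \<open>v = 0\<close> hands on to
  all later rounds. Only finitely many evaluations enter a given value, so all of them are finished
  from some \<open>t\<close> on.\<close>

lemma approximates_rec:
  assumes F: "approximates F f" and G: "approximates G g"
  defines "H \<equiv> (\<lambda>a t. rec_nat (F a t)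
      (\<lambda>k v. if v = 0 then 0 else G (prod_encode (a, prod_encode (k, v - 1))) t))"
  shows "approximates (\<lambda>x t. H (pi1 x) t (pi2 x)) (\<lambda>x. prim_rec f g (pi1 x) (pi2 x))"
proof (rule approximatesI)
  show "computable2 (\<lambda>x t. H (pi1 x) t (pi2 x))"
    unfolding computable2_def H_def
    by (intro computable_rec_nat computable_intros computable2_comp[OF approximatesD(1)[OF F]]
        computable2_comp[OF approximatesD(1)[OF G]])
next
  have "H a t k = Suc y \<Longrightarrow> prim_rec f g a k = Some y" for a t k y
  proof (induction k arbitrary: y)
    case 0
    then show ?case using approximatesD(2)[OF F] by (simp add: H_def)
  next
    case (Suc k)
    then obtain v where "H a t k = Suc v" "G (prod_encode (a, prod_encode (k, v))) t = Suc y"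
      by (cases "H a t k") (auto simp: H_def)
    then show ?case using Suc.IH approximatesD(2)[OF G] by simp
  qed
  then show "H (pi1 x) t (pi2 x) = Suc y \<Longrightarrow> prim_rec f g (pi1 x) (pi2 x) = Some y" for x t y .
  have "prim_rec f g a k = Some y \<Longrightarrow> \<forall>\<^sub>F t in sequentially. H a t k = Suc y" for a k y
  proof (induction k arbitrary: y)
    case 0
    then show ?case using approximatesD(3)[OF F] by (simp add: H_def)
  next
    case (Suc k)
    then obtain v where v: "prim_rec f g a k = Some v"
        "g (prod_encode (a, prod_encode (k, v))) = Some y"
      by (auto simp: bind_eq_Some_conv)
    show ?case
      using Suc.IH[OF v(1)] approximatesD(3)[OF G v(2)]
      by eventually_elim (simp add: H_def)
  qed
  then show "prim_rec f g (pi1 x) (pi2 x) = Some y \<Longrightarrow>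
      \<forall>\<^sub>F t in sequentially. H (pi1 x) t (pi2 x) = Suc y" for x y .
qed

text \<open>In the shifted coding 1 stands for the result 0 and anything above 1 for a positive
  result, so \<open>Q x t n\<close> says that \<open>t\<close> steps establish \<open>n\<close> as
  the first zero. The disjunct \<open>t \<le> n\<close> gives the least-number operator a witness
  for all arguments, as \<open>computable_Least\<close> demands.\<close>

lemma approximates_mu:
  assumes F: "approximates F f"
  defines "Q \<equiv> (\<lambda>x t n. F (prod_encode (x, n)) t = 1 \<and> (\<forall>m<n. 1 < F (prod_encode (x, m)) t))"
  shows "approximates (\<lambda>x t. if \<exists>n<t. Q x t n then Suc (LEAST n. t \<le> n \<or> Q x t n) else 0)
    (mu_search f)"
proof (rule approximatesI)
  have Q: "decidable (\<lambda>z. Q (a z) (b z) (c z))"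
    if "computable a" "computable b" "computable c" for a b c
    unfolding Q_def using that
    by (intro computable_intros decidable_ball computable2_comp[OF approximatesD(1)[OF F]])
      (auto simp: decidable2_def intro!: computable_intros
        computable2_comp[OF approximatesD(1)[OF F]] computable_comp[of a] computable_comp[of b])
  show "computable2 (\<lambda>x t. if \<exists>n<t. Q x t n then Suc (LEAST n. t \<le> n \<or> Q x t n) else 0)"
    unfolding computable2_def
    by (intro computable_intros decidable_bex computable_Least exI[of _ "pi2 _"])
      (auto simp: decidable2_def intro!: computable_intros Q)
next
  have Q_zero: "mu_zero f x n" if "Q x t n" for x t n
    unfolding mu_zero_def
  proof (intro conjI allI impI)
    show "f (prod_encode (x, n)) = Some 0"
      using that approximatesD(2)[OF F, of "prod_encode (x, n)" t 0] by (simp add: Q_def)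
    fix m assume "m < n"
    then have "1 < F (prod_encode (x, m)) t" using that by (simp add: Q_def)
    then obtain v where "F (prod_encode (x, m)) t = Suc (Suc v)"
      by (metis One_nat_def less_iff_Suc_add add_Suc)
    then show "\<exists>v. f (prod_encode (x, m)) = Some (Suc v)"
      using approximatesD(2)[OF F] by blast
  qed
  have zero_unique: "n = n'" if "mu_zero f x n" "mu_zero f x n'" for x n n'
    using that unfolding mu_zero_def
    by (metis Zero_neq_Suc linorder_neqE_nat option.inject)
  have search: "mu_search f x = Some y \<longleftrightarrow> mu_zero f x y" for x y
    unfolding mu_search_def by (auto dest: zero_unique intro: LeastI Least_equality)
  have Least: "(LEAST n. t \<le> n \<or> Q x t n) = y" if "Q x t y" "y < t" for x t y
    by (rule Least_equality) (use that in \<open>auto dest!: Q_zero dest: zero_unique\<close>)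
  show "mu_search f x = Some y"
    if "(if \<exists>n<t. Q x t n then Suc (LEAST n. t \<le> n \<or> Q x t n) else 0) = Suc y" for x t y
    using that Least Q_zero unfolding search by (auto split: if_splits)
  show "\<forall>\<^sub>F t in sequentially.
      (if \<exists>n<t. Q x t n then Suc (LEAST n. t \<le> n \<or> Q x t n) else 0) = Suc y"
    if "mu_search f x = Some y" for x y
  proof -
    have zero: "mu_zero f x y" using that by (simp add: search)
    have "\<forall>\<^sub>F t in sequentially. 1 < F (prod_encode (x, m)) t" if m: "m < y" for m
    proof -
      obtain v where "f (prod_encode (x, m)) = Some (Suc v)"
        using zero m by (auto simp: mu_zero_def)
      from approximatesD(3)[OF F this] show ?thesis by eventually_elim simp
    qed
    then have "\<forall>\<^sub>F t in sequentially. \<forall>m\<in>{..<y}. 1 < F (prod_encode (x, m)) t"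
      by (intro eventually_ball_finite) auto
    moreover have "\<forall>\<^sub>F t in sequentially. F (prod_encode (x, y)) t = 1"
      using approximatesD(3)[OF F] zero by (simp add: mu_zero_def)
    moreover have "\<forall>\<^sub>F t in sequentially. y < t" by (rule eventually_gt_at_top)
    ultimately show ?thesis
    proof eventually_elim
      case (elim t)
      then have "Q x t y" by (simp add: Q_def)
      then show ?case using Least elim by auto
    qed
  qed
qed

text \<open>The evaluator follows the construction of \<open>f\<close>, one for each
  \<open>f\<close>. It makes halting visible by stages, which the inductive definition alone does
  not.\<close>

lemma partial_computable_approximates:
  "partial_computable f \<Longrightarrow> \<exists>F. approximates F f"
proof (induction rule: partial_computable.induct)
  case pc_zero
  then show ?case using approximates_total[OF computable_const] by blast
next
  case pc_suc
  then show ?case using approximates_total[OF computable_Suc[OF computable_id]] by blast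
next
  case pc_fst
  then show ?case using approximates_total[OF computable_pi1[OF computable_id]] by blast
next
  case pc_snd
  then show ?case using approximates_total[OF computable_pi2[OF computable_id]] by blast
qed (use approximates_pair approximates_comp approximates_rec approximates_mu in blast)+

section \<open>Semidecidable predicates and c.e. sets\<close>

definition semidecidable :: "(nat \<Rightarrow> bool) \<Rightarrow> bool" where
  "semidecidable P \<longleftrightarrow> (\<exists>R. decidable2 R \<and> (\<forall>x. P x \<longleftrightarrow> (\<exists>s. R x s)))"

lemma semidecidableI: "decidable2 R \<Longrightarrow> (\<And>x. P x \<longleftrightarrow> (\<exists>s. R x s)) \<Longrightarrow> semidecidable P"
  by (auto simp: semidecidable_def)

lemma decidable_semidecidable: "decidable P \<Longrightarrow> semidecidable P"
  by (rule semidecidableI[of "\<lambda>x s. P x"])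
    (auto simp: decidable2_def intro!: decidable_comp[of P] computable_intros)

text \<open>The normal form of c.e. sets: halting is halting at some stage, and conversely a search
  for a witness halts exactly on the set.\<close>

lemma ce_set_iff_semidecidable: "ce_set W \<longleftrightarrow> semidecidable (\<lambda>x. x \<in> W)"
proof
  assume "ce_set W"
  then obtain f where f: "partial_computable f" "W = dom f" by (auto simp: ce_set_def)
  then obtain F where F: "approximates F f" using partial_computable_approximates by blast
  have "x \<in> W \<longleftrightarrow> (\<exists>t. F x t \<noteq> 0)" for x
  proof
    assume "x \<in> W"
    then obtain y where "f x = Some y" using f by auto
    from approximatesD(3)[OF F this] obtain t where "F x t = Suc y"
      by (auto simp: eventually_sequentially)
    then show "\<exists>t. F x t \<noteq> 0" by (intro exI[of _ t]) simp
  next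
    assume "\<exists>t. F x t \<noteq> 0"
    then obtain t y where "F x t = Suc y" by (auto simp: not0_implies_Suc gr0_conv_Suc)
    then show "x \<in> W" using approximatesD(2)[OF F] f by auto
  qed
  moreover have "decidable2 (\<lambda>x t. F x t \<noteq> 0)"
    unfolding decidable2_def
    by (intro computable_intros computable2_comp[OF approximatesD(1)[OF F]])
  ultimately show "semidecidable (\<lambda>x. x \<in> W)" by (auto intro: semidecidableI)
next
  assume "semidecidable (\<lambda>x. x \<in> W)"
  then obtain R where R: "decidable2 R" "\<And>x. x \<in> W \<longleftrightarrow> (\<exists>s. R x s)"
    by (auto simp: semidecidable_def)
  have "W = dom (\<lambda>x. if \<exists>n. R x n then Some (LEAST n. R x n) else None)"
    using R(2) by (auto split: if_splits)
  then show "ce_set W"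
    unfolding ce_set_def using partial_computable_search[OF R(1)] by blast
qed

text \<open>Syntax for counting: every partial computable function is the value of some program, and
  the datatype is countable. The back-and-forth argument rests on this countability.\<close>

datatype program = Zero | Succ | Fst | Snd | Pair program program | Comp program program
  | Rec program program | Mu program

instance program :: countable by countable_datatype

primrec run :: "program \<Rightarrow> nat \<rightharpoonup> nat" where
  "run Zero = (\<lambda>x. Some 0)"
| "run Succ = (\<lambda>x. Some (Suc x))"
| "run Fst = (\<lambda>x. Some (pi1 x))"
| "run Snd = (\<lambda>x. Some (pi2 x))"
| "run (Pair p q) =
    (\<lambda>x. Option.bind (run p x) (\<lambda>a. Option.bind (run q x) (\<lambda>b. Some (prod_encode (a, b)))))"
| "run (Comp p q) = (\<lambda>x. Option.bind (run q x) (run p))"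
| "run (Rec p q) = (\<lambda>x. prim_rec (run p) (run q) (pi1 x) (pi2 x))"
| "run (Mu p) = mu_search (run p)"

lemma countable_partial_computable: "countable {f. partial_computable f}"
proof -
  have "partial_computable f \<Longrightarrow> \<exists>p. f = run p" for f
  proof (induction rule: partial_computable.induct)
    case pc_zero
    show ?case by (rule exI[of _ Zero]) simp
  next
    case pc_suc
    show ?case by (rule exI[of _ Succ]) simp
  next
    case pc_fst
    show ?case by (rule exI[of _ Fst]) simp
  next
    case pc_snd
    show ?case by (rule exI[of _ Snd]) simp
  next
    case (pc_pair f g)
    then obtain p q where "f = run p" "g = run q" by blast
    then show ?case by (intro exI[of _ "Pair p q"]) simp
  next
    case (pc_comp f g)
    then obtain p q where "f = run p" "g = run q" by blast
    then show ?case by (intro exI[of _ "Comp p q"]) simp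
  next
    case (pc_rec f g)
    then obtain p q where "f = run p" "g = run q" by blast
    then show ?case by (intro exI[of _ "Rec p q"]) simp
  next
    case (pc_mu f)
    then obtain p where "f = run p" by blast
    then show ?case by (intro exI[of _ "Mu p"]) simp
  qed
  then have "{f. partial_computable f} \<subseteq> range run" by auto
  then show ?thesis by (rule countable_subset) simp
qed

lemma countable_computable: "countable {f. computable f}"
proof -
  have "inj (\<lambda>f x. Some (f x))" by (auto simp: inj_def fun_eq_iff)
  moreover have "(\<lambda>f x. Some (f x)) ` {f. computable f} \<subseteq> {f. partial_computable f}"
    by (auto simp: computable_def)
  then have "countable ((\<lambda>f x. Some (f x)) ` {f. computable f})"
    by (rule countable_subset) (rule countable_partial_computable)
  ultimately show ?thesis by (auto dest: countable_image_inj_on intro: inj_on_subset)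
qed

section \<open>The cohesive filter\<close>

locale co_ce_cohesive =
  fixes C :: "nat set"
  assumes co_ce: "co_ce_set C" and cohesive: "cohesive C"
begin

text \<open>\<open>eventually\<close> for this filter means almost everywhere on \<open>C\<close>,
  so that the cohesive power becomes a reduced power restricted to partial computable
  functions.\<close>

definition cohesive_filter :: "nat filter" where
  "cohesive_filter = inf cofinite (principal C)"

lemma eventually_cohesive:
  "eventually P cohesive_filter \<longleftrightarrow> finite {x \<in> C. \<not> P x}"
  by (simp add: cohesive_filter_def eventually_inf_principal eventually_cofinite)

lemma infinite_C: "infinite C"
  using cohesive by (simp add: cohesive_def)

lemma cohesive_filter_neq_bot [simp]: "cohesive_filter \<noteq> bot"
  using infinite_C by (simp add: trivial_limit_def eventually_cohesive)

text \<open>Cohesiveness makes the filter act as an ultrafilter on semidecidable predicates. This is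
  the source of the case distinctions that hold almost everywhere.\<close>

lemma eventually_dichotomy:
  assumes "semidecidable P"
  shows "eventually P cohesive_filter \<or> (\<forall>\<^sub>F x in cohesive_filter. \<not> P x)"
proof -
  have "ce_set {x. P x}" using assms by (simp add: ce_set_iff_semidecidable)
  then have "finite (C - {x. P x}) \<or> finite (C \<inter> {x. P x})"
    using cohesive by (simp add: cohesive_def)
  then show ?thesis by (simp add: eventually_cohesive set_diff_eq Int_def)
qed

lemma eventually_dichotomy':
  assumes "decidable P"
  shows "eventually P cohesive_filter \<or> (\<forall>\<^sub>F x in cohesive_filter. \<not> P x)"
  by (intro eventually_dichotomy decidable_semidecidable assms)

lemma not_eventually_iff:
  assumes "decidable P"
  shows "(\<not> eventually P cohesive_filter) \<longleftrightarrow> (\<forall>\<^sub>F x in cohesive_filter. \<not> P x)"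
proof
  assume "\<forall>\<^sub>F x in cohesive_filter. \<not> P x"
  then show "\<not> eventually P cohesive_filter"
    using eventually_conj[of "\<lambda>x. \<not> P x" cohesive_filter P] by (auto simp: eventually_False)
qed (use eventually_dichotomy'[OF assms] in blast)

text \<open>\<open>enum_complement x s\<close>: the element \<open>x\<close> is enumerated into the complement of \<open>C\<close> at
  stage \<open>s\<close>.\<close>

definition enum_complement :: "nat \<Rightarrow> nat \<Rightarrow> bool" where
  "enum_complement = (SOME R. decidable2 R \<and> (\<forall>x. x \<notin> C \<longleftrightarrow> (\<exists>s. R x s)))"

lemma enum_complement:
  shows decidable_enum_complement: "decidable2 enum_complement"
    and notin_C_iff: "x \<notin> C \<longleftrightarrow> (\<exists>s. enum_complement x s)"
proof -
  have "\<exists>R. decidable2 R \<and> (\<forall>x. x \<notin> C \<longleftrightarrow> (\<exists>s. R x s))"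
    using co_ce by (simp add: co_ce_set_def ce_set_iff_semidecidable semidecidable_def)
  from someI_ex[OF this] show "decidable2 enum_complement"
    "x \<notin> C \<longleftrightarrow> (\<exists>s. enum_complement x s)"
    unfolding enum_complement_def by blast+
qed

text \<open>Decidable supersets that decrease to \<open>C\<close>.\<close>

definition C_stage :: "nat \<Rightarrow> nat set" where
  "C_stage s = {x. \<forall>t\<le>s. \<not> enum_complement x t}"

lemma C_subset_stage: "C \<subseteq> C_stage s"
  using notin_C_iff by (auto simp: C_stage_def)

text \<open>Elements only leave, so on each finite initial segment the approximation is final from
  some stage on.\<close>

lemma C_stage_settles: "\<exists>s. \<forall>x<v. x \<in> C_stage s \<longleftrightarrow> x \<in> C"
proof (induction v)
  case (Suc v)
  then obtain s where s: "\<forall>x<v. x \<in> C_stage s \<longleftrightarrow> x \<in> C" by blast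
  obtain t where t: "v \<in> C_stage t \<longleftrightarrow> v \<in> C"
    using notin_C_iff[of v] by (auto simp: C_stage_def)
  have "C_stage (max s t) \<subseteq> C_stage s" "C_stage (max s t) \<subseteq> C_stage t"
    by (auto simp: C_stage_def)
  then have "\<forall>x<Suc v. x \<in> C_stage (max s t) \<longleftrightarrow> x \<in> C"
    using s t C_subset_stage[of "max s t"] unfolding less_Suc_eq by blast
  then show ?case by blast
qed simp

lemma decidable_C_stage:
  "computable f \<Longrightarrow> computable g \<Longrightarrow> decidable (\<lambda>z. f z \<in> C_stage (g z))"
  unfolding C_stage_def mem_Collect_eq
  by (intro decidable_ball_le)
    (auto simp: decidable2_def intro!: decidable_not decidable2_comp[OF decidable_enum_complement]
      computable_intros computable_comp[of f])

text \<open>Membership in \<open>C\<close> occurs negatively, so the condition is existential in the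
  stage, and one stage settles the finitely many \<open>y < x\<close>. This makes records and
  sparseness subject to \<open>eventually_dichotomy\<close>.\<close>

lemma semidecidable_ball_C:
  assumes "decidable2 D"
  shows "semidecidable (\<lambda>x. \<forall>y<x. y \<in> C \<longrightarrow> D x y)"
proof (rule semidecidableI)
  show "decidable2 (\<lambda>x s. \<forall>y<x. y \<in> C_stage s \<longrightarrow> D x y)"
    unfolding decidable2_def
    by (intro decidable_ball computable_intros)
      (auto simp: decidable2_def intro!: computable_intros decidable_C_stage
        decidable2_comp[OF assms])
  show "(\<forall>y<x. y \<in> C \<longrightarrow> D x y) \<longleftrightarrow> (\<exists>s. \<forall>y<x. y \<in> C_stage s \<longrightarrow> D x y)" for x
    using C_stage_settles[of x] C_subset_stage by blast
qed

text \<open>Searching until either a witness or the escape of \<open>x\<close> from \<open>C\<close> is found makes a partial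
  search total; this is where \<open>C\<close> being co-c.e. is used.\<close>

lemma computable_choice:
  assumes "decidable2 P" "\<forall>\<^sub>F x in cohesive_filter. \<exists>t. P x t"
  obtains g where "computable g" "\<forall>\<^sub>F x in cohesive_filter. P x (g x)"
proof -
  have "finite {x \<in> C. \<not> (\<exists>t. P x t)}" using assms(2) by (simp add: eventually_cohesive)
  then obtain N where N: "x \<le> N" if "x \<in> C" "\<nexists>t. P x t" for x
    unfolding finite_nat_set_iff_bounded_le by blast
  let ?Q = "\<lambda>x t. P x t \<or> enum_complement x t \<or> x \<le> N"
  define g where "g = (\<lambda>x. LEAST t. ?Q x t)"
  have ex: "\<exists>t. ?Q x t" for x using N[of x] notin_C_iff[of x] by blast
  have "computable g"
    unfolding g_def
    by (intro computable_Least ex)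
      (auto simp: decidable2_def intro!: computable_intros decidable2_comp[OF assms(1)]
        decidable2_comp[OF decidable_enum_complement])
  moreover have "\<forall>\<^sub>F x in cohesive_filter. P x (g x)"
    unfolding eventually_cohesive
  proof (rule finite_subset)
    have "P x (g x) \<or> enum_complement x (g x) \<or> x \<le> N" for x
      unfolding g_def using ex[of x] by (rule LeastI_ex)
    then show "{x \<in> C. \<not> P x (g x)} \<subseteq> {..N}" using notin_C_iff by blast
  qed simp
  ultimately show thesis using that by blast
qed

section \<open>Computable functions along \<open>C\<close>: boundedness, growth and gaps\<close>

lemma eventually_constI:
  assumes "computable g" "finite B" "\<forall>\<^sub>F x in cohesive_filter. g x \<in> B"
  obtains b where "b \<in> B" "\<forall>\<^sub>F x in cohesive_filter. g x = b"
  using assms(2,3)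
proof (induction B arbitrary: thesis)
  case empty
  then show ?case by (simp add: eventually_False)
next
  case (insert b B)
  show ?case
  proof (cases "\<forall>\<^sub>F x in cohesive_filter. g x = b")
    case True
    then show ?thesis using insert by blast
  next
    case False
    then have "\<forall>\<^sub>F x in cohesive_filter. g x \<noteq> b"
      using not_eventually_iff decidable_eq[OF assms(1) computable_const] by blast
    then have "\<forall>\<^sub>F x in cohesive_filter. g x \<in> B"
      using insert.prems(2) by eventually_elim auto
    then show ?thesis using insert by blast
  qed
qed

text \<open>In the power of \<omega>, every element is standard or exceeds all standard ones:
  failing to tend to infinity means a bound almost everywhere, and a bounded value is
  constant.\<close>

lemma eventually_const_or_at_top:
  assumes "computable g"
  obtains k where "\<forall>\<^sub>F x in cohesive_filter. g x = k" | "filterlim g at_top cohesive_filter"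
proof (cases "filterlim g at_top cohesive_filter")
  case False
  then obtain Z where "\<not> (\<forall>\<^sub>F x in cohesive_filter. Z \<le> g x)"
    by (auto simp: filterlim_at_top)
  then have "\<forall>\<^sub>F x in cohesive_filter. g x \<in> {..<Z}"
    using not_eventually_iff[OF decidable_le[OF computable_const assms]] by (simp add: not_le)
  from eventually_constI[OF assms _ this] show ?thesis using that by blast
qed (use that in blast)

lemma not_at_top_if_eventually_eq:
  assumes "\<forall>\<^sub>F x in cohesive_filter. g x = (k::nat)"
  shows "\<not> filterlim g at_top cohesive_filter"
proof
  assume "filterlim g at_top cohesive_filter"
  then have "\<forall>\<^sub>F x in cohesive_filter. Suc k \<le> g x" by (auto simp: filterlim_at_top)
  with assms have "\<forall>\<^sub>F x in cohesive_filter. False" by eventually_elim simp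
  then show False by (simp add: eventually_False)
qed

lemma filterlim_ident: "filterlim (\<lambda>x. x) at_top cohesive_filter"
  unfolding filterlim_at_top eventually_cohesive
  by (auto intro!: finite_subset[of _ "{..<_}"] simp: not_le)

text \<open>Being a record is semidecidable, so unless almost all elements of \<open>C\<close> are
  records, only finitely many are; but \<open>u\<close> is unbounded on \<open>C\<close> and hence
  sets records without end.\<close>

lemma eventually_records:
  assumes u: "computable u" and lim: "filterlim u at_top cohesive_filter"
  shows "\<forall>\<^sub>F x in cohesive_filter. \<forall>y<x. y \<in> C \<longrightarrow> u y < u x"
proof (rule ccontr)
  let ?V = "\<lambda>x. \<forall>y<x. y \<in> C \<longrightarrow> u y < u x"
  have "semidecidable ?V"
    by (rule semidecidable_ball_C)
      (auto simp: decidable2_def intro!: computable_intros computable_comp[OF u])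
  moreover assume "\<not> eventually ?V cohesive_filter"
  ultimately have "\<forall>\<^sub>F x in cohesive_filter. \<not> ?V x" using eventually_dichotomy by blast
  then have "finite {x \<in> C. ?V x}" by (simp only: eventually_cohesive not_not)
  then obtain N where N: "x \<le> N" if "x \<in> C" "?V x" for x
    unfolding finite_nat_set_iff_bounded_le by blast
  obtain b where b: "u y \<le> b" if "y \<le> N" for y
    using finite_nat_set_iff_bounded_le[of "u ` {..N}"] by auto
  have "\<exists>x. x \<in> C \<and> b < u x"
  proof (rule ccontr)
    assume "\<nexists>x. x \<in> C \<and> b < u x"
    moreover have "\<forall>\<^sub>F x in cohesive_filter. Suc b \<le> u x"
      using lim by (auto simp: filterlim_at_top)
    ultimately have "C \<subseteq> {x \<in> C. \<not> Suc b \<le> u x}" by (auto simp: Suc_le_eq)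
    with \<open>\<forall>\<^sub>F x in cohesive_filter. Suc b \<le> u x\<close> show False
      using infinite_C finite_subset by (auto simp: eventually_cohesive)
  qed
  then obtain x where x: "x \<in> C" "b < u x" and min: "\<And>y. y < x \<Longrightarrow> \<not> (y \<in> C \<and> b < u y)"
    using exists_least_iff[of "\<lambda>x. x \<in> C \<and> b < u x"] by blast
  \<comment> \<open>The first element of \<open>C\<close> at which \<open>u\<close> exceeds the
    bound \<open>b\<close> for its values up to \<open>N\<close> is a record, yet it lies beyond
    \<open>N\<close>.\<close>
  have "?V x" using min x by (meson le_less_trans not_less)
  then have "x \<le> N" using N x by blast
  then show False using b[of x] x by simp
qed

lemma computable_sum:
  assumes "computable h" "computable n"
  shows "computable (\<lambda>x. sum h {..<n x})"
proof -
  have "rec_nat 0 (\<lambda>k v. v + h k) m = sum h {..<m}" for m by (induction m) simp_all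
  moreover have "computable (\<lambda>x. rec_nat 0 (\<lambda>k v. v + h k) (n x))"
    by (intro computable_rec_nat assms(2) computable_intros computable_comp[OF assms(1)])
  ultimately show ?thesis by simp
qed

text \<open>Otherwise \<open>C\<close> would eventually meet each of the computably given intervals
  \<open>{t i..<t (Suc i)}\<close>, and the parity of the interval would split \<open>C\<close> into two infinite parts.\<close>

lemma eventually_sparse:
  assumes h: "computable h"
  shows "\<forall>\<^sub>F x in cohesive_filter. \<forall>y<x. y \<in> C \<longrightarrow> h y < x"
proof (rule ccontr)
  let ?V = "\<lambda>x. \<forall>y<x. y \<in> C \<longrightarrow> h y < x"
  have "semidecidable ?V"
    by (rule semidecidable_ball_C)
      (auto simp: decidable2_def intro!: computable_intros computable_comp[OF h])
  moreover assume "\<not> eventually ?V cohesive_filter"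
  ultimately have "\<forall>\<^sub>F x in cohesive_filter. \<not> ?V x" using eventually_dichotomy by blast
  then have "finite {x \<in> C. ?V x}" by (simp only: eventually_cohesive not_not)
  then obtain N where N: "x \<le> N" if "x \<in> C" "?V x" for x
    unfolding finite_nat_set_iff_bounded_le by blast
  \<comment> \<open>The sum is a computable bound for all \<open>h y\<close> with
    \<open>y < v\<close>, so \<open>t (Suc i)\<close> exceeds every value of \<open>h\<close> below
    \<open>t i\<close>.\<close>
  define t where "t = rec_nat 0 (\<lambda>i v. Suc (v + sum h {..<v}))"
  have t_Suc: "t (Suc i) = Suc (t i + sum h {..<t i})" for i by (simp add: t_def)
  have t: "computable t"
    unfolding t_def by (intro computable_rec_nat computable_sum h computable_intros)
  have mono: "strict_mono t" by (rule strict_mono_Suc_iff[THEN iffD2]) (simp add: t_Suc)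
  have meets: "\<exists>x\<in>C. N < x \<and> t i \<le> x \<and> x < t (Suc i)" if i: "N < t i" for i
  proof -
    obtain x0 where "x0 \<in> C" "t i \<le> x0"
      using infinite_C by (meson infinite_nat_iff_unbounded_le)
    then obtain x where x: "x \<in> C" "t i \<le> x" and min: "\<And>y. y < x \<Longrightarrow> \<not> (y \<in> C \<and> t i \<le> y)"
      using exists_least_iff[of "\<lambda>x. x \<in> C \<and> t i \<le> x"] by blast
    \<comment> \<open>The least \<open>x\<close> in \<open>C\<close> from \<open>t i\<close> on
      violates sparseness through some \<open>y\<close>; minimality puts \<open>y\<close> below
      \<open>t i\<close>, so \<open>h y\<close> and with it \<open>x\<close> stay below
      \<open>t (Suc i)\<close>.\<close>
    have "\<not> ?V x" using N[of x] x i by auto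
    then obtain y where y: "y < x" "y \<in> C" "x \<le> h y" by (auto simp: not_less)
    then have "y < t i" using min by force
    then have "h y \<le> sum h {..<t i}" by (intro member_le_sum) auto
    then have "x < t (Suc i)" using y by (simp add: t_Suc)
    then show ?thesis using x i by (intro bexI[of _ x]) auto
  qed
  \<comment> \<open>One more than the index of the interval containing \<open>x\<close>; the bound
    \<open>Suc x\<close> loses no index, since \<open>i \<le> t i\<close>.\<close>
  define b where "b = (\<lambda>x. card {i. i < Suc x \<and> t i \<le> x})"
  have b: "b x = Suc i" if "t i \<le> x" "x < t (Suc i)" for i x
  proof -
    have "j \<le> t j" for j using mono by (rule strict_mono_imp_increasing)
    then have "j < Suc x \<and> t j \<le> x \<longleftrightarrow> j \<le> i" for j
      using that strict_mono_less_eq[OF mono, of j i] strict_mono_less_eq[OF mono, of "Suc i" j]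
      by (metis le_trans less_Suc_eq_le not_less not_less_eq_eq)
    then show ?thesis by (simp add: b_def)
  qed
  have "computable b"
    unfolding b_def
    by (intro computable_count computable_intros)
      (auto simp: decidable2_def intro!: computable_intros computable_comp[OF t])
  then have "decidable (\<lambda>x. 2 * (b x div 2) = b x)"
    by (intro computable_intros computable_div)
  moreover have "2 * (n div 2) = n \<longleftrightarrow> even n" for n :: nat by presburger
  ultimately have "decidable (\<lambda>x. even (b x))" by simp
  have not_parity: "\<not> (\<forall>\<^sub>F x in cohesive_filter. even (b x) \<longleftrightarrow> e)" for e
  proof
    assume "\<forall>\<^sub>F x in cohesive_filter. even (b x) \<longleftrightarrow> e"
    then have "finite {x \<in> C. \<not> (even (b x) \<longleftrightarrow> e)}" by (simp add: eventually_cohesive)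
    then obtain K where K: "x \<le> K" if "x \<in> C" "\<not> (even (b x) \<longleftrightarrow> e)" for x
      unfolding finite_nat_set_iff_bounded_le by blast
    \<comment> \<open>An index beyond both bounds whose successor has the parity opposite to
      \<open>e\<close>.\<close>
    define i where "i = 2 * (Suc N + Suc K) + (if e then 0 else 1)"
    have "N < i" "K < i" by (auto simp: i_def)
    moreover have "i \<le> t i" using mono by (rule strict_mono_imp_increasing)
    ultimately obtain x where x: "x \<in> C" "t i \<le> x" "x < t (Suc i)" using meets[of i] by auto
    then have "b x = Suc i" using b by blast
    moreover have "K < x" using \<open>K < i\<close> \<open>i \<le> t i\<close> x by simp
    ultimately show False using K[of x] x(1) by (auto simp: i_def split: if_splits)
  qed
  show False
    using eventually_dichotomy'[OF \<open>decidable (\<lambda>x. even (b x))\<close>] not_parity[of True] not_parity[of False]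
    by simp
qed

text \<open>Up to a finite set, \<open>u\<close> is increasing on \<open>C\<close>, hence \<open>u x\<close> is at least the position of \<open>x\<close> in \<open>C\<close>
  minus a constant, while no element of \<open>C\<close> lies strictly between \<open>x\<close> and \<open>h x\<close>.\<close>

lemma eventually_card_le:
  assumes u: "computable u" "filterlim u at_top cohesive_filter" and h: "computable h"
  shows "\<forall>\<^sub>F x in cohesive_filter. card (C \<inter> {..<h x}) \<le> 2 * u x"
proof -
  have "\<forall>\<^sub>F x in cohesive_filter. \<forall>y<x. y \<in> C \<longrightarrow> u y < u x \<and> h y < x"
    using eventually_records[OF u] eventually_sparse[OF h] by eventually_elim blast
  then have "finite {x \<in> C. \<not> (\<forall>y<x. y \<in> C \<longrightarrow> u y < u x \<and> h y < x)}"
    by (simp only: eventually_cohesive)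
  then obtain N where N: "u y < u x \<and> h y < x" if "x \<in> C" "N < x" "y < x" "y \<in> C" for x y
    unfolding finite_nat_set_iff_bounded_le by (auto simp: not_le[symmetric])
  have "\<forall>\<^sub>F x in cohesive_filter. x \<in> C" by (simp add: eventually_cohesive)
  moreover have "\<forall>\<^sub>F x in cohesive_filter. Suc N \<le> x"
    using filterlim_ident by (auto simp: filterlim_at_top)
  \<comment> \<open>The at most \<open>N + 1\<close> exceptional elements up to \<open>N\<close>,
    and \<open>x\<close> itself, are paid for by the second \<open>u x\<close>.\<close>
  moreover have "\<forall>\<^sub>F x in cohesive_filter. N + 2 \<le> u x"
    using u(2) by (auto simp: filterlim_at_top)
  ultimately show ?thesis
  proof eventually_elim
    case (elim x)
    have "inj_on u (C \<inter> {N<..<x})"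
    proof (rule linorder_inj_onI)
      fix y z assume "y < z" "y \<in> C \<inter> {N<..<x}" "z \<in> C \<inter> {N<..<x}"
      then show "u y \<noteq> u z" using N[of z y] by auto
    qed auto
    moreover have "u ` (C \<inter> {N<..<x}) \<subseteq> {..<u x}" using N[of x] elim by auto
    ultimately have "card (C \<inter> {N<..<x}) \<le> u x" by (metis card_inj_on_le card_lessThan finite_lessThan)
    \<comment> \<open>An element of \<open>C\<close> above \<open>x\<close> is above
      \<open>h x\<close> by sparseness.\<close>
    moreover have sub: "C \<inter> {..<h x} \<subseteq> {..N} \<union> (C \<inter> {N<..<x}) \<union> {x}"
    proof
      fix y assume "y \<in> C \<inter> {..<h x}"
      then show "y \<in> {..N} \<union> (C \<inter> {N<..<x}) \<union> {x}"
        using N[of y x] elim by (cases "x < y") auto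
    qed
    moreover have "card (C \<inter> {..<h x}) \<le> card ({..N} \<union> (C \<inter> {N<..<x}) \<union> {x})"
      using sub by (intro card_mono) auto
    then have "card (C \<inter> {..<h x}) \<le> card {..N} + card (C \<inter> {N<..<x}) + card {x}"
      by (meson card_Un_le le_trans add_le_mono1)
    ultimately show ?case using elim by simp
  qed
qed

end

section \<open>Representing linear orders\<close>

text \<open>\<open>T\<close> with the relation \<open>lt\<close> becomes the order \<open>N\<close> once incomparable elements are identified.\<close>

definition representation ::
    "'a set \<Rightarrow> ('a \<Rightarrow> 'a \<Rightarrow> bool) \<Rightarrow> 'b ord_struct \<Rightarrow> ('a \<Rightarrow> 'b) \<Rightarrow> bool" where
  "representation T lt N h \<longleftrightarrow> h ` T = elems N \<and>
     (\<forall>x\<in>T. \<forall>y\<in>T. (lt x y \<longleftrightarrow> (h x, h y) \<in> less_rel N) \<and>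
       (\<not> lt x y \<longrightarrow> \<not> lt y x \<longrightarrow> h x = h y))"

definition represents :: "'a set \<Rightarrow> ('a \<Rightarrow> 'a \<Rightarrow> bool) \<Rightarrow> 'b ord_struct \<Rightarrow> bool" where
  "represents T lt N \<longleftrightarrow> (\<exists>h. representation T lt N h)"

lemma representsI:
  assumes "\<And>x. x \<in> T \<Longrightarrow> h x \<in> elems N" "\<And>z. z \<in> elems N \<Longrightarrow> \<exists>x\<in>T. h x = z"
    "\<And>x y. x \<in> T \<Longrightarrow> y \<in> T \<Longrightarrow> lt x y \<longleftrightarrow> (h x, h y) \<in> less_rel N"
    "\<And>x y. x \<in> T \<Longrightarrow> y \<in> T \<Longrightarrow> \<not> lt x y \<Longrightarrow> \<not> lt y x \<Longrightarrow> h x = h y"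
  shows "represents T lt N"
proof -
  have "h ` T = elems N" using assms(1,2) by blast
  then have "representation T lt N h" unfolding representation_def using assms(3,4) by blast
  then show ?thesis unfolding represents_def by blast
qed

lemma representsE:
  assumes "represents T lt N"
  obtains h where "representation T lt N h"
  using assms unfolding represents_def by blast

lemma representationD:
  assumes "representation T lt N h"
  shows "h ` T = elems N" "x \<in> T \<Longrightarrow> h x \<in> elems N"
    "x \<in> T \<Longrightarrow> y \<in> T \<Longrightarrow> lt x y \<longleftrightarrow> (h x, h y) \<in> less_rel N"
    "x \<in> T \<Longrightarrow> y \<in> T \<Longrightarrow> \<not> lt x y \<Longrightarrow> \<not> lt y x \<Longrightarrow> h x = h y"
proof -
  have eq: "h ` T = elems N"
    and iff: "\<forall>x\<in>T. \<forall>y\<in>T. (lt x y \<longleftrightarrow> (h x, h y) \<in> less_rel N) \<and>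
      (\<not> lt x y \<longrightarrow> \<not> lt y x \<longrightarrow> h x = h y)"
    using assms[unfolded representation_def] by - (erule conjunct1, erule conjunct2)
  show "h ` T = elems N" by (rule eq)
  show "x \<in> T \<Longrightarrow> h x \<in> elems N" using eq by blast
  show "x \<in> T \<Longrightarrow> y \<in> T \<Longrightarrow> lt x y \<longleftrightarrow> (h x, h y) \<in> less_rel N" using iff by blast
  show "x \<in> T \<Longrightarrow> y \<in> T \<Longrightarrow> \<not> lt x y \<Longrightarrow> \<not> lt y x \<Longrightarrow> h x = h y" using iff by blast
qed

lemma representation_surj:
  assumes "representation T lt N h" "z \<in> elems N"
  obtains x where "x \<in> T" "h x = z"
proof -
  have "z \<in> h ` T" using assms(2) by (simp only: representationD(1)[OF assms(1)])
  then show thesis using that by blast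
qed

text \<open>\<open>\<phi>\<close> has to reach each class of incomparable elements, not each
  element; this is how functions that agree almost everywhere are handled.\<close>

lemma represents_image:
  assumes "represents A lt N" "\<And>x. x \<in> T \<Longrightarrow> \<phi> x \<in> A"
    "\<And>a. a \<in> A \<Longrightarrow> \<exists>x\<in>T. \<not> lt (\<phi> x) a \<and> \<not> lt a (\<phi> x)"
    "\<And>x y. x \<in> T \<Longrightarrow> y \<in> T \<Longrightarrow> lt' x y \<longleftrightarrow> lt (\<phi> x) (\<phi> y)"
  shows "represents T lt' N"
proof -
  obtain h where h: "representation A lt N h" using assms(1) by (rule representsE)
  show ?thesis
  proof (rule representsI[of _ "h \<circ> \<phi>"])
    show "\<exists>x\<in>T. (h \<circ> \<phi>) x = z" if "z \<in> elems N" for z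
    proof (rule representation_surj[OF h that])
      fix a assume a: "a \<in> A" "h a = z"
      then obtain x where "x \<in> T" "\<not> lt (\<phi> x) a" "\<not> lt a (\<phi> x)" using assms(3) by blast
      then show ?thesis using representationD(4)[OF h assms(2) a(1)] a(2) by auto
    qed
  qed (use assms(2,4) representationD(2,3)[OF h] in \<open>auto intro: representationD(4)[OF h]\<close>)
qed

lemma represents_imp_ord_iso:
  assumes "represents (elems M) (\<lambda>x y. (x, y) \<in> less_rel M) N"
    "\<And>x. x \<in> elems M \<Longrightarrow> (x, x) \<notin> less_rel M"
    "\<And>x y. x \<in> elems M \<Longrightarrow> y \<in> elems M \<Longrightarrow> x \<noteq> y \<Longrightarrow> (x, y) \<in> less_rel M \<or> (y, x) \<in> less_rel M"
  shows "M \<simeq> N"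
proof -
  obtain h where h: "representation (elems M) (\<lambda>x y. (x, y) \<in> less_rel M) N h"
    using assms(1) by (rule representsE)
  have "inj_on h (elems M)"
    by (rule inj_onI) (metis assms(2,3) representationD(3)[OF h])
  then show ?thesis using representationD(1,3)[OF h] by (auto simp: ord_iso_def bij_betw_def)
qed

lemma represents_copy:
  assumes "represents T lt N" "inj f"
  shows "represents T lt (copy_order f N)"
proof -
  obtain h where h: "representation T lt N h" using assms(1) by (rule representsE)
  have iff: "(f x, f y) \<in> map_prod f f ` R \<longleftrightarrow> (x, y) \<in> R" for x y R
    using assms(2) by (auto dest: injD)
  show ?thesis
  proof (rule representsI[of _ "f \<circ> h"])
    show "\<exists>x\<in>T. (f \<circ> h) x = z" if "z \<in> elems (copy_order f N)" for z
    proof -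
      have "z \<in> f ` h ` T" using that representationD(1)[OF h] by (simp add: copy_order_def)
      then show ?thesis by auto
    qed
  qed (use representationD(2,3)[OF h] in \<open>auto simp: copy_order_def iff intro: arg_cong[OF representationD(4)[OF h]]\<close>)
qed

lemma represents_plus:
  assumes "represents T1 lt N1" "represents T2 lt N2"
    "\<And>x y. x \<in> T1 \<Longrightarrow> y \<in> T2 \<Longrightarrow> lt x y \<and> \<not> lt y x"
  shows "represents (T1 \<union> T2) lt (N1 \<oplus> N2)"
proof -
  obtain h where h: "representation T1 lt N1 h" using assms(1) by (rule representsE)
  obtain k where k: "representation T2 lt N2 k" using assms(2) by (rule representsE)
  have disj: "x \<notin> T1" if "x \<in> T2" for x using assms(3) that by blast
  let ?h = "\<lambda>x. if x \<in> T1 then Inl (h x) else Inr (k x)"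
  show ?thesis
  proof (rule representsI[of _ ?h])
    show "x \<in> T1 \<union> T2 \<Longrightarrow> ?h x \<in> elems (N1 \<oplus> N2)" for x
      using representationD(2)[OF h] representationD(2)[OF k] by (auto simp: ord_plus_def)
    show "\<exists>x\<in>T1 \<union> T2. ?h x = z" if "z \<in> elems (N1 \<oplus> N2)" for z
    proof (cases z)
      case (Inl a)
      then have "a \<in> h ` T1" using that representationD(1)[OF h] by (auto simp: ord_plus_def)
      then show ?thesis using Inl by auto
    next
      case (Inr a)
      then have "a \<in> k ` T2" using that representationD(1)[OF k] by (auto simp: ord_plus_def)
      then show ?thesis using Inr disj by auto
    qed
    show "lt x y \<longleftrightarrow> (?h x, ?h y) \<in> less_rel (N1 \<oplus> N2)"
      if "x \<in> T1 \<union> T2" "y \<in> T1 \<union> T2" for x y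
      using that representationD(2,3)[OF h] representationD(2,3)[OF k] assms(3) disj
      by (auto simp: ord_plus_def)
    show "?h x = ?h y" if "x \<in> T1 \<union> T2" "y \<in> T1 \<union> T2" "\<not> lt x y" "\<not> lt y x" for x y
      using that assms(3) disj
      by (auto intro: representationD(4)[OF h] representationD(4)[OF k])
  qed
qed

text \<open>The isomorphism counts predecessors.\<close>

lemma represents_omega:
  assumes irrefl: "\<And>x. x \<in> A \<Longrightarrow> \<not> lt x x"
    and trans: "\<And>x y z. x \<in> A \<Longrightarrow> y \<in> A \<Longrightarrow> z \<in> A \<Longrightarrow> lt x y \<Longrightarrow> lt y z \<Longrightarrow> lt x z"
    and total: "\<And>x y. x \<in> A \<Longrightarrow> y \<in> A \<Longrightarrow> x \<noteq> y \<Longrightarrow> lt x y \<or> lt y x"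
    and fin: "\<And>x. x \<in> A \<Longrightarrow> finite {y \<in> A. lt y x}" and inf: "infinite A"
  shows "represents A lt omega"
proof -
  define h where "h = (\<lambda>x. card {y \<in> A. lt y x})"
  have less: "h x < h y" if "x \<in> A" "y \<in> A" "lt x y" for x y
    unfolding h_def
  proof (rule psubset_card_mono[OF fin])
    show "{z \<in> A. lt z x} \<subset> {z \<in> A. lt z y}"
      using that irrefl trans by blast
  qed (rule that)
  have iff: "lt x y \<longleftrightarrow> h x < h y" if "x \<in> A" "y \<in> A" for x y
    using less[OF that] less[OF that(2,1)] total[OF that] by force
  have surj: "\<exists>x\<in>A. h x = n" for n
  proof (induction n rule: less_induct)
    case (less n)
    have "inj_on h A" by (rule inj_onI) (metis iff less_irrefl total)
    then have "infinite (h ` A)" using inf finite_imageD by blast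
    then obtain x0 where x0: "x0 \<in> A" "n \<le> h x0"
      by (metis (no_types, lifting) imageE infinite_nat_iff_unbounded_le)
    show ?case
    proof (cases "n = h x0")
      case False
      then have lt: "n < h x0" using x0 by simp
      have "inj_on h {y \<in> A. lt y x0}" using \<open>inj_on h A\<close> by (rule inj_on_subset) auto
      then have "card (h ` {y \<in> A. lt y x0}) = h x0" by (simp add: card_image h_def)
      moreover have "h ` {y \<in> A. lt y x0} \<subseteq> {..<h x0}" using iff x0 by auto
      \<comment> \<open>The \<open>h x0\<close> predecessors of \<open>x0\<close> have distinct
        counts below \<open>h x0\<close>, so they exhaust \<open>{..<h x0}\<close>, and
        \<open>n\<close> is among them.\<close>
      ultimately have "h ` {y \<in> A. lt y x0} = {..<h x0}"
        by (intro card_subset_eq) auto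
      then have "n \<in> h ` {y \<in> A. lt y x0}" using lt by simp
      then show ?thesis by blast
    qed (use x0 in blast)
  qed
  show ?thesis
    by (rule representsI[of _ h]) (use iff surj total in \<open>auto simp: omega_def std_order_def\<close>)
qed

text \<open>Colour an odd multiple of \<open>1 / 2 ^ p\<close> by the member of \<open>S\<close>
  numbered \<open>pi1 p\<close>. Every member has its number at arbitrarily large \<open>p\<close>,
  and for large \<open>p\<close> the odd multiples come close to every rational.\<close>

lemma dense_coloring_exists:
  assumes "countable S" "S \<noteq> {}"
  shows "\<exists>c. dense_coloring S c"
proof -
  define val :: "int \<Rightarrow> nat \<Rightarrow> rat" where "val = (\<lambda>m p. of_int (2 * m + 1) / 2 ^ p)"
  have val_less: "p = q" if eq: "val m p = val n q" and "p \<le> q" for m n p q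
  proof (rule ccontr)
    assume "p \<noteq> q"
    then obtain k where k: "q = p + Suc k"
      using \<open>p \<le> q\<close> by (metis le_neq_implies_less less_imp_Suc_add add_Suc_right)
    have "val m p * 2 ^ q = of_int (2 * m + 1) * 2 ^ Suc k" "val n q * 2 ^ q = of_int (2 * n + 1)"
      by (simp_all add: val_def k power_add)
    then have "of_int (2 * m + 1) * 2 ^ Suc k = (of_int (2 * n + 1) :: rat)"
      using eq by simp
    then have "of_int ((2 * m + 1) * 2 ^ Suc k) = (of_int (2 * n + 1) :: rat)" by simp
    then have "(2 * m + 1) * 2 ^ Suc k = 2 * n + 1" by (simp only: of_int_eq_iff)
    then have "even (2 * n + 1)" by (metis dvd_triv_left dvd_mult power_Suc)
    then show False by simp
  qed
  then have val_inj: "p = q" if "val m p = val n q" for m n p q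
    using that by (metis nat_le_linear)
  define c where "c = (\<lambda>q. from_nat_into S (pi1 (SOME p. \<exists>m. q = val m p)))"
  have c: "c (val m p) = from_nat_into S (pi1 p)" for m p
  proof -
    have "(SOME p'. \<exists>n. val m p = val n p') = p"
      by (rule some_equality) (use val_inj in blast)+
    then show ?thesis by (simp add: c_def)
  qed
  have "\<exists>q. a < q \<and> q < b \<and> c q = K" if "K \<in> S" "a < b" for K a b
  proof -
    obtain n where n: "from_nat_into S n = K"
      using from_nat_into_surj[OF assms(1) \<open>K \<in> S\<close>] by blast
    \<comment> \<open>Padding that makes \<open>2 ^ p\<close> exceed \<open>4 / (b - a)\<close>: the
      odd number \<open>2 * m + 1\<close> chosen below lies at most 3 above
      \<open>a * 2 ^ p\<close>, and so below \<open>b * 2 ^ p\<close>.\<close>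
    obtain l :: nat where l: "4 / (b - a) < of_nat l" using reals_Archimedean2 by blast
    define p where "p = prod_encode (n, l)"
    have "l \<le> p" unfolding p_def by (rule le_prod_encode_2)
    then have "l < 2 ^ p" using less_exp[of p] by (meson le_less_trans)
    then have "(of_nat l :: rat) < of_nat (2 ^ p)" by (simp only: of_nat_less_iff)
    then have "of_nat l * (b - a) < of_nat (2 ^ p) * (b - a)"
      using \<open>a < b\<close> by (intro mult_strict_right_mono) auto
    moreover have "4 < of_nat l * (b - a)"
      using l \<open>a < b\<close> by (simp add: pos_divide_less_eq)
    ultimately have p: "4 < (b - a) * 2 ^ p" by (simp add: mult.commute)
    define m where "m = \<lfloor>a * 2 ^ p / 2\<rfloor> + 1"
    have m: "a * 2 ^ p / 2 < of_int m" "of_int m \<le> a * 2 ^ p / 2 + 1"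
      unfolding m_def by linarith+
    have "a < val m p" "val m p < b"
      using m p by (simp_all add: val_def field_simps)
    then show ?thesis using c[of m p] n by (auto simp: p_def)
  qed
  moreover have "range c \<subseteq> S" using assms(2) by (auto simp: c_def intro: from_nat_into)
  ultimately show ?thesis unfolding dense_coloring_def by blast
qed

text \<open>A strict weak order: its classes of incomparable elements form a countable dense order
  without end points in which every colour is dense. The axioms speak of representatives, so that
  computable functions can be used directly in place of classes.\<close>

locale dense_colored_order =
  fixes T :: "'a set" and lt :: "'a \<Rightarrow> 'a \<Rightarrow> bool" and c :: "'a \<Rightarrow> 'c" and S :: "'c set"
  assumes countable: "countable T" and nonempty: "T \<noteq> {}"
    and irrefl: "x \<in> T \<Longrightarrow> \<not> lt x x"
    and trans: "x \<in> T \<Longrightarrow> y \<in> T \<Longrightarrow> z \<in> T \<Longrightarrow> lt x y \<Longrightarrow> lt y z \<Longrightarrow> lt x z"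
    and negtrans: "x \<in> T \<Longrightarrow> y \<in> T \<Longrightarrow> z \<in> T \<Longrightarrow> lt x z \<Longrightarrow> lt x y \<or> lt y z"
    and color: "x \<in> T \<Longrightarrow> c x \<in> S"
    and color_cong: "x \<in> T \<Longrightarrow> y \<in> T \<Longrightarrow> \<not> lt x y \<Longrightarrow> \<not> lt y x \<Longrightarrow> c x = c y"
    and dense: "x \<in> T \<Longrightarrow> y \<in> T \<Longrightarrow> lt x y \<Longrightarrow> K \<in> S \<Longrightarrow> \<exists>z\<in>T. lt x z \<and> lt z y \<and> c z = K"
    and no_least: "x \<in> T \<Longrightarrow> K \<in> S \<Longrightarrow> \<exists>z\<in>T. lt z x \<and> c z = K"
    and no_greatest: "x \<in> T \<Longrightarrow> K \<in> S \<Longrightarrow> \<exists>z\<in>T. lt x z \<and> c z = K"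
begin

lemma finite_max:
  "finite A \<Longrightarrow> A \<noteq> {} \<Longrightarrow> A \<subseteq> T \<Longrightarrow> \<exists>m\<in>A. \<forall>a\<in>A. \<not> lt m a"
proof (induction A rule: finite_ne_induct)
  case (singleton x)
  then show ?case using irrefl by blast
next
  case (insert x A)
  then obtain m where m: "m \<in> A" "\<forall>a\<in>A. \<not> lt m a" by auto
  show ?case
  proof (cases "lt m x")
    case True
    have "\<not> lt x a" if "a \<in> insert x A" for a
      using that m True insert.prems irrefl trans[of m x a] by blast
    then show ?thesis by blast
  qed (use m in blast)
qed

lemma finite_min:
  "finite A \<Longrightarrow> A \<noteq> {} \<Longrightarrow> A \<subseteq> T \<Longrightarrow> \<exists>m\<in>A. \<forall>a\<in>A. \<not> lt a m"
proof (induction A rule: finite_ne_induct)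
  case (singleton x)
  then show ?case using irrefl by blast
next
  case (insert x A)
  then obtain m where m: "m \<in> A" "\<forall>a\<in>A. \<not> lt a m" by auto
  show ?case
  proof (cases "lt x m")
    case True
    have "\<not> lt a x" if "a \<in> insert x A" for a
      using that m True insert.prems irrefl trans[of a x m] by blast
    then show ?thesis by blast
  qed (use m in blast)
qed

text \<open>The extension property behind back-and-forth; \<open>negtrans\<close> reduces the two
  finite sets to a maximal and a minimal element.\<close>

lemma between_finite_sets:
  assumes "finite A" "finite B" "A \<subseteq> T" "B \<subseteq> T" "\<And>a b. a \<in> A \<Longrightarrow> b \<in> B \<Longrightarrow> lt a b" "K \<in> S"
  obtains z where "z \<in> T" "c z = K" "\<And>a. a \<in> A \<Longrightarrow> lt a z" "\<And>b. b \<in> B \<Longrightarrow> lt z b"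
proof -
  have above: "lt a z" if "m \<in> A" "\<forall>a\<in>A. \<not> lt m a" "z \<in> T" "lt m z" "a \<in> A" for a m z
    using negtrans[of m a z] that assms(3) by blast
  have below: "lt z b" if "m \<in> B" "\<forall>b\<in>B. \<not> lt b m" "z \<in> T" "lt z m" "b \<in> B" for b m z
    using negtrans[of z b m] that assms(4) by blast
  consider "A = {}" "B = {}" | "A \<noteq> {}" "B = {}" | "A = {}" "B \<noteq> {}" | "A \<noteq> {}" "B \<noteq> {}"
    by blast
  then show thesis
  proof cases
    case 1
    obtain x where "x \<in> T" using nonempty by blast
    then show ?thesis using no_least[of x K] assms(6) that 1 by blast
  next
    case 2
    obtain m where m: "m \<in> A" "\<forall>a\<in>A. \<not> lt m a" using finite_max assms(1,3) 2 by blast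
    then show ?thesis using no_greatest[of m K] assms(3,6) that 2 above by blast
  next
    case 3
    obtain m where m: "m \<in> B" "\<forall>a\<in>B. \<not> lt a m" using finite_min assms(2,4) 3 by blast
    then show ?thesis using no_least[of m K] assms(4,6) that 3 below by blast
  next
    case 4
    obtain m where m: "m \<in> A" "\<forall>a\<in>A. \<not> lt m a" using finite_max assms(1,3) 4 by blast
    obtain n where n: "n \<in> B" "\<forall>a\<in>B. \<not> lt a n" using finite_min assms(2,4) 4 by blast
    then obtain z where "z \<in> T" "lt m z" "lt z n" "c z = K"
      using dense[of m n K] m assms(3-6) by blast
    then show ?thesis using that above[OF m] below[OF n] by blast
  qed
qed

end

text \<open>A relation and not a function, as several incomparable elements may be matched with one
  another.\<close>

definition partial_iso ::
  "('a \<Rightarrow> 'a \<Rightarrow> bool) \<Rightarrow> ('a \<Rightarrow> 'c) \<Rightarrow> ('b \<Rightarrow> 'b \<Rightarrow> bool) \<Rightarrow> ('b \<Rightarrow> 'c) \<Rightarrow> ('a \<times> 'b) set \<Rightarrow> bool" where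
  "partial_iso lt c lt' c' R \<longleftrightarrow> (\<forall>x y. (x, y) \<in> R \<longrightarrow> c x = c' y) \<and>
     (\<forall>x y x' y'. (x, y) \<in> R \<longrightarrow> (x', y') \<in> R \<longrightarrow> (lt x x' \<longleftrightarrow> lt' y y'))"

lemma partial_iso_converse: "partial_iso lt c lt' c' R \<longleftrightarrow> partial_iso lt' c' lt c (R\<inverse>)"
  unfolding partial_iso_def by fastforce

lemma partial_iso_insert:
  assumes "partial_iso lt c lt' c' R" "c x = c' y" "\<not> lt x x" "\<not> lt' y y"
    "\<And>x' y'. (x', y') \<in> R \<Longrightarrow> (lt x x' \<longleftrightarrow> lt' y y') \<and> (lt x' x \<longleftrightarrow> lt' y' y)"
  shows "partial_iso lt c lt' c' (insert (x, y) R)"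
  using assms unfolding partial_iso_def by auto

lemma partial_iso_extend:
  assumes "dense_colored_order T lt c S" "dense_colored_order U lt' c' S"
    and R: "partial_iso lt c lt' c' R" "finite R" "R \<subseteq> T \<times> U" and x: "x \<in> T"
  shows "\<exists>y\<in>U. partial_iso lt c lt' c' (insert (x, y) R)"
proof -
  interpret T: dense_colored_order T lt c S by fact
  interpret U: dense_colored_order U lt' c' S by fact
  show ?thesis
  \<comment> \<open>An \<open>x\<close> incomparable to a matched \<open>x0\<close> inherits its
    partner. Any other \<open>x\<close> cuts the matched elements into a lower and an upper part,
    between whose partners an element of the right colour exists.\<close>
  proof (cases "\<exists>x0 y0. (x0, y0) \<in> R \<and> \<not> lt x x0 \<and> \<not> lt x0 x")
    case True
    then obtain x0 y0 where xy: "(x0, y0) \<in> R" "\<not> lt x x0" "\<not> lt x0 x" by blast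
    then have mem: "x0 \<in> T" "y0 \<in> U" using R by auto
    have eq: "lt x x' \<longleftrightarrow> lt x0 x'" "lt x' x \<longleftrightarrow> lt x' x0" if "x' \<in> T" for x'
      using T.negtrans mem xy x that by blast+
    have "partial_iso lt c lt' c' (insert (x, y0) R)"
    proof (rule partial_iso_insert[OF R(1)])
      have "c x = c x0" using T.color_cong x mem xy by blast
      then show "c x = c' y0" using R(1) xy(1) by (simp add: partial_iso_def)
      show "(lt x x' \<longleftrightarrow> lt' y0 y') \<and> (lt x' x \<longleftrightarrow> lt' y' y0)" if r: "(x', y') \<in> R" for x' y'
      proof -
        have "x' \<in> T" using r R by blast
        then show ?thesis using eq R(1) r xy(1) by (simp add: partial_iso_def)
      qed
    qed (use T.irrefl U.irrefl x mem in auto)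
    then show ?thesis using mem by blast
  next
    case False
    define A where "A = {y. \<exists>x'. (x', y) \<in> R \<and> lt x' x}"
    define B where "B = {y. \<exists>x'. (x', y) \<in> R \<and> lt x x'}"
    have lt: "lt' a b" if ab: "a \<in> A" "b \<in> B" for a b
    proof -
      obtain a' b' where "(a', a) \<in> R" "(b', b) \<in> R" "lt a' x" "lt x b'"
        using ab by (auto simp: A_def B_def)
      moreover have "lt a' b'" using calculation T.trans[of a' x b'] R(3) x by blast
      ultimately show ?thesis using R(1) by (simp add: partial_iso_def)
    qed
    obtain y where y: "y \<in> U" "c' y = c x" "\<And>a. a \<in> A \<Longrightarrow> lt' a y" "\<And>b. b \<in> B \<Longrightarrow> lt' y b"
    proof (rule U.between_finite_sets[of A B "c x"])
      show "A \<subseteq> U" "B \<subseteq> U" using R(3) by (auto simp: A_def B_def)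
      have "A \<subseteq> snd ` R" "B \<subseteq> snd ` R" by (force simp: A_def B_def)+
      then show "finite A" "finite B" using R(2) by (auto intro: finite_subset)
      show "c x \<in> S" using T.color x by blast
    qed (use lt in blast)+
    have asymT: "\<not> (lt a b \<and> lt b a)" if "a \<in> T" "b \<in> T" for a b
      using T.trans[of a b a] T.irrefl that by blast
    have asymU: "\<not> (lt' a b \<and> lt' b a)" if "a \<in> U" "b \<in> U" for a b
      using U.trans[of a b a] U.irrefl that by blast
    have iff: "(lt x x' \<longleftrightarrow> lt' y y') \<and> (lt x' x \<longleftrightarrow> lt' y' y)" if r: "(x', y') \<in> R" for x' y'
    proof -
      have mem: "x' \<in> T" "y' \<in> U" using r R by auto
      consider "lt x x'" "y' \<in> B" | "lt x' x" "y' \<in> A"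
        using False r by (auto simp: A_def B_def)
      then show ?thesis
        using asymT[OF x mem(1)] asymU[OF y(1) mem(2)] y by cases auto
    qed
    then have "partial_iso lt c lt' c' (insert (x, y) R)"
      using R(1) y(2) T.irrefl[OF x] U.irrefl[OF y(1)] by (intro partial_iso_insert) auto
    then show ?thesis using y by blast
  qed
qed

text \<open>Cantor's argument for coloured orders: stage \<open>n\<close> puts \<open>t n\<close>
  into the domain and \<open>u n\<close> into the range.\<close>

lemma back_and_forth:
  assumes T: "dense_colored_order T lt c S" and U: "dense_colored_order U lt' c' S"
  obtains R where "partial_iso lt c lt' c' R" "R \<subseteq> T \<times> U" "T \<subseteq> Domain R" "U \<subseteq> Range R"
proof -
  define P where "P = (\<lambda>R. finite R \<and> R \<subseteq> T \<times> U \<and> partial_iso lt c lt' c' R)"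
  define t where "t = from_nat_into T"
  define u where "u = from_nat_into U"
  have t: "range t = T" and u: "range u = U"
    unfolding t_def u_def using T U
    by (auto simp: range_from_nat_into dense_colored_order.countable dense_colored_order.nonempty)
  have step: "\<exists>R'. P R' \<and> R \<subseteq> R' \<and> t n \<in> Domain R' \<and> u n \<in> Range R'" if R: "P R" for R n
  proof -
    have "t n \<in> T" "u n \<in> U" using t u by auto
    obtain y where y: "y \<in> U" "partial_iso lt c lt' c' (insert (t n, y) R)"
      using partial_iso_extend[OF T U _ _ _ \<open>t n \<in> T\<close>] R by (auto simp: P_def)
    let ?R = "insert (t n, y) R"
    have R': "finite ?R" "?R \<subseteq> T \<times> U" using R y \<open>t n \<in> T\<close> by (auto simp: P_def)
    obtain x where x: "x \<in> T" "partial_iso lt' c' lt c (insert (u n, x) (?R\<inverse>))"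
      using partial_iso_extend[OF U T _ _ _ \<open>u n \<in> U\<close>, of "?R\<inverse>"] R' y partial_iso_converse[of lt c lt' c' ?R]
      by auto
    moreover have "insert (u n, x) (?R\<inverse>) = (insert (x, u n) ?R)\<inverse>" by auto
    ultimately have "partial_iso lt c lt' c' (insert (x, u n) ?R)"
      unfolding partial_iso_converse[of lt c] by simp
    then show ?thesis
      using R' x \<open>u n \<in> U\<close> by (intro exI[of _ "insert (x, u n) ?R"]) (auto simp: P_def)
  qed
  have "\<exists>F. \<forall>n. P (F n) \<and> (F n \<subseteq> F (Suc n) \<and> t n \<in> Domain (F (Suc n)) \<and> u n \<in> Range (F (Suc n)))"
    by (rule dependent_nat_choice) (use step in \<open>auto simp: P_def partial_iso_def intro!: exI[of _ "{}"]\<close>)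
  then obtain F where F: "\<And>n. P (F n)" "\<And>n. F n \<subseteq> F (Suc n)"
    "\<And>n. t n \<in> Domain (F (Suc n))" "\<And>n. u n \<in> Range (F (Suc n))"
    by blast
  have mono: "F m \<subseteq> F n" if "m \<le> n" for m n
    using F(2) that by (rule lift_Suc_mono_le)
  let ?R = "\<Union>n. F n"
  have "partial_iso lt c lt' c' ?R"
    unfolding partial_iso_def
  proof (intro conjI allI impI)
    fix x y assume "(x, y) \<in> ?R"
    then show "c x = c' y" using F(1) by (auto simp: P_def partial_iso_def)
  next
    fix x y x' y' assume "(x, y) \<in> ?R" "(x', y') \<in> ?R"
    then obtain m n where "(x, y) \<in> F m" "(x', y') \<in> F n" by blast
    then have "(x, y) \<in> F (max m n)" "(x', y') \<in> F (max m n)"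
      using mono[of m "max m n"] mono[of n "max m n"] by auto
    then show "lt x x' \<longleftrightarrow> lt' y y'" using F(1) unfolding P_def partial_iso_def by blast
  qed
  moreover have "?R \<subseteq> T \<times> U" using F(1) by (auto simp: P_def)
  moreover have "T \<subseteq> Domain ?R" using F(3) t by blast
  moreover have "U \<subseteq> Range ?R" using F(4) u by blast
  ultimately show thesis using that by blast
qed

lemma dense_colored_order_rat:
  assumes "dense_coloring S c"
  shows "dense_colored_order (UNIV :: rat set) (<) c S"
proof
  have c: "\<exists>q. a < q \<and> q < b \<and> c q = K" if "K \<in> S" "a < b" for a b K
    using assms that by (auto simp: dense_coloring_def)
  show "\<exists>z\<in>UNIV. x < z \<and> z < y \<and> c z = K" if "x < y" "K \<in> S" for x y K
    using c[OF that(2,1)] by blast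
  show "\<exists>z\<in>UNIV. z < x \<and> c z = K" if "K \<in> S" for x K
    using c[OF that, of "x - 1" x] by auto
  show "\<exists>z\<in>UNIV. x < z \<and> c z = K" if "K \<in> S" for x K
    using c[OF that, of x "x + 1"] by auto
qed (use assms in \<open>auto simp: dense_coloring_def\<close>)

text \<open>Back-and-forth identifies the coarse classes with the rationals coloured by
  \<open>d\<close>; the colours are themselves orders, and the isomorphisms of the classes with
  their colours are glued. A single colour gives \<zeta>\<eta>, several give the shuffle.\<close>

lemma represents_lex_sum:
  assumes T: "dense_colored_order T coarse c S" and d: "dense_coloring S d"
    and coarse: "\<And>x y. x \<in> T \<Longrightarrow> y \<in> T \<Longrightarrow> coarse x y \<Longrightarrow> lt x y \<and> \<not> lt y x"
    and fiber: "\<And>x. x \<in> T \<Longrightarrow> represents {y \<in> T. \<not> coarse x y \<and> \<not> coarse y x} lt (c x)"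
  shows "represents T lt (ord_lex_sum eta d)"
proof -
  obtain R where R: "partial_iso coarse c (<) d R" "R \<subseteq> T \<times> UNIV" "T \<subseteq> Domain R"
      "(UNIV :: rat set) \<subseteq> Range R"
    using back_and_forth[OF T dense_colored_order_rat[OF d]] by blast
  define q where "q = (\<lambda>x. SOME r. (x, r) \<in> R)"
  have q: "(x, q x) \<in> R" if "x \<in> T" for x
    unfolding q_def using R(3) that by (metis Domain.cases someI subsetD)
  have less: "coarse x y \<longleftrightarrow> q x < q y" if "x \<in> T" "y \<in> T" for x y
    using q that R(1) unfolding partial_iso_def by blast
  have color: "c x = d (q x)" if "x \<in> T" for x
    using q that R(1) unfolding partial_iso_def by blast
  have surj: "\<exists>x\<in>T. q x = r" for r
  proof -
    obtain x where x: "(x, r) \<in> R" using R(4) by blast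
    then have "x \<in> T" using R(2) by blast
    then have "\<not> q x < r" "\<not> r < q x"
      using q R(1) x less[of x x] unfolding partial_iso_def by blast+
    then show ?thesis using \<open>x \<in> T\<close> by auto
  qed
  have "\<exists>h. representation {y \<in> T. q y = r} lt (d r) h" for r
  proof -
    obtain x where x: "x \<in> T" "q x = r" using surj by blast
    have "{y \<in> T. \<not> coarse x y \<and> \<not> coarse y x} = {y \<in> T. q y = r}"
      using less x by auto
    then show ?thesis using fiber[OF x(1)] color[OF x(1)] x(2) by (simp add: represents_def)
  qed
  then obtain h where h: "\<And>r. representation {y \<in> T. q y = r} lt (d r) (h r)" by metis
  show ?thesis
  proof (rule representsI[of _ "\<lambda>x. (q x, h (q x) x)"])
    show in_elems: "(q x, h (q x) x) \<in> elems (ord_lex_sum eta d)" if "x \<in> T" for x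
      using representationD(2)[OF h[of "q x"]] that by (auto simp: ord_lex_sum_def eta_def std_order_def)
    show "\<exists>x\<in>T. (q x, h (q x) x) = z" if z: "z \<in> elems (ord_lex_sum eta d)" for z
    proof -
      obtain r e where "z = (r, e)" "e \<in> elems (d r)"
        using z by (auto simp: ord_lex_sum_def)
      then show ?thesis using representation_surj[OF h[of r]] by blast
    qed
    show "(q x, h (q x) x) = (q y, h (q y) y)" if "x \<in> T" "y \<in> T" "\<not> lt x y" "\<not> lt y x" for x y
    proof -
      have "q x = q y" using less coarse that by (meson linorder_less_linear)
      then show ?thesis using that by (auto intro: representationD(4)[OF h])
    qed
    fix x y assume xy: "x \<in> T" "y \<in> T"
    have "h (q x) x \<in> elems (d (q x))" "h (q y) y \<in> elems (d (q y))"
      using representationD(2)[OF h] xy by auto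
    then have "((q x, h (q x) x), q y, h (q y) y) \<in> less_rel (ord_lex_sum eta d) \<longleftrightarrow>
        q x < q y \<or> q x = q y \<and> (h (q x) x, h (q x) y) \<in> less_rel (d (q x))"
      by (auto simp: ord_lex_sum_def eta_def std_order_def)
    also have "\<dots> \<longleftrightarrow> lt x y"
    proof (cases "q x" "q y" rule: linorder_cases)
      case less
      then show ?thesis using coarse xy \<open>\<And>x y. x \<in> T \<Longrightarrow> y \<in> T \<Longrightarrow> coarse x y \<longleftrightarrow> q x < q y\<close> by auto
    next
      case equal
      then show ?thesis using representationD(3)[OF h[of "q x"]] xy by auto
    next
      case greater
      then show ?thesis using coarse xy \<open>\<And>x y. x \<in> T \<Longrightarrow> y \<in> T \<Longrightarrow> coarse x y \<longleftrightarrow> q x < q y\<close> by auto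
    qed
    finally show "lt x y \<longleftrightarrow> ((q x, h (q x) x), q y, h (q y) y) \<in> less_rel (ord_lex_sum eta d)"
      by simp
  qed
qed

lemma represents_shuffle:
  assumes "dense_colored_order T coarse c S" "countable S"
    "\<And>x y. x \<in> T \<Longrightarrow> y \<in> T \<Longrightarrow> coarse x y \<Longrightarrow> lt x y \<and> \<not> lt y x"
    "\<And>x. x \<in> T \<Longrightarrow> represents {y \<in> T. \<not> coarse x y \<and> \<not> coarse y x} lt (c x)"
  shows "represents T lt (shuffle S)"
  unfolding shuffle_def
proof (rule represents_lex_sum[OF assms(1) _ assms(3,4)])
  have "S \<noteq> {}"
    using assms(1) dense_colored_order.nonempty dense_colored_order.color by fastforce
  then show "dense_coloring S (SOME c. dense_coloring S c)"
    using dense_coloring_exists[OF assms(2)] someI_ex by metis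
qed

section \<open>Blocks\<close>

text \<open>Used to see that halves, shifts and distances still tend to infinity.\<close>

lemma filterlim_at_top_linear:
  fixes f h :: "'a \<Rightarrow> nat"
  assumes "filterlim f at_top F" "\<forall>\<^sub>F x in F. f x \<le> a * h x + c"
  shows "filterlim h at_top F"
  unfolding filterlim_at_top
proof
  fix Z
  have "\<forall>\<^sub>F x in F. Suc (a * Z + c) \<le> f x" using assms(1) by (auto simp: filterlim_at_top)
  with assms(2) show "\<forall>\<^sub>F x in F. Z \<le> h x"
  proof eventually_elim
    case (elim x)
    then have "a * Z < a * h x" by linarith
    then show ?case by simp
  qed
qed

lemma filterlim_at_top_linear_if:
  fixes f h :: "'a \<Rightarrow> nat"
  assumes "filterlim f at_top F" "eventually P F" "\<And>x. P x \<Longrightarrow> f x \<le> a * h x + c"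
  shows "filterlim h at_top F"
  using filterlim_at_top_linear[OF assms(1) eventually_mono[OF assms(2,3)]] .

lemma filterlim_at_top_le:
  fixes f h :: "'a \<Rightarrow> nat"
  assumes "filterlim f at_top F" "\<forall>\<^sub>F x in F. f x \<le> h x"
  shows "filterlim h at_top F"
  using filterlim_at_top_linear[OF assms(1), of 1 h 0] assms(2) by simp

lemma filterlim_at_top_ge:
  fixes f :: "'a \<Rightarrow> nat"
  assumes "filterlim f at_top F"
  shows "\<forall>\<^sub>F x in F. Z \<le> f x"
  using assms by (auto simp: filterlim_at_top)

context co_ce_cohesive
begin

lemma eventually_not_both:
  assumes "eventually P cohesive_filter" "eventually Q cohesive_filter" "\<And>x. P x \<Longrightarrow> Q x \<Longrightarrow> False"
  shows False
proof -
  have "\<forall>\<^sub>F x in cohesive_filter. False"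
    using eventually_conj[OF assms(1,2)] by (rule eventually_mono) (use assms(3) in blast)
  then show False by (simp add: eventually_False)
qed

section \<open>Order-types of initial segments of the power of \<omega>\<close>

definition ae_less :: "(nat \<Rightarrow> nat) \<Rightarrow> (nat \<Rightarrow> nat) \<Rightarrow> bool" where
  "ae_less i j \<longleftrightarrow> (\<forall>\<^sub>F x in cohesive_filter. i x < j x)"

text \<open>The indices inside a block of size \<open>g\<close>, as elements of the power; functions
  equal almost everywhere are incomparable under \<open>ae_less\<close>.\<close>

definition below :: "(nat \<Rightarrow> nat) \<Rightarrow> (nat \<Rightarrow> nat) set" where
  "below g = {i. computable i \<and> ae_less i g}"

lemma ae_less_asym: "ae_less i j \<Longrightarrow> \<not> ae_less j i"
  unfolding ae_less_def by (auto dest: eventually_not_both)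

lemma represents_fin_order:
  assumes "\<forall>\<^sub>F x in cohesive_filter. g x = k"
  shows "represents (below g) ae_less (fin_order k)"
proof -
  have rep: "represents {..<k} (<) (fin_order k)"
    by (rule representsI[of _ "\<lambda>x. x"]) (auto simp: fin_order_def std_order_def)
  define v where "v = (\<lambda>i. SOME m. m < k \<and> (\<forall>\<^sub>F x in cohesive_filter. i x = m))"
  have v: "v i < k \<and> (\<forall>\<^sub>F x in cohesive_filter. i x = v i)" if "i \<in> below g" for i
  proof -
    have "\<forall>\<^sub>F x in cohesive_filter. i x < g x" "computable i"
      using that by (auto simp: below_def ae_less_def)
    then have "\<forall>\<^sub>F x in cohesive_filter. i x \<in> {..<k}"
      using assms by (auto elim: eventually_elim2)
    from eventually_constI[OF \<open>computable i\<close> _ this]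
    have "\<exists>m. m < k \<and> (\<forall>\<^sub>F x in cohesive_filter. i x = m)" by blast
    then show ?thesis unfolding v_def by (rule someI_ex)
  qed
  show ?thesis
  proof (rule represents_image[OF rep, of _ v])
    show "v i \<in> {..<k}" if "i \<in> below g" for i using v[OF that] by simp
    show "\<exists>i\<in>below g. \<not> v i < m \<and> \<not> m < v i" if "m \<in> {..<k}" for m
    proof -
      have mem: "(\<lambda>x. m) \<in> below g"
        using that assms by (auto simp: below_def ae_less_def computable_const elim: eventually_mono)
      then have "\<forall>\<^sub>F x in cohesive_filter. m = v (\<lambda>x. m)" using v by blast
      then have "m = v (\<lambda>x. m)" by simp
      then show ?thesis using mem by (intro bexI[of _ "\<lambda>x. m"]) auto
    qed
    show "ae_less i j \<longleftrightarrow> v i < v j" if "i \<in> below g" "j \<in> below g" for i j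
    proof -
      have "ae_less i j \<longleftrightarrow> (\<forall>\<^sub>F x in cohesive_filter. v i < v j)"
        unfolding ae_less_def using v[OF that(1)] v[OF that(2)]
        by (intro eventually_cong[of "\<lambda>x. i x = v i \<and> j x = v j"]) (auto intro: eventually_conj)
      then show ?thesis by simp
    qed
  qed
qed

text \<open>The part that becomes the summand \<zeta>\<eta> of \<alpha>. A truncated difference that
  tends to infinity already forces \<open>i < g\<close> almost everywhere.\<close>

definition middle :: "(nat \<Rightarrow> nat) \<Rightarrow> (nat \<Rightarrow> nat) set" where
  "middle g = {i. computable i \<and> filterlim i at_top cohesive_filter \<and>
     filterlim (\<lambda>x. g x - i x) at_top cohesive_filter}"

text \<open>The order between the copies of \<zeta>; elements at finite distance share a
  copy.\<close>

definition far_below :: "(nat \<Rightarrow> nat) \<Rightarrow> (nat \<Rightarrow> nat) \<Rightarrow> bool" where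
  "far_below i j \<longleftrightarrow> filterlim (\<lambda>x. j x - i x) at_top cohesive_filter"

lemma far_below_less: "far_below i j \<Longrightarrow> ae_less i j"
  unfolding far_below_def ae_less_def
  by (drule filterlim_at_top_ge[of _ _ 1]) (auto elim: eventually_mono)

lemma not_far_below:
  assumes "computable i" "computable j" "\<not> far_below i j"
  obtains c where "\<forall>\<^sub>F x in cohesive_filter. j x - i x = c"
  by (rule eventually_const_or_at_top[OF computable_diff[OF assms(2,1)]])
    (use assms(3) that in \<open>auto simp: far_below_def\<close>)

text \<open>By \<open>k - i \<le> (k - j) + (j - i)\<close>, valid for truncated subtraction, an
  infinite distance cannot split into two finite ones.\<close>

lemma far_below_cotrans:
  assumes "computable i" "computable j" "far_below i k"
  shows "far_below i j \<or> far_below j k"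
proof (rule eventually_const_or_at_top[of "\<lambda>x. j x - i x"])
  show "computable (\<lambda>x. j x - i x)" by (intro computable_diff assms)
next
  fix c assume "\<forall>\<^sub>F x in cohesive_filter. j x - i x = c"
  then have "\<forall>\<^sub>F x in cohesive_filter. k x - i x \<le> 1 * (k x - j x) + c"
    by eventually_elim auto
  from filterlim_at_top_linear[OF _ this] have "far_below j k"
    using assms(3) by (simp only: far_below_def)
  then show ?thesis ..
qed (simp add: far_below_def)

lemma represents_zeta:
  assumes i: "i \<in> middle g"
  shows "represents {j \<in> middle g. \<not> far_below i j \<and> \<not> far_below j i} ae_less zeta"
    (is "represents ?T _ _")
proof -
  have rep: "represents (UNIV :: int set) (<) zeta"
    by (rule representsI[of _ "\<lambda>x. x"]) (auto simp: zeta_def std_order_def)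
  define v where
    "v = (\<lambda>j. SOME z. \<forall>\<^sub>F x in cohesive_filter. int (j x) = int (i x) + z)"
  have v: "\<forall>\<^sub>F x in cohesive_filter. int (j x) = int (i x) + v j" if "j \<in> ?T" for j
  proof -
    have comp: "computable i" "computable j" using i that by (auto simp: middle_def)
    have far: "\<not> far_below i j" "\<not> far_below j i" using that by auto
    obtain c where c: "\<forall>\<^sub>F x in cohesive_filter. j x - i x = c"
      using not_far_below[OF comp far(1)] .
    obtain d where d: "\<forall>\<^sub>F x in cohesive_filter. i x - j x = d"
      using not_far_below[OF comp(2,1) far(2)] .
    \<comment> \<open>Of the two truncated differences at most one is nonzero, so
      \<open>int c - int d\<close> is the signed distance.\<close>
    from c d have "\<forall>\<^sub>F x in cohesive_filter. int (j x) = int (i x) + (int c - int d)"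
      by eventually_elim auto
    then show ?thesis unfolding v_def by (rule someI)
  qed
  show ?thesis
  proof (rule represents_image[OF rep, of _ v])
    fix z :: int
    \<comment> \<open>This is \<open>i + z\<close> in natural numbers; almost everywhere nothing is
      truncated, as \<open>i\<close> tends to infinity.\<close>
    define j where "j = (\<lambda>x. i x + nat z - nat (- z))"
    have lim: "filterlim i at_top cohesive_filter" "filterlim (\<lambda>x. g x - i x) at_top cohesive_filter"
      and comp: "computable i"
      using i by (auto simp: middle_def)
    have "\<forall>\<^sub>F x in cohesive_filter. nat (- z) \<le> i x" using lim(1) by (rule filterlim_at_top_ge)
    then have j: "\<forall>\<^sub>F x in cohesive_filter. int (j x) = int (i x) + z"
      by eventually_elim (auto simp: j_def of_nat_diff)
    have "\<forall>\<^sub>F x in cohesive_filter. i x \<le> 1 * j x + nat \<bar>z\<bar>"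
      "\<forall>\<^sub>F x in cohesive_filter. g x - i x \<le> 1 * (g x - j x) + nat \<bar>z\<bar>"
      using j by (auto elim!: eventually_mono)
    from filterlim_at_top_linear[OF lim(1) this(1)] filterlim_at_top_linear[OF lim(2) this(2)]
    have "filterlim j at_top cohesive_filter" "filterlim (\<lambda>x. g x - j x) at_top cohesive_filter" .
    moreover have "computable j" unfolding j_def by (intro computable_intros comp)
    moreover have near: "\<not> filterlim (\<lambda>x. f x :: nat) at_top cohesive_filter"
      if bound: "\<forall>\<^sub>F x in cohesive_filter. f x \<le> nat \<bar>z\<bar>" for f
    proof
      assume "filterlim f at_top cohesive_filter"
      then have "\<forall>\<^sub>F x in cohesive_filter. Suc (nat \<bar>z\<bar>) \<le> f x" by (rule filterlim_at_top_ge)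
      with bound show False by (rule eventually_not_both) auto
    qed
    have "\<not> far_below i j" "\<not> far_below j i"
      unfolding far_below_def using j by (auto intro!: near elim!: eventually_mono)
    ultimately have mem: "j \<in> ?T" by (simp add: middle_def)
    have "v j = z"
      using eventually_not_both[OF v[OF mem] j] by fastforce
    then show "\<exists>j\<in>?T. \<not> v j < z \<and> \<not> z < v j" using mem by auto
  next
    show "ae_less j k \<longleftrightarrow> v j < v k" if "j \<in> ?T" "k \<in> ?T" for j k
    proof -
      have "ae_less j k \<longleftrightarrow> (\<forall>\<^sub>F x in cohesive_filter. v j < v k)"
        unfolding ae_less_def
        by (rule eventually_cong[OF eventually_conj[OF v[OF that(1)] v[OF that(2)]]]) auto
      then show ?thesis by simp
    qed
  qed auto
qed

text \<open>Halving preserves infinite distances: the midpoint of two indices lies between their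
  copies, \<open>i div 2\<close> lies in a copy below that of \<open>i\<close>, and the midpoint of
  \<open>i\<close> and \<open>g\<close> in one above it.\<close>

lemma represents_middle:
  assumes g: "computable g" "filterlim g at_top cohesive_filter"
  shows "represents (middle g) ae_less (ord_lex_sum eta (\<lambda>_. zeta))"
proof (rule represents_lex_sum[of _ far_below "\<lambda>_. zeta" "{zeta}"])
  have ineq: "\<forall>\<^sub>F x in cohesive_filter. i x < g x" if "i \<in> middle g" for i
    using far_below_less[of i g] that by (simp add: middle_def far_below_def ae_less_def)
  show "dense_colored_order (middle g) far_below (\<lambda>_. zeta) {zeta}"
  proof
    show "countable (middle g)"
      by (rule countable_subset[OF _ countable_computable]) (auto simp: middle_def)
    have "(\<lambda>x. g x div 2) \<in> middle g"
    proof -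
      have "filterlim (\<lambda>x. g x div 2) at_top cohesive_filter"
        "filterlim (\<lambda>x. g x - g x div 2) at_top cohesive_filter"
        by (rule filterlim_at_top_linear_if[OF g(2) eventually_True, of 2 _ 1], linarith)+
      then show ?thesis
        using g by (simp add: middle_def computable_div computable_const)
    qed
    then show "middle g \<noteq> {}" by blast
    show "\<not> far_below i i" if "i \<in> middle g" for i
      using far_below_less[of i i] ae_less_asym by blast
    show "far_below i k" if "i \<in> middle g" "j \<in> middle g" "k \<in> middle g" "far_below i j" "far_below j k"
      for i j k
    proof -
      have "\<forall>\<^sub>F x in cohesive_filter. j x - i x \<le> k x - i x"
        using far_below_less[OF that(5)] unfolding ae_less_def by eventually_elim auto
      from filterlim_at_top_le[OF _ this] show ?thesis
        using that(4) unfolding far_below_def by blast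
    qed
    show "far_below i j \<or> far_below j k"
      if "i \<in> middle g" "j \<in> middle g" "k \<in> middle g" "far_below i k" for i j k
      using that far_below_cotrans by (simp add: middle_def)
    show "\<exists>h\<in>middle g. far_below i h \<and> far_below h j \<and> zeta = K"
      if ij: "i \<in> middle g" "j \<in> middle g" "far_below i j" "K \<in> {zeta}" for i j K
    proof -
      let ?h = "\<lambda>x. (i x + j x) div 2"
      have lim: "filterlim (\<lambda>x. j x - i x) at_top cohesive_filter"
        using ij(3) by (simp add: far_below_def)
      have less: "\<forall>\<^sub>F x in cohesive_filter. i x < j x"
        using far_below_less[OF ij(3)] by (simp add: ae_less_def)
      have "far_below i ?h" "far_below ?h j"
        unfolding far_below_def
        by (rule filterlim_at_top_linear_if[OF lim less, of 2 _ 1], linarith)+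
      moreover have "?h \<in> middle g"
      proof -
        have "filterlim ?h at_top cohesive_filter" "filterlim (\<lambda>x. g x - ?h x) at_top cohesive_filter"
          using ij by (auto simp: middle_def intro: filterlim_at_top_linear_if[OF _ less, of i 1 _ 0]
              filterlim_at_top_linear_if[OF _ less, of "\<lambda>x. g x - j x" 1 _ 0])
        then show ?thesis
          using ij by (simp add: middle_def computable_div computable_const computable_add)
      qed
      ultimately show ?thesis using ij by blast
    qed
    show "\<exists>h\<in>middle g. far_below h i \<and> zeta = K" if i: "i \<in> middle g" "K \<in> {zeta}" for i K
    proof -
      let ?h = "\<lambda>x. i x div 2"
      have lim: "filterlim i at_top cohesive_filter" "filterlim (\<lambda>x. g x - i x) at_top cohesive_filter"
        using i by (auto simp: middle_def)
      have "far_below ?h i" "filterlim ?h at_top cohesive_filter"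
        unfolding far_below_def
        by (rule filterlim_at_top_linear_if[OF lim(1) eventually_True, of 2 _ 1], linarith)+
      moreover have "filterlim (\<lambda>x. g x - ?h x) at_top cohesive_filter"
        by (rule filterlim_at_top_linear_if[OF lim(2) eventually_True, of 1 _ 0]) simp
      ultimately show ?thesis
        using i by (intro bexI[of _ ?h]) (auto simp: middle_def computable_div computable_const)
    qed
    show "\<exists>h\<in>middle g. far_below i h \<and> zeta = K" if i: "i \<in> middle g" "K \<in> {zeta}" for i K
    proof -
      let ?h = "\<lambda>x. (i x + g x) div 2"
      have lim: "filterlim i at_top cohesive_filter" "filterlim (\<lambda>x. g x - i x) at_top cohesive_filter"
        using i by (auto simp: middle_def)
      have less: "\<forall>\<^sub>F x in cohesive_filter. i x < g x" using ineq i by blast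
      have "far_below i ?h" "filterlim (\<lambda>x. g x - ?h x) at_top cohesive_filter"
        unfolding far_below_def
        by (rule filterlim_at_top_linear_if[OF lim(2) less, of 2 _ 1], linarith)+
      moreover have "filterlim ?h at_top cohesive_filter"
        by (rule filterlim_at_top_linear_if[OF lim(1) less, of 1 _ 0]) simp
      ultimately show ?thesis
        using i g(1) by (intro bexI[of _ ?h]) (auto simp: middle_def computable_div computable_const computable_add)
    qed
  qed auto
  show "dense_coloring {zeta} (\<lambda>_. zeta)"
    by (auto simp: dense_coloring_def intro: dense)
  show "ae_less i j \<and> \<not> ae_less j i" if "far_below i j" for i j
    using far_below_less[OF that] ae_less_asym by blast
  show "represents {j \<in> middle g. \<not> far_below i j \<and> \<not> far_below j i} ae_less zeta"
    if "i \<in> middle g" for i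
    using that by (rule represents_zeta)
qed

text \<open>Standard indices, indices at standard distance from \<open>g\<close>, and those in
  between yield the three summands; \<open>eventually_const_or_at_top\<close>, applied to
  \<open>i\<close> and to \<open>g - i\<close>, shows that there is no fourth kind.\<close>

lemma represents_alpha:
  assumes g: "computable g" "filterlim g at_top cohesive_filter"
  shows "represents (below g) ae_less alpha"
proof -
  define L where "L = {i. computable i \<and> (\<exists>k. \<forall>\<^sub>F x in cohesive_filter. i x = k)}"
  define U where "U = {i. computable i \<and> (\<exists>k. \<forall>\<^sub>F x in cohesive_filter. i x + Suc k = g x)}"
  have gt: "\<forall>\<^sub>F x in cohesive_filter. k < g x" for k
    using filterlim_at_top_ge[OF g(2), of "Suc k"] by (auto elim: eventually_mono)
  have less: "L \<union> (middle g \<union> U) = below g"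
  proof (intro equalityI subsetI)
    fix i assume "i \<in> L \<union> (middle g \<union> U)"
    then consider k where "computable i" "\<forall>\<^sub>F x in cohesive_filter. i x = k" | "i \<in> middle g"
      | k where "computable i" "\<forall>\<^sub>F x in cohesive_filter. i x + Suc k = g x"
      by (auto simp: L_def U_def)
    then show "i \<in> below g"
    proof cases
      case (1 k)
      from 1(2) gt[of k] have "ae_less i g" unfolding ae_less_def by eventually_elim simp
      then show ?thesis using 1 by (simp add: below_def)
    next
      case 2
      then show ?thesis using far_below_less[of i g] by (simp add: middle_def below_def far_below_def)
    next
      case (3 k)
      from 3(2) have "ae_less i g" unfolding ae_less_def by eventually_elim simp
      then show ?thesis using 3 by (simp add: below_def)
    qed
  next
    fix i assume i: "i \<in> below g"
    then have comp: "computable i" by (simp add: below_def)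
    show "i \<in> L \<union> (middle g \<union> U)"
    proof (rule eventually_const_or_at_top[OF comp])
      show ?thesis if "\<forall>\<^sub>F x in cohesive_filter. i x = k" for k
        using that comp by (auto simp: L_def)
      assume lim: "filterlim i at_top cohesive_filter"
      show ?thesis
      proof (rule eventually_const_or_at_top[OF computable_diff[OF g(1) comp]])
        show ?thesis if c: "\<forall>\<^sub>F x in cohesive_filter. g x - i x = k" for k
        proof -
          \<comment> \<open>The top index \<open>g - 1\<close> corresponds to 0 in the reversed
            \<omega>, hence \<open>k - 1\<close>; \<open>k\<close> is positive because
            \<open>i\<close> is below \<open>g\<close>.\<close>
          have "\<forall>\<^sub>F x in cohesive_filter. i x + Suc (k - 1) = g x"
            using c i unfolding below_def ae_less_def by (auto elim: eventually_elim2)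
          then show ?thesis using comp by (auto simp: U_def)
        qed
      qed (use lim comp in \<open>simp add: middle_def\<close>)
    qed
  qed
  have "represents L ae_less omega"
  proof -
    define v where "v = (\<lambda>i. SOME k. \<forall>\<^sub>F x in cohesive_filter. i x = (k :: nat))"
    have v: "\<forall>\<^sub>F x in cohesive_filter. i x = v i" if "i \<in> L" for i
      using that unfolding v_def L_def by (auto intro: someI_ex)
    have "represents (UNIV :: nat set) (<) omega"
      by (rule representsI[of _ "\<lambda>x. x"]) (auto simp: omega_def std_order_def)
    then show ?thesis
    proof (rule represents_image[where \<phi> = v])
      fix k :: nat
      have mem: "(\<lambda>x. k) \<in> L" using computable_const by (auto simp: L_def)
      from v[OF this] have "v (\<lambda>x. k) = k" by simp
      then show "\<exists>i\<in>L. \<not> v i < k \<and> \<not> k < v i" using mem by (intro bexI[of _ "\<lambda>x. k"]) auto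
      show "ae_less i j \<longleftrightarrow> v i < v j" if "i \<in> L" "j \<in> L" for i j
      proof -
        have "ae_less i j \<longleftrightarrow> (\<forall>\<^sub>F x in cohesive_filter. v i < v j)"
          unfolding ae_less_def
          by (rule eventually_cong[OF eventually_conj[OF v[OF that(1)] v[OF that(2)]]]) auto
        then show ?thesis by simp
      qed
    qed auto
  qed
  moreover have "represents U ae_less (reverse_order omega)"
  proof -
    define v where "v = (\<lambda>i. SOME k. \<forall>\<^sub>F x in cohesive_filter. i x + Suc k = g x)"
    have v: "\<forall>\<^sub>F x in cohesive_filter. i x + Suc (v i) = g x" if "i \<in> U" for i
      using that unfolding v_def U_def by (auto intro: someI_ex)
    have "represents (UNIV :: nat set) (\<lambda>x y. y < x) (reverse_order omega)"
      by (rule representsI[of _ "\<lambda>x. x"]) (auto simp: omega_def std_order_def reverse_order_def)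
    then show ?thesis
    proof (rule represents_image[where \<phi> = v])
      fix k :: nat
      have ev: "\<forall>\<^sub>F x in cohesive_filter. (g x - Suc k) + Suc k = g x"
        using gt[of k] by eventually_elim simp
      then have mem: "(\<lambda>x. g x - Suc k) \<in> U"
        using computable_diff[OF g(1) computable_const] by (auto simp: U_def)
      have "v (\<lambda>x. g x - Suc k) = k"
        using eventually_not_both[OF v[OF mem] ev] by fastforce
      then show "\<exists>i\<in>U. \<not> k < v i \<and> \<not> v i < k"
        using mem by (intro bexI[of _ "\<lambda>x. g x - Suc k"]) auto
      show "ae_less i j \<longleftrightarrow> v j < v i" if "i \<in> U" "j \<in> U" for i j
      proof -
        have "ae_less i j \<longleftrightarrow> (\<forall>\<^sub>F x in cohesive_filter. v j < v i)"
          unfolding ae_less_def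
          by (rule eventually_cong[OF eventually_conj[OF v[OF that(1)] v[OF that(2)]]]) auto
        then show ?thesis by simp
      qed
    qed auto
  qed
  moreover have LMU: "ae_less i j" if i: "i \<in> L" and j: "j \<in> middle g \<union> U" for i j
  proof -
    obtain k where k: "\<forall>\<^sub>F x in cohesive_filter. i x = k" using i by (auto simp: L_def)
    have "filterlim j at_top cohesive_filter"
    proof (cases "j \<in> middle g")
      case False
      then obtain m where "\<forall>\<^sub>F x in cohesive_filter. j x + Suc m = g x"
        using j by (auto simp: U_def)
      then have "\<forall>\<^sub>F x in cohesive_filter. g x \<le> 1 * j x + Suc m" by eventually_elim simp
      then show ?thesis by (rule filterlim_at_top_linear[OF g(2)])
    qed (simp add: middle_def)
    from filterlim_at_top_ge[OF this, of "Suc k"] k show ?thesis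
      unfolding ae_less_def by eventually_elim simp
  qed
  moreover have MU: "ae_less i j" if i: "i \<in> middle g" and j: "j \<in> U" for i j
  proof -
    obtain k where k: "\<forall>\<^sub>F x in cohesive_filter. j x + Suc k = g x" using j by (auto simp: U_def)
    have "filterlim (\<lambda>x. g x - i x) at_top cohesive_filter" using i by (simp add: middle_def)
    from filterlim_at_top_ge[OF this, of "Suc (Suc k)"] k show ?thesis
      unfolding ae_less_def by eventually_elim simp
  qed
  ultimately have "represents (L \<union> (middle g \<union> U)) ae_less alpha"
    unfolding alpha_def by (intro represents_plus represents_middle g) (auto dest: ae_less_asym)
  then show ?thesis by (simp only: less)
qed

end

section \<open>The cohesive power of a c.e. order\<close>

lemma ord_isoI_represents_omega:
  assumes "represents A lt omega" "bij_betw f (elems M) A"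
    "\<And>x y. x \<in> elems M \<Longrightarrow> y \<in> elems M \<Longrightarrow> (x, y) \<in> less_rel M \<longleftrightarrow> lt (f x) (f y)"
    "\<And>x. x \<in> A \<Longrightarrow> \<not> lt x x" "\<And>x y. x \<in> A \<Longrightarrow> y \<in> A \<Longrightarrow> x \<noteq> y \<Longrightarrow> lt x y \<or> lt y x"
  shows "M \<simeq> omega"
proof (rule represents_imp_ord_iso)
  have f: "f x \<in> A" if "x \<in> elems M" for x using assms(2) that by (rule bij_betw_apply)
  show "represents (elems M) (\<lambda>x y. (x, y) \<in> less_rel M) omega"
  proof (rule represents_image[OF assms(1), of _ f])
    show "\<exists>x\<in>elems M. \<not> lt (f x) a \<and> \<not> lt a (f x)" if "a \<in> A" for a
    proof -
      have "a \<in> f ` elems M" using assms(2) that by (simp add: bij_betw_def)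
      then show ?thesis using assms(4)[OF that] by blast
    qed
  qed (use f assms(3) in auto)
  show "(x, x) \<notin> less_rel M" if "x \<in> elems M" for x
    using assms(3)[OF that that] assms(4)[OF f[OF that]] by simp
  show "(x, y) \<in> less_rel M \<or> (y, x) \<in> less_rel M"
    if "x \<in> elems M" "y \<in> elems M" "x \<noteq> y" for x y
  proof -
    have "f x \<noteq> f y" using assms(2) that by (auto simp: bij_betw_def dest: inj_onD)
    then show ?thesis using assms(3,5) f that by blast
  qed
qed

text \<open>The comparison is decidable on all numbers; only membership, witnessed by a stage
  \<open>s\<close> with \<open>W a s\<close>, is c.e.\<close>

locale ce_linear_order = co_ce_cohesive +
  fixes W less :: "nat \<Rightarrow> nat \<Rightarrow> bool"
  assumes decidable_W: "decidable2 W" and decidable_less: "decidable2 less"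
    and irrefl: "\<not> less a a"
    and trans: "less a b \<Longrightarrow> less b c \<Longrightarrow> less a c"
    and total: "a \<noteq> b \<Longrightarrow> less a b \<or> less b a"
begin

definition A :: "nat set" where "A = {a. \<exists>s. W a s}"

text \<open>A computable copy of the c.e. order \<open>A\<close>: an element carries the stage at which it appears.\<close>

definition M_elems :: "nat set" where
  "M_elems = {x. W (pi1 x) (pi2 x) \<and> (\<forall>t<pi2 x. \<not> W (pi1 x) t)}"

definition M :: "nat ord_struct" where
  "M = \<lparr>elems = M_elems,
     less_rel = {(x, y). x \<in> M_elems \<and> y \<in> M_elems \<and> less (pi1 x) (pi1 y)}\<rparr>"

lemma elems_M [simp]: "elems M = M_elems" by (simp add: M_def)

lemma pi1_in_A: "x \<in> M_elems \<Longrightarrow> pi1 x \<in> A" by (auto simp: M_elems_def A_def)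

lemma M_elems_unique: "x \<in> M_elems \<Longrightarrow> y \<in> M_elems \<Longrightarrow> pi1 x = pi1 y \<Longrightarrow> x = y"
proof -
  assume "x \<in> M_elems" "y \<in> M_elems" "pi1 x = pi1 y"
  moreover from this have "pi2 x = pi2 y"
    by (metis (mono_tags, lifting) M_elems_def linorder_neqE_nat mem_Collect_eq)
  ultimately show "x = y" by (metis prod.collapse prod_decode_inverse)
qed

lemma M_elems_ex: "a \<in> A \<Longrightarrow> prod_encode (a, LEAST s. W a s) \<in> M_elems"
  by (auto simp: M_elems_def A_def intro: LeastI dest: not_less_Least)

lemma bij_pi1: "bij_betw pi1 M_elems A"
proof -
  have "a \<in> pi1 ` M_elems" if "a \<in> A" for a
    using M_elems_ex[OF that] by (rule rev_image_eqI) simp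
  then show ?thesis
    unfolding bij_betw_def using M_elems_unique pi1_in_A by (auto intro!: inj_onI)
qed

lemma decidable_M_elems: "computable f \<Longrightarrow> decidable (\<lambda>x. f x \<in> M_elems)"
  unfolding M_elems_def mem_Collect_eq
  by (intro decidable_conj decidable2_comp[OF decidable_W] decidable_ball)
    (auto simp: decidable2_def intro!: computable_intros decidable2_comp[OF decidable_W]
      computable_comp[of f])

lemma computable_linear_order_M: "computable_linear_order M"
  unfolding computable_linear_order_def
proof (intro conjI)
  show "linear_order_struct M"
    unfolding linear_order_struct_def strict_linear_order_on_def
  proof (intro conjI)
    show "less_rel M \<subseteq> elems M \<times> elems M" by (auto simp: M_def)
    show "trans (less_rel M)" using trans by (auto simp: M_def intro!: transI)
    show "irrefl (less_rel M)" using irrefl by (auto simp: M_def irrefl_def)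
    show "total_on (elems M) (less_rel M)"
      using total M_elems_unique by (auto simp: M_def total_on_def)
  qed
  show "computable_set (elems M)"
    using decidable_M_elems[OF computable_id]
    by (simp add: computable_set_def decidable_def computable_def)
  have "x \<in> prod_encode ` less_rel M \<longleftrightarrow>
      pi1 x \<in> M_elems \<and> pi2 x \<in> M_elems \<and> less (pi1 (pi1 x)) (pi1 (pi2 x))" for x
    using image_iff[of x prod_encode "less_rel M"]
    by (metis (mono_tags, lifting) M_def case_prod_conv mem_Collect_eq ord_struct.select_convs(2)
        prod.collapse prod_decode_inverse prod_encode_inverse)
  moreover have "decidable (\<lambda>x.
      pi1 x \<in> M_elems \<and> pi2 x \<in> M_elems \<and> less (pi1 (pi1 x)) (pi1 (pi2 x)))"
    by (intro decidable_conj decidable_M_elems decidable2_comp[OF decidable_less] computable_intros)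
  ultimately show "computable_rel (less_rel M)"
    by (simp add: computable_rel_def computable_set_def decidable_def computable_def)
qed

lemma M_omega:
  assumes "represents A less omega"
  shows "M \<simeq> omega"
  using assms bij_pi1[folded elems_M] by (rule ord_isoI_represents_omega)
    (use irrefl total in \<open>auto simp: M_def\<close>)

section \<open>The power described by total computable functions with values in
  \<open>A\<close>\<close>

definition funs :: "(nat \<Rightarrow> nat) set" where
  "funs = {f. computable f \<and> (\<forall>\<^sub>F x in cohesive_filter. f x \<in> A)}"

definition lt :: "(nat \<Rightarrow> nat) \<Rightarrow> (nat \<Rightarrow> nat) \<Rightarrow> bool" where
  "lt f g \<longleftrightarrow> (\<forall>\<^sub>F x in cohesive_filter. less (f x) (g x))"

lemma lt_asym: "lt f g \<Longrightarrow> \<not> lt g f"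
  unfolding lt_def using trans irrefl by (blast dest: eventually_not_both)

lemma lt_total:
  assumes "computable f" "computable g" "\<not> lt f g" "\<not> lt g f"
  shows "\<forall>\<^sub>F x in cohesive_filter. f x = g x"
proof -
  have "\<forall>\<^sub>F x in cohesive_filter. \<not> less (f x) (g x)" "\<forall>\<^sub>F x in cohesive_filter. \<not> less (g x) (f x)"
    using assms eventually_dichotomy'[OF decidable2_comp[OF decidable_less]] by (auto simp: lt_def)
  then show ?thesis by eventually_elim (use total in blast)
qed

lemma eventually_not_iff_lt:
  assumes "\<forall>\<^sub>F x in cohesive_filter. f x = g x"
  shows "\<not> lt f g"
  unfolding lt_def using assms irrefl by (auto dest: eventually_not_both)

lemma almost_subset_iff: "C \<subseteq>* B \<longleftrightarrow> (\<forall>\<^sub>F x in cohesive_filter. x \<in> B)"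
  by (simp add: almost_subset_def eventually_cohesive set_diff_eq)

text \<open>Where \<open>\<phi>\<close> halts, a halting stage can be searched for, and
  \<open>computable_choice\<close> makes this search total at the cost of finitely many elements of
  \<open>C\<close>. The stage component of the value is dropped.\<close>

lemma total_representative:
  assumes "\<phi> \<in> power_funs C M"
  shows "\<exists>f. computable f \<and> (\<forall>\<^sub>F x in cohesive_filter. \<exists>y\<in>M_elems. \<phi> x = Some y \<and> pi1 y = f x)"
proof -
  have \<phi>: "partial_computable \<phi>" "ran \<phi> \<subseteq> M_elems" "\<forall>\<^sub>F x in cohesive_filter. x \<in> dom \<phi>"
    using assms by (auto simp: power_funs_def almost_subset_iff)
  obtain F where F: "approximates F \<phi>" using partial_computable_approximates[OF \<phi>(1)] by blast
  have "decidable2 (\<lambda>x t. F x t \<noteq> 0)"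
    unfolding decidable2_def
    by (intro computable_intros computable2_comp[OF approximatesD(1)[OF F]])
  moreover have "\<exists>t. F x t \<noteq> 0" if dom: "x \<in> dom \<phi>" for x
  proof -
    obtain y where "\<phi> x = Some y" using dom by auto
    from approximatesD(3)[OF F this] obtain t where "F x t = Suc y"
      by (auto simp: eventually_sequentially)
    then show ?thesis by (intro exI[of _ t]) simp
  qed
  then have "\<forall>\<^sub>F x in cohesive_filter. \<exists>t. F x t \<noteq> 0"
    by (rule eventually_mono[OF \<phi>(3)])
  ultimately obtain g where g: "computable g" "\<forall>\<^sub>F x in cohesive_filter. F x (g x) \<noteq> 0"
    by (rule computable_choice)
  let ?f = "\<lambda>x. pi1 (F x (g x) - 1)"
  have "computable ?f"
    by (intro computable_intros computable2_comp[OF approximatesD(1)[OF F]] g(1))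
  moreover have "\<forall>\<^sub>F x in cohesive_filter. \<exists>y\<in>M_elems. \<phi> x = Some y \<and> pi1 y = ?f x"
    using g(2)
  proof eventually_elim
    case (elim x)
    then obtain y where "F x (g x) = Suc y" using not0_implies_Suc by blast
    moreover from this have "\<phi> x = Some y" by (rule approximatesD(2)[OF F])
    ultimately show ?case using \<phi>(2) by (auto intro: ranI)
  qed
  ultimately show ?thesis by blast
qed

definition rep :: "(nat \<rightharpoonup> nat) \<Rightarrow> nat \<Rightarrow> nat" where
  "rep \<phi> = (SOME f. computable f \<and>
     (\<forall>\<^sub>F x in cohesive_filter. \<exists>y\<in>M_elems. \<phi> x = Some y \<and> pi1 y = f x))"

lemma rep:
  assumes "\<phi> \<in> power_funs C M"
  shows "computable (rep \<phi>)"
    "\<forall>\<^sub>F x in cohesive_filter. \<exists>y\<in>M_elems. \<phi> x = Some y \<and> pi1 y = rep \<phi> x"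
  using someI_ex[OF total_representative[OF assms]] by (simp_all add: rep_def)

lemma rep_in_funs: "\<phi> \<in> power_funs C M \<Longrightarrow> rep \<phi> \<in> funs"
  unfolding funs_def using rep[of \<phi>] by (auto elim!: eventually_mono simp: pi1_in_A dest: sym)

lemma rep_surj:
  assumes "f \<in> funs"
  shows "\<exists>\<phi>\<in>power_funs C M. \<forall>\<^sub>F x in cohesive_filter. rep \<phi> x = f x"
proof -
  \<comment> \<open>The way back restores the stage; the search for it diverges where
    \<open>f x\<close> is outside \<open>A\<close>, that is, at only finitely many elements of
    \<open>C\<close>.\<close>
  define \<phi> where "\<phi> = (\<lambda>x. if \<exists>s. W (f x) s then Some (prod_encode (f x, LEAST s. W (f x) s)) else None)"
  have f: "computable f" "\<forall>\<^sub>F x in cohesive_filter. f x \<in> A" using assms by (auto simp: funs_def)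
  have "decidable2 (\<lambda>x s. W (f x) s)"
    unfolding decidable2_def
    by (intro decidable2_comp[OF decidable_W] computable_intros computable_comp[OF f(1)])
  from pc_pair[OF f(1)[unfolded computable_def] partial_computable_search[OF this]]
  have "partial_computable \<phi>"
    by (rule back_subst[of partial_computable]) (auto simp: \<phi>_def)
  moreover have "ran \<phi> \<subseteq> M_elems"
    using M_elems_ex by (auto simp: \<phi>_def ran_def A_def split: if_splits)
  moreover have "\<forall>\<^sub>F x in cohesive_filter. x \<in> dom \<phi>"
    using f(2) by eventually_elim (auto simp: A_def \<phi>_def)
  ultimately have mem: "\<phi> \<in> power_funs C M"
    by (auto simp: power_funs_def almost_subset_iff)
  have "\<forall>\<^sub>F x in cohesive_filter. rep \<phi> x = f x"
    using rep(2)[OF mem] by eventually_elim (auto simp: \<phi>_def split: if_splits)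
  then show ?thesis using mem by blast
qed

lemma power_eq_iff:
  assumes "\<phi> \<in> power_funs C M" "\<psi> \<in> power_funs C M"
  shows "(\<phi>, \<psi>) \<in> power_eq C M \<longleftrightarrow> (\<forall>\<^sub>F x in cohesive_filter. rep \<phi> x = rep \<psi> x)"
proof -
  have "(\<forall>\<^sub>F x in cohesive_filter. \<exists>a. \<phi> x = Some a \<and> \<psi> x = Some a) \<longleftrightarrow>
      (\<forall>\<^sub>F x in cohesive_filter. rep \<phi> x = rep \<psi> x)"
    by (rule eventually_cong[OF eventually_conj[OF rep(2)[OF assms(1)] rep(2)[OF assms(2)]]])
      (use M_elems_unique in fastforce)
  then show ?thesis using assms by (simp add: power_eq_def almost_subset_iff)
qed

lemma power_less_iff:
  assumes "\<phi> \<in> power_funs C M" "\<psi> \<in> power_funs C M"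
  shows "C \<subseteq>* {x. \<exists>a b. \<phi> x = Some a \<and> \<psi> x = Some b \<and> (a, b) \<in> less_rel M} \<longleftrightarrow>
    lt (rep \<phi>) (rep \<psi>)"
  unfolding almost_subset_iff mem_Collect_eq lt_def
  by (rule eventually_cong[OF eventually_conj[OF rep(2)[OF assms(1)] rep(2)[OF assms(2)]]])
    (auto simp: M_def)

lemma power_eq_memD: "(\<phi>, \<psi>) \<in> power_eq C M \<Longrightarrow> \<psi> \<in> power_funs C M"
  by (simp add: power_eq_def)

lemma equiv_power_eq: "equiv (power_funs C M) (power_eq C M)"
proof (rule equivI)
  show "power_eq C M \<subseteq> power_funs C M \<times> power_funs C M" by (auto simp: power_eq_def)
  show "refl_on (power_funs C M) (power_eq C M)"
    using power_eq_iff by (auto intro!: refl_onI)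
  show "sym (power_eq C M)"
  proof (rule symI)
    fix \<phi> \<psi> assume r: "(\<phi>, \<psi>) \<in> power_eq C M"
    then have "\<phi> \<in> power_funs C M" "\<psi> \<in> power_funs C M" by (auto simp: power_eq_def)
    then show "(\<psi>, \<phi>) \<in> power_eq C M"
      using r by (simp add: power_eq_iff eq_commute)
  qed
  show "trans (power_eq C M)"
  proof (rule transI)
    fix \<phi> \<psi> \<chi> assume r: "(\<phi>, \<psi>) \<in> power_eq C M" "(\<psi>, \<chi>) \<in> power_eq C M"
    then have "\<phi> \<in> power_funs C M" "\<psi> \<in> power_funs C M" "\<chi> \<in> power_funs C M"
      by (auto simp: power_eq_def)
    then show "(\<phi>, \<chi>) \<in> power_eq C M"
      using r by (auto simp: power_eq_iff elim: eventually_elim2)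
  qed
qed

lemma cohesive_power_ord_iso:
  assumes "represents funs lt N"
  shows "cohesive_power C M \<simeq> N"
proof (rule represents_imp_ord_iso)
  let ?P = "power_funs C M" and ?E = "power_eq C M" and ?Q = "cohesive_power C M"
  define r where "r = (\<lambda>X. rep (SOME \<phi>. \<phi> \<in> X))"
  have elems: "elems ?Q = ?P // ?E" by (simp add: cohesive_power_def)
  have some: "(\<phi>, SOME \<psi>. \<psi> \<in> ?E `` {\<phi>}) \<in> ?E" if "\<phi> \<in> ?P" for \<phi>
  proof -
    have "\<phi> \<in> ?E `` {\<phi>}" using equiv_class_self[OF equiv_power_eq that] .
    then have "(SOME \<psi>. \<psi> \<in> ?E `` {\<phi>}) \<in> ?E `` {\<phi>}"
      by (rule someI[of "\<lambda>\<psi>. \<psi> \<in> ?E `` {\<phi>}"])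
    then show ?thesis by simp
  qed
  have r: "\<forall>\<^sub>F x in cohesive_filter. r (?E `` {\<phi>}) x = rep \<phi> x" if "\<phi> \<in> ?P" for \<phi>
    using some[OF that] power_eq_memD[OF some[OF that]] that
    by (simp add: power_eq_iff r_def eq_commute)
  have lt_cong: "lt f g \<longleftrightarrow> lt f' g'"
    if "\<forall>\<^sub>F x in cohesive_filter. f x = f' x" "\<forall>\<^sub>F x in cohesive_filter. g x = g' x" for f f' g g'
    unfolding lt_def by (rule eventually_cong[OF eventually_conj[OF that]]) auto
  have classE: thesis if "X \<in> elems ?Q" "\<And>\<phi>. \<phi> \<in> ?P \<Longrightarrow> X = ?E `` {\<phi>} \<Longrightarrow> thesis" for X thesis
    using that unfolding elems by (auto elim: quotientE)
  have class_eq: "?E `` {\<phi>} = ?E `` {\<psi>} \<longleftrightarrow> (\<forall>\<^sub>F x in cohesive_filter. rep \<phi> x = rep \<psi> x)"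
    if "\<phi> \<in> ?P" "\<psi> \<in> ?P" for \<phi> \<psi>
    using eq_equiv_class_iff[OF equiv_power_eq that] power_eq_iff[OF that] by simp
  have less: "(?E `` {\<phi>}, ?E `` {\<psi>}) \<in> less_rel ?Q \<longleftrightarrow> lt (rep \<phi>) (rep \<psi>)"
    if mem: "\<phi> \<in> ?P" "\<psi> \<in> ?P" for \<phi> \<psi>
  proof
    assume "(?E `` {\<phi>}, ?E `` {\<psi>}) \<in> less_rel ?Q"
    then obtain \<phi>' \<psi>' where *: "?E `` {\<phi>} = ?E `` {\<phi>'}" "?E `` {\<psi>} = ?E `` {\<psi>'}"
        "\<phi>' \<in> ?P" "\<psi>' \<in> ?P"
        "C \<subseteq>* {x. \<exists>a b. \<phi>' x = Some a \<and> \<psi>' x = Some b \<and> (a, b) \<in> less_rel M}"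
      unfolding cohesive_power_def by auto
    then have "lt (rep \<phi>') (rep \<psi>')" using power_less_iff by blast
    then show "lt (rep \<phi>) (rep \<psi>)"
      using lt_cong[of "rep \<phi>" "rep \<phi>'" "rep \<psi>" "rep \<psi>'"] * class_eq mem by blast
  next
    assume "lt (rep \<phi>) (rep \<psi>)"
    then have "C \<subseteq>* {x. \<exists>a b. \<phi> x = Some a \<and> \<psi> x = Some b \<and> (a, b) \<in> less_rel M}"
      using power_less_iff mem by blast
    then show "(?E `` {\<phi>}, ?E `` {\<psi>}) \<in> less_rel ?Q"
      unfolding cohesive_power_def using mem by auto
  qed
  show "represents (elems ?Q) (\<lambda>X Y. (X, Y) \<in> less_rel ?Q) N"
  proof (rule represents_image[OF assms, of _ r])
    show "r X \<in> funs" if X: "X \<in> elems ?Q" for X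
    proof (rule classE[OF X])
      fix \<phi> assume \<phi>: "\<phi> \<in> ?P" "X = ?E `` {\<phi>}"
      then have "(SOME \<psi>. \<psi> \<in> X) \<in> ?P" using power_eq_memD[OF some] by simp
      then show "r X \<in> funs" unfolding r_def by (rule rep_in_funs)
    qed
    show "\<exists>X\<in>elems ?Q. \<not> lt (r X) f \<and> \<not> lt f (r X)" if f: "f \<in> funs" for f
    proof -
      obtain \<phi> where \<phi>: "\<phi> \<in> ?P" "\<forall>\<^sub>F x in cohesive_filter. rep \<phi> x = f x"
        using rep_surj[OF f] by blast
      then have "\<forall>\<^sub>F x in cohesive_filter. r (?E `` {\<phi>}) x = f x"
        using r[OF \<phi>(1)] by (auto elim: eventually_elim2)
      then have "\<not> lt (r (?E `` {\<phi>})) f" "\<not> lt f (r (?E `` {\<phi>}))"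
        by (auto intro!: eventually_not_iff_lt elim: eventually_mono)
      moreover have "?E `` {\<phi>} \<in> elems ?Q" unfolding elems using \<phi>(1) by (rule quotientI)
      ultimately show ?thesis by blast
    qed
    show "(X, Y) \<in> less_rel ?Q \<longleftrightarrow> lt (r X) (r Y)" if X: "X \<in> elems ?Q" and Y: "Y \<in> elems ?Q" for X Y
    proof (rule classE[OF X], rule classE[OF Y])
      fix \<phi> \<psi> assume "\<phi> \<in> ?P" "X = ?E `` {\<phi>}" "\<psi> \<in> ?P" "Y = ?E `` {\<psi>}"
      then show "(X, Y) \<in> less_rel ?Q \<longleftrightarrow> lt (r X) (r Y)"
        using less lt_cong[OF r r] by blast
    qed
  qed
  show "(X, X) \<notin> less_rel ?Q" if X: "X \<in> elems ?Q" for X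
  proof (rule classE[OF X])
    fix \<phi> assume "\<phi> \<in> ?P" "X = ?E `` {\<phi>}"
    then show "(X, X) \<notin> less_rel ?Q" using less lt_asym by blast
  qed
  show "(X, Y) \<in> less_rel ?Q \<or> (Y, X) \<in> less_rel ?Q"
    if X: "X \<in> elems ?Q" and Y: "Y \<in> elems ?Q" and ne: "X \<noteq> Y" for X Y
  proof (rule classE[OF X], rule classE[OF Y])
    fix \<phi> \<psi> assume "\<phi> \<in> ?P" "X = ?E `` {\<phi>}" "\<psi> \<in> ?P" "Y = ?E `` {\<psi>}"
    then show "(X, Y) \<in> less_rel ?Q \<or> (Y, X) \<in> less_rel ?Q"
      using less class_eq lt_total rep(1) ne by blast
  qed
qed

end

section \<open>Orders of type omega with blocks at dyadic rationals\<close>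

lemma odd_mult_power2_unique:
  fixes a b :: nat
  assumes "odd a" "odd b" "a * 2 ^ q = b * 2 ^ p"
  shows "p = q \<and> a = b"
proof -
  have *: "p = q" if "odd a" "a * 2 ^ q = b * 2 ^ p" "p \<ge> q" for a b p q :: nat
  proof (rule ccontr)
    assume "p \<noteq> q"
    then obtain k where "p = q + Suc k" using \<open>p \<ge> q\<close> less_imp_Suc_add[of q p] by auto
    then have "a = b * 2 ^ Suc k" using that(2) by (simp add: power_add)
    then show False using \<open>odd a\<close> by simp
  qed
  have "p = q"
    using *[of a q b p] *[of b p a q] assms by (metis nat_le_linear)
  then show ?thesis using assms(3) by simp
qed

text \<open>The number \<open>pt_code p m i\<close> stands for the \<open>i\<close>-th point of the block that sits at the dyadic
  rational \<open>(2 * m + 1) / 2 ^ Suc p\<close>.\<close>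

definition pt_code :: "nat \<Rightarrow> nat \<Rightarrow> nat \<Rightarrow> nat" where
  "pt_code p m i = prod_encode (p, prod_encode (m, i))"

definition depth :: "nat \<Rightarrow> nat" where "depth a = pi1 a"
definition numer :: "nat \<Rightarrow> nat" where "numer a = pi1 (pi2 a)"
definition idx :: "nat \<Rightarrow> nat" where "idx a = pi2 (pi2 a)"

text \<open>The integral part of \<open>(2 * m + 1) / 2 ^ Suc p\<close> is that of
  \<open>m / 2 ^ p\<close>. As the exponent is at least 1, no block sits at an integer, which makes
  the lower bound in \<open>int_part_bounds\<close> strict.\<close>

definition int_part :: "nat \<Rightarrow> nat" where "int_part a = numer a div 2 ^ depth a"
definition val :: "nat \<Rightarrow> real" where "val a = real (2 * numer a + 1) / 2 ^ Suc (depth a)"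

definition pt_less :: "nat \<Rightarrow> nat \<Rightarrow> bool" where
  "pt_less a b \<longleftrightarrow> val a < val b \<or> val a = val b \<and> idx a < idx b"

lemma pt_code_simps [simp]:
  "depth (pt_code p m i) = p" "numer (pt_code p m i) = m" "idx (pt_code p m i) = i"
  by (simp_all add: pt_code_def depth_def numer_def idx_def)

lemma pt_code_collapse: "pt_code (depth a) (numer a) (idx a) = a"
  by (simp add: pt_code_def depth_def numer_def idx_def)

lemma computable_pt:
  assumes "computable f"
  shows "computable (\<lambda>x. depth (f x))" "computable (\<lambda>x. numer (f x))"
    "computable (\<lambda>x. idx (f x))" "computable (\<lambda>x. int_part (f x))"
  unfolding depth_def numer_def idx_def int_part_def
  by (intro computable_intros computable_div assms)+

lemma computable_pt_code:
  "computable p \<Longrightarrow> computable m \<Longrightarrow> computable i \<Longrightarrow> computable (\<lambda>x. pt_code (p x) (m x) (i x))"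
  unfolding pt_code_def by (intro computable_intros)

lemma val_less_iff:
  "val a < val b \<longleftrightarrow>
    (2 * numer a + 1) * 2 ^ Suc (depth b) < (2 * numer b + 1) * 2 ^ Suc (depth a)"
proof -
  have cross: "x / c < y / d \<longleftrightarrow> x * d < y * c" if "0 < c" "0 < d" for x y c d :: real
    using that by (simp add: field_simps)
  have "val a < val b \<longleftrightarrow>
      real (2 * numer a + 1) * 2 ^ Suc (depth b) < real (2 * numer b + 1) * 2 ^ Suc (depth a)"
    unfolding val_def by (rule cross) simp_all
  also have "\<dots> \<longleftrightarrow>
      real ((2 * numer a + 1) * 2 ^ Suc (depth b)) < real ((2 * numer b + 1) * 2 ^ Suc (depth a))"
    by (simp only: of_nat_mult of_nat_power of_nat_numeral)
  finally show ?thesis by (simp only: of_nat_less_iff)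
qed

lemma val_eq_iff: "val a = val b \<longleftrightarrow> depth a = depth b \<and> numer a = numer b"
proof
  assume eq: "val a = val b"
  have "(2 * numer a + 1) * 2 ^ Suc (depth b) = (2 * numer b + 1) * 2 ^ Suc (depth a)"
    using val_less_iff[of a b] val_less_iff[of b a] eq by simp
  then show "depth a = depth b \<and> numer a = numer b"
    using odd_mult_power2_unique[of "2 * numer a + 1" "2 * numer b + 1" "Suc (depth b)" "Suc (depth a)"]
    by simp
qed (simp add: val_def)

lemma int_part_bounds: "real (int_part a) < val a" "val a < real (int_part a) + 1"
proof -
  let ?d = "2 ^ depth a :: nat"
  have "int_part a * ?d \<le> numer a" "numer a < (int_part a + 1) * ?d"
    unfolding int_part_def
    by (simp_all add: div_times_less_eq_dividend dividend_less_div_times)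
  then have "int_part a * (2 * ?d) < 2 * numer a + 1" "2 * numer a + 1 < (int_part a + 1) * (2 * ?d)"
    by (simp_all add: algebra_simps)
  then have "real (int_part a * (2 * ?d)) < real (2 * numer a + 1)"
    "real (2 * numer a + 1) < real ((int_part a + 1) * (2 * ?d))"
    by (simp_all only: of_nat_less_iff)
  then show "real (int_part a) < val a" "val a < real (int_part a) + 1"
    unfolding val_def by (simp_all add: field_simps)
qed

lemma int_part_mono: "val a \<le> val b \<Longrightarrow> int_part a \<le> int_part b"
  using int_part_bounds[of a] int_part_bounds[of b] by linarith

lemma val_less_if_int_part_less: "int_part a < int_part b \<Longrightarrow> val a < val b"
  using int_part_mono[of b a] by linarith

lemma decidable_val_less:
  "computable f \<Longrightarrow> computable g \<Longrightarrow> decidable (\<lambda>x. val (f x) < val (g x))"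
  unfolding val_less_iff by (intro computable_intros computable_pt)

lemma decidable_pt_less: "decidable2 pt_less"
  unfolding decidable2_def pt_less_def val_eq_iff
  by (intro computable_intros computable_pt decidable_val_less)

text \<open>The dyadic rational of depth \<open>p\<close> that lies \<open>1 / 2 ^ Suc p\<close> above \<open>a\<close>.\<close>

lemma between_dyadic:
  assumes p: "depth a < p"
  defines "m \<equiv> (2 * numer a + 1) * 2 ^ (p - Suc (depth a))"
  shows "m div 2 ^ p = int_part a" "val a < val (pt_code p m i)"
    "depth b < p \<Longrightarrow> val a < val b \<Longrightarrow> val (pt_code p m i) < val b"
proof -
  obtain k where k: "p = Suc (depth a) + k" using p less_imp_Suc_add[of "depth a" p] by auto
  have m: "m = (2 * numer a + 1) * 2 ^ k" by (simp add: m_def k)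
  show "m div 2 ^ p = int_part a"
  proof -
    have "m div 2 ^ p = ((2 * numer a + 1) * 2 ^ k) div (2 ^ Suc (depth a) * 2 ^ k)"
      by (simp only: m k power_add)
    also have "\<dots> = (2 * numer a + 1) div 2 ^ Suc (depth a)"
      by (rule div_mult_mult2) simp
    also have "\<dots> = (2 * numer a + 1) div 2 div 2 ^ depth a"
      by (simp add: div_mult2_eq)
    finally show ?thesis by (simp add: int_part_def)
  qed
  show "val a < val (pt_code p m i)"
    unfolding val_less_iff pt_code_simps by (simp add: m k power_add algebra_simps)
  show "val (pt_code p m i) < val b" if "depth b < p" "val a < val b"
  proof -
    obtain l where l: "p = Suc (depth b) + l"
      using \<open>depth b < p\<close> less_imp_Suc_add[of "depth b" p] by auto
    have "(2 * numer a + 1) * 2 ^ Suc (depth b) < (2 * numer b + 1) * 2 ^ Suc (depth a)"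
      using that(2) by (simp only: val_less_iff)
    then have "(2 * numer a + 1) * 2 ^ Suc (depth b) * (2 ^ k * 2 ^ l)
        < (2 * numer b + 1) * 2 ^ Suc (depth a) * (2 ^ k * 2 ^ l)"
      by (intro mult_strict_right_mono) auto
    moreover have "(2 :: nat) ^ p = 2 ^ Suc (depth a) * 2 ^ k" by (simp only: k power_add)
    then have "(2 * numer b + 1) * 2 ^ l * 2 ^ p =
        (2 * numer b + 1) * 2 ^ Suc (depth a) * (2 ^ k * 2 ^ l)"
      by (simp only: mult_ac)
    moreover have "(2 :: nat) ^ p = 2 ^ Suc (depth b) * 2 ^ l" by (simp only: l power_add)
    then have "m * 2 ^ p = (2 * numer a + 1) * 2 ^ Suc (depth b) * (2 ^ k * 2 ^ l)"
      by (simp only: m mult_ac)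
    ultimately have "m * 2 ^ p < (2 * numer b + 1) * 2 ^ l * 2 ^ p" by (simp only:)
    \<comment> \<open>In units of \<open>1 / 2 ^ p\<close>, \<open>a\<close> and \<open>b\<close>
      are the integers \<open>m\<close> and \<open>(2 * numer b + 1) * 2 ^ l\<close>, while the new
      point is \<open>m + 1 / 2\<close>.\<close>
    then have "m < (2 * numer b + 1) * 2 ^ l" by simp
    then have "2 * m + 1 < 2 * ((2 * numer b + 1) * 2 ^ l)" by simp
    then have "(2 * m + 1) * 2 ^ Suc (depth b) < 2 * ((2 * numer b + 1) * 2 ^ l) * 2 ^ Suc (depth b)"
      by (intro mult_strict_right_mono) auto
    then show ?thesis
      unfolding val_less_iff pt_code_simps by (simp add: l power_add algebra_simps)
  qed
qed

section \<open>Domination by the elements of \<open>C\<close>\<close>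

context co_ce_cohesive
begin

text \<open>\<open>horizon j\<close> is the \<open>2 * j\<close>-th element of \<open>C\<close>. It is computable from below and along \<open>C\<close> it
  dominates every computable function (\<open>eventually_le_horizon\<close>); the factor 2 absorbs the
  finitely many exceptions in \<open>eventually_records\<close>.\<close>

definition horizon :: "nat \<Rightarrow> nat" where
  "horizon j = Max {v. card (C \<inter> {..<v}) \<le> 2 * j}"

text \<open>The counts are monotone in \<open>v\<close> and, \<open>C\<close> being infinite,
  unbounded, so the set in the definition is a finite initial segment. Later proofs refer to
  \<open>horizon\<close> through this equivalence.\<close>

lemma le_horizon_iff: "v \<le> horizon j \<longleftrightarrow> card (C \<inter> {..<v}) \<le> 2 * j"
proof -
  let ?V = "{v. card (C \<inter> {..<v}) \<le> 2 * j}"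
  have down: "v \<in> ?V" if "w \<in> ?V" "v \<le> w" for v w
  proof -
    have "card (C \<inter> {..<v}) \<le> card (C \<inter> {..<w})" using that(2) by (intro card_mono) auto
    then show ?thesis using that(1) by simp
  qed
  obtain B where B: "B \<subseteq> C" "finite B" "card B = Suc (2 * j)"
    using infinite_arbitrarily_large[OF infinite_C] by blast
  then obtain w where "B \<subseteq> {..<w}" using finite_nat_iff_bounded by blast
  then have "card B \<le> card (C \<inter> {..<w})" using B by (intro card_mono) auto
  then have "w \<notin> ?V" using B by simp
  then have "?V \<subseteq> {..<w}" using down by (meson lessThan_iff not_less subsetI)
  then have fin: "finite ?V" by (rule finite_subset) simp
  have "0 \<in> ?V" by simp
  then have "Max ?V \<in> ?V" using Max_in[OF fin] by blast
  then show ?thesis unfolding horizon_def using down Max_ge[OF fin] by blast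
qed

lemma eventually_le_horizon:
  assumes "computable u" "filterlim u at_top cohesive_filter" "computable h"
  shows "\<forall>\<^sub>F x in cohesive_filter. h x \<le> horizon (u x)"
  unfolding le_horizon_iff by (rule eventually_card_le[OF assms])

definition horizon_stage :: "nat \<Rightarrow> nat \<Rightarrow> nat \<Rightarrow> bool" where
  "horizon_stage s j v \<longleftrightarrow> card {x. x < v \<and> x \<in> C_stage s} \<le> 2 * j"

text \<open>Since \<open>C_stage s\<close> contains \<open>C\<close>, a count at a stage can only be
  too large. A stage that keeps it within \<open>2 * j\<close> is therefore conclusive, and a
  settled stage gives the exact count.\<close>

lemma le_horizon_iff_stage: "v \<le> horizon j \<longleftrightarrow> (\<exists>s. horizon_stage s j v)"
proof -
  obtain s where "\<forall>x<v. x \<in> C_stage s \<longleftrightarrow> x \<in> C" using C_stage_settles by blast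
  then have "{x. x < v \<and> x \<in> C_stage s} = C \<inter> {..<v}" by auto
  moreover have "card (C \<inter> {..<v}) \<le> card {x. x < v \<and> x \<in> C_stage t}" for t
    using C_subset_stage by (intro card_mono) auto
  ultimately show ?thesis
    unfolding le_horizon_iff horizon_stage_def by (metis le_trans)
qed

lemma decidable_horizon_stage:
  assumes "computable s" "computable j" "computable v"
  shows "decidable (\<lambda>x. horizon_stage (s x) (j x) (v x))"
  unfolding horizon_stage_def
  by (intro computable_intros computable_count assms)
    (auto simp: decidable2_def intro!: decidable_C_stage computable_intros computable_comp[OF assms(1)])

end

text \<open>\<open>S v j p\<close> is the block size computed from a lower bound \<open>v\<close> of
  the horizon; by \<open>mono_S\<close> a better bound never takes away a point.\<close>

locale block_order = co_ce_cohesive +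
  fixes S :: "nat \<Rightarrow> nat \<Rightarrow> nat \<Rightarrow> nat"
  assumes computable_S: "computable (\<lambda>z. S (pi1 z) (pi1 (pi2 z)) (pi2 (pi2 z)))"
    and mono_S: "v \<le> w \<Longrightarrow> S v j p \<le> S w j p"
begin

text \<open>The size of the block at a dyadic rational of integral part \<open>j\<close> and depth \<open>p\<close>; the block is
  absent if the size is 0.\<close>

definition size :: "nat \<Rightarrow> nat \<Rightarrow> nat" where
  "size j p = (if p \<le> horizon j then S (horizon j) j p else 0)"

text \<open>A stage codes a pair: a candidate \<open>pi1 s\<close> for a lower bound of the horizon
  and a stage \<open>pi2 s\<close> of the enumeration confirming it.\<close>

definition pt_stage :: "nat \<Rightarrow> nat \<Rightarrow> bool" where
  "pt_stage a s \<longleftrightarrow> horizon_stage (pi2 s) (int_part a) (pi1 s) \<and> depth a \<le> pi1 s \<and>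
     idx a < S (pi1 s) (int_part a) (depth a)"

lemma decidable_pt_stage: "decidable2 pt_stage"
proof -
  have "computable (\<lambda>z. prod_encode (pi1 (pi2 z), prod_encode (int_part (pi1 z), depth (pi1 z))))"
    by (intro computable_intros computable_pt)
  from computable_comp[OF computable_S this]
  have "computable (\<lambda>z. S (pi1 (pi2 z)) (int_part (pi1 z)) (depth (pi1 z)))" by simp
  then show ?thesis
    unfolding decidable2_def pt_stage_def
    by (intro decidable_conj decidable_horizon_stage decidable_le decidable_less computable_pt)
      (intro computable_intros)+
qed

sublocale ce_linear_order C pt_stage pt_less
proof
  show "decidable2 pt_stage" by (rule decidable_pt_stage)
  show "decidable2 pt_less" by (rule decidable_pt_less)
  show "pt_less a b \<or> pt_less b a" if "a \<noteq> b" for a b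
  proof (cases "val a = val b")
    case True
    then have "idx a \<noteq> idx b"
      using that pt_code_collapse[of a] pt_code_collapse[of b] by (auto simp: val_eq_iff)
    then show ?thesis using True by (auto simp: pt_less_def)
  qed (auto simp: pt_less_def)
qed (auto simp: pt_less_def)

text \<open>Points found from a lower bound are correct by \<open>mono_S\<close>; conversely the
  horizon is a lower bound of itself and is confirmed at some stage.\<close>

lemma A_iff: "a \<in> A \<longleftrightarrow> idx a < size (int_part a) (depth a)"
proof
  assume "a \<in> A"
  then obtain s where s: "pt_stage a s" by (auto simp: A_def)
  then have "pi1 s \<le> horizon (int_part a)"
    unfolding le_horizon_iff_stage by (auto simp: pt_stage_def)
  then show "idx a < size (int_part a) (depth a)"
    using s mono_S[of "pi1 s" "horizon (int_part a)" "int_part a" "depth a"]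
    by (auto simp: pt_stage_def size_def)
next
  assume *: "idx a < size (int_part a) (depth a)"
  obtain t where "horizon_stage t (int_part a) (horizon (int_part a))"
    using le_horizon_iff_stage by blast
  then have "pt_stage a (prod_encode (horizon (int_part a), t))"
    using * by (auto simp: pt_stage_def size_def split: if_splits)
  then show "a \<in> A" by (auto simp: A_def)
qed

text \<open>The horizon caps the depths, and each depth has finitely many numerators up to a given
  integral part; this is what gives the order-type \<omega>.\<close>

lemma finite_A_le: "finite {a \<in> A. int_part a \<le> k}"
proof -
  let ?F = "\<Union>j\<le>k. \<Union>p\<le>horizon j.
    (\<lambda>(m, i). pt_code p m i) ` ({..<Suc j * 2 ^ p} \<times> {..<S (horizon j) j p})"
  have "{a \<in> A. int_part a \<le> k} \<subseteq> ?F"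
  proof
    fix a assume a: "a \<in> {a \<in> A. int_part a \<le> k}"
    then have "depth a \<le> horizon (int_part a)"
      "idx a < S (horizon (int_part a)) (int_part a) (depth a)"
      by (auto simp: A_iff size_def split: if_splits)
    moreover have "numer a < Suc (int_part a) * 2 ^ depth a"
      unfolding int_part_def using dividend_less_div_times[of "2 ^ depth a" "numer a"] by simp
    ultimately show "a \<in> ?F"
      using a pt_code_collapse[of a]
      by (intro UN_I[of "int_part a"] UN_I[of "depth a"] image_eqI[of _ _ "(numer a, idx a)"]) auto
  qed
  moreover have "finite ?F" by simp
  ultimately show ?thesis by (rule finite_subset)
qed

section \<open>Standard and nonstandard elements of the power\<close>

definition nonstd :: "(nat \<Rightarrow> nat) set" where
  "nonstd = {f \<in> funs. filterlim (\<lambda>x. int_part (f x)) at_top cohesive_filter}"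

definition std :: "(nat \<Rightarrow> nat) set" where
  "std = {f \<in> funs. \<exists>a\<in>A. \<forall>\<^sub>F x in cohesive_filter. f x = a}"

text \<open>An integral part that does not tend to infinity is constant almost everywhere; by
  \<open>finite_A_le\<close> only finitely many values remain, so the function is constant as
  well.\<close>

lemma funs_eq: "funs = std \<union> nonstd"
proof -
  have "f \<in> std \<union> nonstd" if f: "f \<in> funs" for f
  proof -
    have comp: "computable f" and A: "\<forall>\<^sub>F x in cohesive_filter. f x \<in> A"
      using f by (auto simp: funs_def)
    show ?thesis
    proof (rule eventually_const_or_at_top[OF computable_pt(4)[OF comp]])
      fix k assume "\<forall>\<^sub>F x in cohesive_filter. int_part (f x) = k"
      with A have "\<forall>\<^sub>F x in cohesive_filter. f x \<in> {a \<in> A. int_part a \<le> k}"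
        by eventually_elim auto
      from eventually_constI[OF comp finite_A_le this] show ?thesis
        using f by (auto simp: std_def)
    qed (use f in \<open>simp add: nonstd_def\<close>)
  qed
  then show ?thesis by (auto simp: std_def nonstd_def)
qed

lemma std_less_nonstd: "f \<in> std \<Longrightarrow> g \<in> nonstd \<Longrightarrow> lt f g"
proof -
  assume "f \<in> std" "g \<in> nonstd"
  then obtain a where a: "\<forall>\<^sub>F x in cohesive_filter. f x = a"
    and g: "filterlim (\<lambda>x. int_part (g x)) at_top cohesive_filter"
    by (auto simp: std_def nonstd_def)
  from a filterlim_at_top_ge[OF g, of "Suc (int_part a)"] show "lt f g"
    unfolding lt_def
    by eventually_elim (use val_less_if_int_part_less in \<open>auto simp: pt_less_def Suc_le_eq\<close>)
qed

text \<open>That \<open>A\<close> is infinite is read off the power: a nonstandard function has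
  values in \<open>A\<close> of arbitrarily large integral part.\<close>

lemma A_omega:
  assumes "nonstd \<noteq> {}"
  shows "represents A pt_less omega"
proof (rule represents_omega)
  show "finite {b \<in> A. pt_less b a}" for a
    by (rule finite_subset[OF _ finite_A_le[of "int_part a"]])
      (auto simp: pt_less_def intro: int_part_mono)
  show "infinite A"
  proof
    assume fin: "finite A"
    obtain f where f: "\<forall>\<^sub>F x in cohesive_filter. f x \<in> A"
      "filterlim (\<lambda>x. int_part (f x)) at_top cohesive_filter"
      using assms by (auto simp: nonstd_def funs_def)
    have "\<forall>\<^sub>F x in cohesive_filter. Suc (Max (int_part ` A)) \<le> int_part (f x)"
      using f(2) by (rule filterlim_at_top_ge)
    moreover have "int_part a \<le> Max (int_part ` A)" if "a \<in> A" for a using fin that by simp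
    ultimately show False
      using f(1) not_less_eq_eq by (blast intro: eventually_not_both)
  qed
qed (use irrefl trans total in blast)+

lemma std_omega:
  assumes "represents A pt_less omega"
  shows "represents std lt omega"
proof -
  define v where "v = (\<lambda>f. SOME a. a \<in> A \<and> (\<forall>\<^sub>F x in cohesive_filter. f x = (a :: nat)))"
  have v: "v f \<in> A \<and> (\<forall>\<^sub>F x in cohesive_filter. f x = v f)" if "f \<in> std" for f
  proof -
    have "\<exists>a. a \<in> A \<and> (\<forall>\<^sub>F x in cohesive_filter. f x = a)" using that by (auto simp: std_def)
    then show ?thesis unfolding v_def by (rule someI_ex)
  qed
  show ?thesis
  proof (rule represents_image[OF assms, of _ v])
    show "\<exists>f\<in>std. \<not> pt_less (v f) a \<and> \<not> pt_less a (v f)" if a: "a \<in> A" for a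
    proof -
      have mem: "(\<lambda>x. a) \<in> std" using a by (auto simp: std_def funs_def computable_const)
      then have "v (\<lambda>x. a) = a" using v[OF mem] by simp
      then show ?thesis using mem irrefl by (intro bexI[of _ "\<lambda>x. a"]) auto
    qed
    show "lt f g \<longleftrightarrow> pt_less (v f) (v g)" if "f \<in> std" "g \<in> std" for f g
    proof -
      have "lt f g \<longleftrightarrow> (\<forall>\<^sub>F x in cohesive_filter. pt_less (v f) (v g))"
        unfolding lt_def
        by (rule eventually_cong[OF eventually_conj[of "\<lambda>x. f x = v f" _ "\<lambda>x. g x = v g"]])
          (use v that in auto)
      then show ?thesis by simp
    qed
  qed (use v in blast)
qed

section \<open>The order of the blocks and their colours\<close>

definition coarse :: "(nat \<Rightarrow> nat) \<Rightarrow> (nat \<Rightarrow> nat) \<Rightarrow> bool" where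
  "coarse f g \<longleftrightarrow> (\<forall>\<^sub>F x in cohesive_filter. val (f x) < val (g x))"

lemma coarse_lt: "coarse f g \<Longrightarrow> lt f g"
  unfolding coarse_def lt_def by (auto simp: pt_less_def elim: eventually_mono)

lemma not_coarse:
  assumes "computable f" "computable g"
  shows "\<not> coarse f g \<longleftrightarrow> (\<forall>\<^sub>F x in cohesive_filter. val (g x) \<le> val (f x))"
  unfolding coarse_def not_eventually_iff[OF decidable_val_less[OF assms]] not_less ..

text \<open>\<open>Some k\<close> is the color of the blocks of \<open>k\<close> elements, \<open>None\<close> that of the blocks of nonstandard
  size.\<close>

definition has_color :: "nat option \<Rightarrow> (nat \<Rightarrow> nat) \<Rightarrow> (nat \<Rightarrow> nat) \<Rightarrow> bool" where
  "has_color q j p \<longleftrightarrow> (\<exists>g. computable g \<and> (\<forall>\<^sub>F x in cohesive_filter. size (j x) (p x) = g x) \<and>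
     (case q of Some k \<Rightarrow> \<forall>\<^sub>F x in cohesive_filter. g x = k
      | None \<Rightarrow> filterlim g at_top cohesive_filter))"

lemma has_color_cong:
  assumes "has_color q j p" "\<forall>\<^sub>F x in cohesive_filter. size (j x) (p x) = size (j' x) (p' x)"
  shows "has_color q j' p'"
proof -
  obtain g where g: "computable g" "\<forall>\<^sub>F x in cohesive_filter. size (j x) (p x) = g x"
    "case q of Some k \<Rightarrow> \<forall>\<^sub>F x in cohesive_filter. g x = k
      | None \<Rightarrow> filterlim g at_top cohesive_filter"
    using assms(1) by (auto simp: has_color_def)
  from g(2) assms(2) have "\<forall>\<^sub>F x in cohesive_filter. size (j' x) (p' x) = g x"
    by eventually_elim simp
  with g(1,3) show ?thesis unfolding has_color_def by blast
qed

lemma has_color_unique: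
  assumes "has_color q j p" "has_color q' j p"
  shows "q = q'"
proof -
  obtain g where g: "\<forall>\<^sub>F x in cohesive_filter. size (j x) (p x) = g x"
    "case q of Some k \<Rightarrow> \<forall>\<^sub>F x in cohesive_filter. g x = k
      | None \<Rightarrow> filterlim g at_top cohesive_filter"
    using assms(1) by (auto simp: has_color_def)
  obtain g' where g': "\<forall>\<^sub>F x in cohesive_filter. size (j x) (p x) = g' x"
    "case q' of Some k \<Rightarrow> \<forall>\<^sub>F x in cohesive_filter. g' x = k
      | None \<Rightarrow> filterlim g' at_top cohesive_filter"
    using assms(2) by (auto simp: has_color_def)
  have eq: "\<forall>\<^sub>F x in cohesive_filter. g x = g' x" using g(1) g'(1) by eventually_elim simp
  have lim: "filterlim g at_top cohesive_filter \<longleftrightarrow> filterlim g' at_top cohesive_filter"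
    by (rule filterlim_cong[OF refl refl eq])
  show ?thesis
  proof (cases q; cases q')
    fix k l assume q: "q = Some k" "q' = Some l"
    have "\<forall>\<^sub>F x in cohesive_filter. g x = k" "\<forall>\<^sub>F x in cohesive_filter. g' x = l"
      using g(2) g'(2) q by auto
    with eq have "\<forall>\<^sub>F x in cohesive_filter. k = l" by eventually_elim simp
    then show ?thesis using q by simp
  qed (use g(2) g'(2) lim not_at_top_if_eventually_eq in auto)
qed

end

text \<open>\<open>color_ex\<close> says that no block of the nonstandard part has an unwanted size,
  \<open>color_realized\<close> that every wanted one occurs beyond each computable depth. Size 0 is
  excluded because it means absence.\<close>

locale colored_block_order = block_order C S for C S +
  fixes Z :: "nat option set"
  assumes Z_nonempty: "Z \<noteq> {}" and no_zero: "Some 0 \<notin> Z"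
    and color_ex: "computable j \<Longrightarrow> filterlim j at_top cohesive_filter \<Longrightarrow> computable p \<Longrightarrow>
      \<forall>\<^sub>F x in cohesive_filter. 0 < size (j x) (p x) \<Longrightarrow> \<exists>q\<in>Z. has_color q j p"
    and color_realized: "q \<in> Z \<Longrightarrow> computable j \<Longrightarrow> filterlim j at_top cohesive_filter \<Longrightarrow>
      computable P \<Longrightarrow> \<exists>p. computable p \<and> (\<forall>x. P x \<le> p x) \<and> has_color q j p"
begin

definition color :: "(nat \<Rightarrow> nat) \<Rightarrow> nat option" where
  "color f = (SOME q. q \<in> Z \<and> has_color q (\<lambda>x. int_part (f x)) (\<lambda>x. depth (f x)))"

lemma color:
  assumes "f \<in> nonstd"
  shows "color f \<in> Z" "has_color (color f) (\<lambda>x. int_part (f x)) (\<lambda>x. depth (f x))"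
proof -
  have f: "computable f" "\<forall>\<^sub>F x in cohesive_filter. f x \<in> A"
    "filterlim (\<lambda>x. int_part (f x)) at_top cohesive_filter"
    using assms by (auto simp: nonstd_def funs_def)
  from f(2) have "\<forall>\<^sub>F x in cohesive_filter. 0 < size (int_part (f x)) (depth (f x))"
    by eventually_elim (auto simp: A_iff)
  then have "\<exists>q. q \<in> Z \<and> has_color q (\<lambda>x. int_part (f x)) (\<lambda>x. depth (f x))"
    using color_ex[OF computable_pt(4)[OF f(1)] f(3) computable_pt(1)[OF f(1)]] by blast
  from someI_ex[OF this]
  show "color f \<in> Z" "has_color (color f) (\<lambda>x. int_part (f x)) (\<lambda>x. depth (f x))"
    by (simp_all add: color_def)
qed

lemma color_eqI:
  "f \<in> nonstd \<Longrightarrow> has_color q (\<lambda>x. int_part (f x)) (\<lambda>x. depth (f x)) \<Longrightarrow> color f = q"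
  using color(2) has_color_unique by blast

text \<open>By \<open>no_zero\<close> the block at the prescribed place is non-empty, so it has a
  point with index 0.\<close>

lemma nonstdI:
  assumes "q \<in> Z" "has_color q j p" "computable p" "computable m"
    "filterlim j at_top cohesive_filter" "\<And>x. m x div 2 ^ p x = j x"
  shows "(\<lambda>x. pt_code (p x) (m x) 0) \<in> nonstd \<and> color (\<lambda>x. pt_code (p x) (m x) 0) = q"
proof -
  let ?h = "\<lambda>x. pt_code (p x) (m x) 0"
  obtain g where g: "\<forall>\<^sub>F x in cohesive_filter. size (j x) (p x) = g x"
    "case q of Some k \<Rightarrow> \<forall>\<^sub>F x in cohesive_filter. g x = k
      | None \<Rightarrow> filterlim g at_top cohesive_filter"
    using assms(2) by (auto simp: has_color_def)
  have j: "int_part (?h x) = j x" for x using assms(6) by (simp add: int_part_def)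
  have "\<forall>\<^sub>F x in cohesive_filter. 0 < g x"
  proof (cases q)
    case None
    then show ?thesis using g(2) filterlim_at_top_ge[of g cohesive_filter 1] by (simp add: Suc_le_eq)
  next
    case (Some k)
    then have "0 < k" using assms(1) no_zero by (cases k) auto
    then show ?thesis using g(2) Some by (auto elim: eventually_mono)
  qed
  with g(1) have "\<forall>\<^sub>F x in cohesive_filter. ?h x \<in> A"
    by eventually_elim (simp add: A_iff j)
  then have "?h \<in> nonstd"
    using assms(3-5) by (simp add: nonstd_def funs_def j computable_pt_code computable_const)
  moreover from this have "color ?h = q"
    using assms(2) by (intro color_eqI) (simp_all add: j)
  ultimately show ?thesis ..
qed

lemma not_coarse_eq:
  assumes "f \<in> nonstd" "g \<in> nonstd" "\<not> coarse f g" "\<not> coarse g f"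
  shows "\<forall>\<^sub>F x in cohesive_filter. depth (f x) = depth (g x) \<and> numer (f x) = numer (g x)"
proof -
  have "computable f" "computable g" using assms by (auto simp: nonstd_def funs_def)
  then have "\<forall>\<^sub>F x in cohesive_filter. val (g x) \<le> val (f x)"
    "\<forall>\<^sub>F x in cohesive_filter. val (f x) \<le> val (g x)"
    using not_coarse assms by blast+
  then show ?thesis by eventually_elim (simp flip: val_eq_iff)
qed

text \<open>Between \<open>f\<close> and \<open>g\<close> goes the point just above \<open>f\<close>
  from \<open>between_dyadic\<close>, at a depth beyond both that \<open>color_realized\<close>
  supplies. For points below and above, the integral part is halved or increased by one.
  \<open>ord_of\<close> stays arbitrary so that the result applies to orders of different element
  types.\<close>

lemma dense_colored_nonstd: "dense_colored_order nonstd coarse (\<lambda>f. ord_of (color f)) (ord_of ` Z)"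
proof
  have comp: "computable f" and lim: "filterlim (\<lambda>x. int_part (f x)) at_top cohesive_filter"
    if "f \<in> nonstd" for f using that by (auto simp: nonstd_def funs_def)
  show "countable nonstd"
    by (rule countable_subset[OF _ countable_computable]) (auto simp: nonstd_def funs_def)
  show "\<not> coarse f f" for f by (simp add: coarse_def)
  show "coarse f h" if "coarse f g" "coarse g h" for f g h
    using that unfolding coarse_def by eventually_elim simp
  show "coarse f g \<or> coarse g h" if "f \<in> nonstd" "g \<in> nonstd" "h \<in> nonstd" "coarse f h" for f g h
  proof (rule ccontr)
    assume "\<not> (coarse f g \<or> coarse g h)"
    then have "\<forall>\<^sub>F x in cohesive_filter. val (g x) \<le> val (f x)"
      "\<forall>\<^sub>F x in cohesive_filter. val (h x) \<le> val (g x)"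
      using not_coarse comp that by blast+
    then have "\<forall>\<^sub>F x in cohesive_filter. val (h x) \<le> val (f x)" by eventually_elim simp
    then show False using that(4) unfolding coarse_def by (rule eventually_not_both) simp
  qed
  show "ord_of (color f) \<in> ord_of ` Z" if "f \<in> nonstd" for f using color(1)[OF that] by blast
  show "ord_of (color f) = ord_of (color g)"
    if "f \<in> nonstd" "g \<in> nonstd" "\<not> coarse f g" "\<not> coarse g f" for f g
  proof -
    have eq: "\<forall>\<^sub>F x in cohesive_filter. size (int_part (f x)) (depth (f x)) = size (int_part (g x)) (depth (g x))"
      using not_coarse_eq[OF that] by eventually_elim (simp add: int_part_def)
    have "has_color (color g) (\<lambda>x. int_part (f x)) (\<lambda>x. depth (f x))"
      using color(2)[OF that(2)] by (rule has_color_cong) (use eq in \<open>simp add: eq_commute\<close>)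
    then show ?thesis using color_eqI[OF that(1)] by simp
  qed
  show "\<exists>h\<in>nonstd. coarse f h \<and> coarse h g \<and> ord_of (color h) = K"
    if f: "f \<in> nonstd" and g: "g \<in> nonstd" and fg: "coarse f g" and K: "K \<in> ord_of ` Z" for f g K
  proof -
    obtain q where q: "q \<in> Z" "K = ord_of q" using K by blast
    obtain p where p: "computable p" "\<And>x. Suc (depth (f x) + depth (g x)) \<le> p x"
        "has_color q (\<lambda>x. int_part (f x)) p"
      using color_realized[OF q(1) computable_pt(4)[OF comp[OF f]] lim[OF f]]
        computable_Suc[OF computable_add[OF computable_pt(1)[OF comp[OF f]] computable_pt(1)[OF comp[OF g]]]]
      by blast
    define m where "m = (\<lambda>x. (2 * numer (f x) + 1) * 2 ^ (p x - Suc (depth (f x))))"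
    have d: "depth (f x) < p x" "depth (g x) < p x" for x using p(2)[of x] by simp_all
    let ?h = "\<lambda>x. pt_code (p x) (m x) 0"
    have "?h \<in> nonstd \<and> color ?h = q"
    proof (rule nonstdI[OF q(1) p(3,1)])
      show "computable m"
        unfolding m_def by (intro computable_intros computable_pt comp f p(1))
      show "m x div 2 ^ p x = int_part (f x)" for x
        unfolding m_def using d by (intro between_dyadic)
    qed (rule lim[OF f])
    moreover have "coarse f ?h"
      unfolding coarse_def m_def using between_dyadic(2) d by simp
    moreover have "coarse ?h g"
      using fg unfolding coarse_def m_def by eventually_elim (use between_dyadic(3) d in blast)
    ultimately show ?thesis using q(2) by blast
  qed
  have ex: "\<exists>h\<in>nonstd. (\<forall>x. int_part (h x) = j x) \<and> ord_of (color h) = K"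
    if K: "K \<in> ord_of ` Z" and j: "computable j" "filterlim j at_top cohesive_filter" for j K
  proof -
    obtain q where q: "q \<in> Z" "K = ord_of q" using K by blast
    obtain p where p: "computable p" "has_color q j p"
      using color_realized[OF q(1) j computable_const] by blast
    \<comment> \<open>With this numerator the block sits at
      \<open>j x + 1 / 2 ^ Suc (p x)\<close>.\<close>
    have "(\<lambda>x. pt_code (p x) (j x * 2 ^ p x) 0) \<in> nonstd \<and>
        color (\<lambda>x. pt_code (p x) (j x * 2 ^ p x) 0) = q"
      by (rule nonstdI[OF q(1) p(2,1) _ j(2)]) (intro computable_intros j p, simp)
    then show ?thesis
      using q(2) by (intro bexI[of _ "\<lambda>x. pt_code (p x) (j x * 2 ^ p x) 0"])
        (simp_all add: int_part_def)
  qed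
  show "nonstd \<noteq> {}"
    using ex[OF _ computable_id filterlim_ident] Z_nonempty by blast
  show "\<exists>h\<in>nonstd. coarse h f \<and> ord_of (color h) = K" if f: "f \<in> nonstd" and K: "K \<in> ord_of ` Z" for f K
  proof -
    have "filterlim (\<lambda>x. int_part (f x) div 2) at_top cohesive_filter"
      by (rule filterlim_at_top_linear_if[OF lim[OF f] eventually_True, of 2 _ 1]) linarith
    from ex[OF K _ this] obtain h where h: "h \<in> nonstd" "ord_of (color h) = K"
        "\<And>x. int_part (h x) = int_part (f x) div 2"
      using computable_div[OF computable_pt(4)[OF comp[OF f]] computable_const] by blast
    have "coarse h f"
      unfolding coarse_def using filterlim_at_top_ge[OF lim[OF f], of 1]
      by eventually_elim (simp add: val_less_if_int_part_less h(3))
    then show ?thesis using h by blast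
  qed
  show "\<exists>h\<in>nonstd. coarse f h \<and> ord_of (color h) = K" if f: "f \<in> nonstd" and K: "K \<in> ord_of ` Z" for f K
  proof -
    have "filterlim (\<lambda>x. Suc (int_part (f x))) at_top cohesive_filter"
      by (rule filterlim_at_top_linear_if[OF lim[OF f] eventually_True, of 1 _ 0]) simp
    from ex[OF K _ this] obtain h where h: "h \<in> nonstd" "ord_of (color h) = K"
        "\<And>x. int_part (h x) = Suc (int_part (f x))"
      using computable_Suc[OF computable_pt(4)[OF comp[OF f]]] by blast
    have "coarse f h"
      unfolding coarse_def by (simp add: val_less_if_int_part_less h(3))
    then show ?thesis using h by blast
  qed
qed

text \<open>Inside a block only the index varies, and up to equality almost everywhere it runs
  through all computable functions below the size.\<close>

lemma represents_block:
  assumes f: "f \<in> nonstd" and g: "computable g"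
    "\<forall>\<^sub>F x in cohesive_filter. size (int_part (f x)) (depth (f x)) = g x"
    and rep: "represents (below g) ae_less N"
  shows "represents {h \<in> nonstd. \<not> coarse f h \<and> \<not> coarse h f} lt N"
proof (rule represents_image[OF rep, of _ "\<lambda>h x. idx (h x)"])
  have comp: "computable h" and A: "\<forall>\<^sub>F x in cohesive_filter. h x \<in> A"
    if "h \<in> nonstd" for h using that by (auto simp: nonstd_def funs_def)
  have eq: "\<forall>\<^sub>F x in cohesive_filter. depth (h x) = depth (f x) \<and> numer (h x) = numer (f x)"
    if "h \<in> {h \<in> nonstd. \<not> coarse f h \<and> \<not> coarse h f}" for h
    using not_coarse_eq[of h f] that f by blast
  show "(\<lambda>x. idx (h x)) \<in> below g" if h: "h \<in> {h \<in> nonstd. \<not> coarse f h \<and> \<not> coarse h f}" for h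
  proof -
    have "\<forall>\<^sub>F x in cohesive_filter. h x \<in> A" using A h by blast
    with g(2) eq[OF h] have "\<forall>\<^sub>F x in cohesive_filter. idx (h x) < g x"
      by eventually_elim (auto simp: A_iff int_part_def)
    then show ?thesis using computable_pt(3) comp h by (simp add: below_def ae_less_def)
  qed
  show "\<exists>h\<in>{h \<in> nonstd. \<not> coarse f h \<and> \<not> coarse h f}.
      \<not> ae_less (\<lambda>x. idx (h x)) i \<and> \<not> ae_less i (\<lambda>x. idx (h x))" if i: "i \<in> below g" for i
  proof -
    let ?h = "\<lambda>x. pt_code (depth (f x)) (numer (f x)) (i x)"
    have part: "int_part (?h x) = int_part (f x)" for x by (simp add: int_part_def)
    have "\<forall>\<^sub>F x in cohesive_filter. i x < g x" using i by (simp add: below_def ae_less_def)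
    with g(2) have "\<forall>\<^sub>F x in cohesive_filter. ?h x \<in> A"
      by eventually_elim (simp add: A_iff part)
    moreover have "computable ?h"
      using i comp[OF f] by (intro computable_pt_code computable_pt) (auto simp: below_def)
    ultimately have "?h \<in> nonstd" using f by (simp add: nonstd_def funs_def part)
    moreover have "val (?h x) = val (f x)" for x by (simp add: val_eq_iff)
    then have "\<not> coarse f ?h" "\<not> coarse ?h f" by (simp_all add: coarse_def)
    ultimately show ?thesis by (intro bexI[of _ ?h]) (auto simp: ae_less_def)
  qed
  show "lt h k \<longleftrightarrow> ae_less (\<lambda>x. idx (h x)) (\<lambda>x. idx (k x))"
    if "h \<in> {h \<in> nonstd. \<not> coarse f h \<and> \<not> coarse h f}"
      "k \<in> {h \<in> nonstd. \<not> coarse f h \<and> \<not> coarse h f}" for h k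
    unfolding lt_def ae_less_def
    by (rule eventually_cong[OF eventually_conj[OF eq[OF that(1)] eq[OF that(2)]]])
      (auto simp: pt_less_def val_eq_iff val_less_iff)
qed

text \<open>The two assumptions ask that \<open>ord_of\<close> name the order-type of the blocks of
  each colour; \<open>represents_fin_order\<close> and \<open>represents_alpha\<close> will supply
  them.\<close>

theorem ex_computable_omega:
  assumes solid: "\<And>k g. Some k \<in> Z \<Longrightarrow> \<forall>\<^sub>F x in cohesive_filter. g x = k \<Longrightarrow>
      represents (below g) ae_less (ord_of (Some k))"
    and striped: "\<And>g. None \<in> Z \<Longrightarrow> computable g \<Longrightarrow> filterlim g at_top cohesive_filter \<Longrightarrow>
      represents (below g) ae_less (ord_of None)"
  shows "\<exists>M. computable_linear_order M \<and> M \<simeq> omega \<and> cohesive_power C M \<simeq> omega \<oplus> shuffle (ord_of ` Z)"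
proof (intro exI conjI)
  show "computable_linear_order M" by (rule computable_linear_order_M)
  have A: "represents A pt_less omega"
    using dense_colored_order.nonempty[OF dense_colored_nonstd] by (rule A_omega)
  then show "M \<simeq> omega" by (rule M_omega)
  have "represents nonstd lt (shuffle (ord_of ` Z))"
  proof (rule represents_shuffle[OF dense_colored_nonstd])
    show "lt f g \<and> \<not> lt g f" if "coarse f g" for f g
      using coarse_lt[OF that] lt_asym by blast
    show "represents {g \<in> nonstd. \<not> coarse f g \<and> \<not> coarse g f} lt (ord_of (color f))"
      if f: "f \<in> nonstd" for f
    proof -
      obtain g where g: "computable g"
          "\<forall>\<^sub>F x in cohesive_filter. size (int_part (f x)) (depth (f x)) = g x"
          "case color f of Some k \<Rightarrow> \<forall>\<^sub>F x in cohesive_filter. g x = k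
            | None \<Rightarrow> filterlim g at_top cohesive_filter"
        using color(2)[OF f] by (auto simp: has_color_def)
      have "represents (below g) ae_less (ord_of (color f))"
        using solid striped color(1)[OF f] g(1,3) by (cases "color f") auto
      then show ?thesis by (rule represents_block[OF f g(1,2)])
    qed
  qed auto
  then have "represents (std \<union> nonstd) lt (omega \<oplus> shuffle (ord_of ` Z))"
    using std_omega[OF A] std_less_nonstd lt_asym by (intro represents_plus) auto
  then show "cohesive_power C M \<simeq> omega \<oplus> shuffle (ord_of ` Z)"
    unfolding funs_eq[symmetric] by (rule cohesive_power_ord_iso)
qed

end

section \<open>Realizing prescribed block sizes\<close>

context block_order
begin

text \<open>Every computable depth is within the horizon almost everywhere, so the cut-off in
  \<open>size\<close> is invisible in the nonstandard part.\<close>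

lemma eventually_size:
  assumes "computable j" "filterlim j at_top cohesive_filter" "computable p"
  shows "\<forall>\<^sub>F x in cohesive_filter. size (j x) (p x) = S (horizon (j x)) (j x) (p x)"
  using eventually_le_horizon[OF assms] by eventually_elim (simp add: size_def)

lemma has_color_SomeI:
  "\<forall>\<^sub>F x in cohesive_filter. size (j x) (p x) = k \<Longrightarrow> has_color (Some k) j p"
  unfolding has_color_def using computable_const[of k] by auto

lemma has_color_NoneI:
  "computable g \<Longrightarrow> filterlim g at_top cohesive_filter \<Longrightarrow>
    \<forall>\<^sub>F x in cohesive_filter. size (j x) (p x) = g x \<Longrightarrow> has_color None j p"
  unfolding has_color_def by auto

lemma has_color_cases:
  assumes "computable g" "\<forall>\<^sub>F x in cohesive_filter. size (j x) (p x) = g x"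
  obtains "has_color None j p"
  | k where "\<forall>\<^sub>F x in cohesive_filter. g x = k" "has_color (Some k) j p"
proof (rule eventually_const_or_at_top[OF assms(1)])
  fix k assume k: "\<forall>\<^sub>F x in cohesive_filter. g x = k"
  with assms(2) have "\<forall>\<^sub>F x in cohesive_filter. size (j x) (p x) = k" by eventually_elim simp
  then show thesis using that(2) k has_color_SomeI by blast
qed (use that(1) has_color_NoneI assms in blast)

end

context co_ce_cohesive
begin

lemma sigma2_block_order:
  assumes X: "X \<subseteq> UNIV - {0}" and "Sigma2_set X"
  shows "\<exists>S. colored_block_order C S (insert None (Some ` X))"
proof -
  obtain Q where Q: "decidable (\<lambda>x. x \<in> Q)"
    and X_eq: "X = {x. \<exists>y. \<forall>z. prod_encode (x, prod_encode (y, z)) \<in> Q}"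
    using assms(2) by (auto simp: Sigma2_set_def computable_set_def decidable_def computable_def)
  define R where "R = (\<lambda>k y z. prod_encode (k, prod_encode (y, z)) \<in> Q)"
  have R: "decidable (\<lambda>x. R (a x) (b x) (c x))"
    if "computable a" "computable b" "computable c" for a b c
    unfolding R_def by (intro decidable_comp[OF Q] computable_intros that)
  \<comment> \<open>The depth codes \<open>k\<close>, a candidate witness and padding that makes it
    as large as desired. The summand \<open>Suc j\<close> sends the size of a refuted block to
    infinity along with \<open>j\<close>.\<close>
  define S where "S = (\<lambda>v j p. if \<exists>z\<le>v. \<not> R (pi1 p) (pi1 (pi2 p)) z then pi1 p + Suc j else pi1 p)"
  have X_iff: "k \<in> X \<longleftrightarrow> (\<exists>y. \<forall>z. R k y z)" for k by (simp add: X_eq R_def)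
  interpret block_order C S
  proof
    show "computable (\<lambda>z. S (pi1 z) (pi1 (pi2 z)) (pi2 (pi2 z)))"
      unfolding S_def
      by (intro computable_intros decidable_bex_le)
        (auto simp: decidable2_def intro!: computable_intros R)
    show "S v j p \<le> S w j p" if "v \<le> w" for v w j p
      using that by (auto simp: S_def intro: le_trans)
  qed
  have color_ex: "\<exists>q\<in>insert None (Some ` X). has_color q j p"
    if j: "computable j" "filterlim j at_top cohesive_filter" and p: "computable p" for j p
  proof -
    have size: "\<forall>\<^sub>F x in cohesive_filter. size (j x) (p x) = S (horizon (j x)) (j x) (p x)"
      using eventually_size[OF j p] .
    let ?D = "\<lambda>x z. \<not> R (pi1 (p x)) (pi1 (pi2 (p x))) z"
    have D: "decidable2 ?D"
      unfolding decidable2_def by (intro decidable_not R computable_intros computable_comp[OF p])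
    then have "semidecidable (\<lambda>x. \<exists>z. ?D x z)" by (rule semidecidableI) simp
    then consider "\<forall>\<^sub>F x in cohesive_filter. \<exists>z. ?D x z" | "\<forall>\<^sub>F x in cohesive_filter. \<not> (\<exists>z. ?D x z)"
      using eventually_dichotomy by blast
    then show ?thesis
    proof cases
      case 1
      \<comment> \<open>Refutations can be found computably, hence lie below the horizon almost
        everywhere, and the bounded search in \<open>S\<close> succeeds.\<close>
      then obtain z where z: "computable z" "\<forall>\<^sub>F x in cohesive_filter. ?D x (z x)"
        using computable_choice[OF D] by blast
      from size z(2) eventually_le_horizon[OF j z(1)]
      have "\<forall>\<^sub>F x in cohesive_filter. size (j x) (p x) = pi1 (p x) + Suc (j x)"
        by eventually_elim (auto simp: S_def)
      moreover have "computable (\<lambda>x. pi1 (p x) + Suc (j x))" by (intro computable_intros j p)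
      moreover have "filterlim (\<lambda>x. pi1 (p x) + Suc (j x)) at_top cohesive_filter"
        by (rule filterlim_at_top_le[OF j(2)]) simp
      ultimately have "has_color None j p" using has_color_NoneI by blast
      then show ?thesis by blast
    next
      case 2
      from size 2 have "\<forall>\<^sub>F x in cohesive_filter. size (j x) (p x) = pi1 (p x)"
        by eventually_elim (auto simp: S_def)
      then show ?thesis
      \<comment> \<open>If the code \<open>k\<close> is constant, an unrefuted guess at a single
        \<open>x\<close> is a true witness for \<open>k \<in> X\<close>; otherwise the size tends to
        infinity.\<close>
      proof (rule has_color_cases[OF computable_pi1[OF p]])
        fix k assume k: "\<forall>\<^sub>F x in cohesive_filter. pi1 (p x) = k" "has_color (Some k) j p"
        from 2 k(1) have "\<forall>\<^sub>F x in cohesive_filter. k \<in> X"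
          by eventually_elim (auto simp: X_iff)
        then show ?thesis using k(2) by auto
      qed blast
    qed
  qed
  have "\<exists>p. computable p \<and> (\<forall>x. P x \<le> p x) \<and> has_color q j p"
    if q: "q \<in> insert None (Some ` X)" and j: "computable j" "filterlim j at_top cohesive_filter"
      and P: "computable P" for q j P
  proof (cases q)
    case None
    \<comment> \<open>With \<open>j x\<close> in the place of \<open>k\<close> the size is at least
      \<open>j x\<close>, whether the guess is refuted or not.\<close>
    let ?p = "\<lambda>x. prod_encode (j x, prod_encode (0, P x))"
    have p: "computable ?p" by (intro computable_intros j P)
    from eventually_size[OF j p] have "\<forall>\<^sub>F x in cohesive_filter. j x \<le> size (j x) (?p x)"
      by eventually_elim (simp add: S_def)
    then have lim: "filterlim (\<lambda>x. size (j x) (?p x)) at_top cohesive_filter"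
      by (rule filterlim_at_top_le[OF j(2)])
    obtain q' where q': "has_color q' j ?p" using color_ex[OF j p] by blast
    have "q' = None"
    proof (rule ccontr)
      assume "q' \<noteq> None"
      then obtain k where "has_color (Some k) j ?p" using q' by auto
      then obtain g where "\<forall>\<^sub>F x in cohesive_filter. size (j x) (?p x) = g x"
          "\<forall>\<^sub>F x in cohesive_filter. g x = k"
        by (auto simp: has_color_def)
      then have "\<forall>\<^sub>F x in cohesive_filter. size (j x) (?p x) = k" by eventually_elim simp
      from not_at_top_if_eventually_eq[OF this] show False using lim by blast
    qed
    moreover have "P x \<le> ?p x" for x by (meson le_prod_encode_2 le_trans)
    ultimately show ?thesis using p q' None by blast
  next
    case (Some k)
    then obtain y where y: "\<forall>z. R k y z" using q X_iff by auto
    let ?p = "\<lambda>x. prod_encode (k, prod_encode (y, P x))"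
    have p: "computable ?p" by (intro computable_intros P)
    from eventually_size[OF j p] have "\<forall>\<^sub>F x in cohesive_filter. size (j x) (?p x) = k"
      by eventually_elim (simp add: S_def y)
    from has_color_SomeI[OF this] have "has_color q j ?p" using Some by simp
    moreover have "P x \<le> ?p x" for x by (meson le_prod_encode_2 le_trans)
    ultimately show ?thesis using p by blast
  qed
  then have "colored_block_order C S (insert None (Some ` X))"
    using color_ex X by unfold_locales auto
  then show ?thesis by blast
qed

lemma pi2_block_order:
  assumes X: "X \<subseteq> UNIV - {0}" and "Pi2_set X"
  shows "\<exists>S. colored_block_order C S (insert None (Some ` X))"
proof -
  obtain Q where Q: "decidable (\<lambda>x. x \<in> Q)"
    and X_eq: "X = {x. \<forall>y. \<exists>z. prod_encode (x, prod_encode (y, z)) \<in> Q}"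
    using assms(2) by (auto simp: Pi2_set_def computable_set_def decidable_def computable_def)
  \<comment> \<open>Only the instances up to \<open>j\<close> are checked; as \<open>j\<close> tends
    to infinity in the nonstandard part, every fixed \<open>y\<close> is eventually among
    them.\<close>
  define R where "R = (\<lambda>k j v. \<forall>y\<le>j. \<exists>z\<le>v. prod_encode (k, prod_encode (y, z)) \<in> Q)"
  have R: "decidable (\<lambda>x. R (a x) (b x) (c x))"
    if "computable a" "computable b" "computable c" for a b c
    unfolding R_def
    by (intro decidable_ball_le that)
      (auto simp: decidable2_def intro!: decidable_bex_le decidable_comp[OF Q] computable_intros
        computable_comp[OF that(1)] computable_comp[OF that(3)])
  have R_mono: "R k j w" if "R k j v" "v \<le> w" for k j v w
    using that unfolding R_def by (meson le_trans)
  have R_ex: "\<exists>v. R k j v" if "k \<in> X" for k j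
  proof -
    have "\<forall>y. \<exists>z. prod_encode (k, prod_encode (y, z)) \<in> Q" using that X_eq by blast
    then obtain z where "\<And>y. prod_encode (k, prod_encode (y, z y)) \<in> Q" by metis
    then have "R k j (Max (z ` {..j}))" unfolding R_def by (auto intro!: exI[of _ "z _"])
    then show ?thesis by blast
  qed
  \<comment> \<open>As 0 is not in \<open>X\<close>, the code 0 is free for blocks of nonstandard
    size.\<close>
  define S where "S = (\<lambda>v j p. if pi1 p = 0 then j else if R (pi1 p) j v then pi1 p else 0)"
  interpret block_order C S
  proof
    show "computable (\<lambda>z. S (pi1 z) (pi1 (pi2 z)) (pi2 (pi2 z)))"
      unfolding S_def by (intro computable_intros R)
    show "S v j p \<le> S w j p" if "v \<le> w" for v w j p
      using R_mono[OF _ that] by (auto simp: S_def)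
  qed
  have "\<exists>q\<in>insert None (Some ` X). has_color q j p"
    if j: "computable j" "filterlim j at_top cohesive_filter" and p: "computable p"
      and pos: "\<forall>\<^sub>F x in cohesive_filter. 0 < size (j x) (p x)" for j p
  proof -
    have size: "\<forall>\<^sub>F x in cohesive_filter. size (j x) (p x) = S (horizon (j x)) (j x) (p x)"
      using eventually_size[OF j p] .
    have "decidable (\<lambda>x. pi1 (p x) = 0)" by (intro computable_intros p)
    then consider "\<forall>\<^sub>F x in cohesive_filter. pi1 (p x) = 0" | "\<forall>\<^sub>F x in cohesive_filter. pi1 (p x) \<noteq> 0"
      using eventually_dichotomy' by blast
    then show ?thesis
    proof cases
      case 1
      from size 1 have "\<forall>\<^sub>F x in cohesive_filter. size (j x) (p x) = j x"
        by eventually_elim (simp add: S_def)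
      then have "has_color None j p" using has_color_NoneI j by blast
      then show ?thesis by blast
    next
      case 2
      from size pos 2 have *: "\<forall>\<^sub>F x in cohesive_filter.
          size (j x) (p x) = pi1 (p x) \<and> R (pi1 (p x)) (j x) (horizon (j x))"
        by eventually_elim (auto simp: S_def split: if_splits)
      then have "\<forall>\<^sub>F x in cohesive_filter. size (j x) (p x) = pi1 (p x)" by eventually_elim simp
      then show ?thesis
      proof (rule has_color_cases[OF computable_pi1[OF p]])
        fix k assume k: "\<forall>\<^sub>F x in cohesive_filter. pi1 (p x) = k" "has_color (Some k) j p"
        have "\<exists>z. prod_encode (k, prod_encode (y, z)) \<in> Q" for y
        proof -
          from * k(1) filterlim_at_top_ge[OF j(2), of y]
          have "\<forall>\<^sub>F x in cohesive_filter. \<exists>z. prod_encode (k, prod_encode (y, z)) \<in> Q"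
            by eventually_elim (auto simp: R_def)
          then show ?thesis by simp
        qed
        then show ?thesis using k(2) X_eq by blast
      qed blast
    qed
  qed
  moreover have "\<exists>p. computable p \<and> (\<forall>x. P x \<le> p x) \<and> has_color q j p"
    if q: "q \<in> insert None (Some ` X)" and j: "computable j" "filterlim j at_top cohesive_filter"
      and P: "computable P" for q j P
  proof (cases q)
    case None
    let ?p = "\<lambda>x. prod_encode (0, P x)"
    have p: "computable ?p" by (intro computable_intros P)
    from eventually_size[OF j p] have "\<forall>\<^sub>F x in cohesive_filter. size (j x) (?p x) = j x"
      by eventually_elim (simp add: S_def)
    from has_color_NoneI[OF j this] have "has_color q j ?p" using None by simp
    then show ?thesis using p le_prod_encode_2 by blast
  next
    case (Some k)
    then have k: "k \<in> X" "k \<noteq> 0" using q X by auto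
    let ?p = "\<lambda>x. prod_encode (k, P x)"
    have p: "computable ?p" by (intro computable_intros P)
    \<comment> \<open>For \<open>k\<close> in \<open>X\<close> a confirming bound exists at every
      \<open>x\<close> and is found computably, so the horizon exceeds it almost everywhere.\<close>
    have "decidable2 (\<lambda>x. R k (j x))"
      unfolding decidable2_def by (intro R computable_intros computable_comp[OF j(1)])
    then obtain g where g: "computable g" "\<forall>\<^sub>F x in cohesive_filter. R k (j x) (g x)"
      using computable_choice[of "\<lambda>x. R k (j x)"] R_ex[OF k(1)] by auto
    from eventually_size[OF j p] g(2) eventually_le_horizon[OF j g(1)]
    have "\<forall>\<^sub>F x in cohesive_filter. size (j x) (?p x) = k"
      by eventually_elim (use R_mono k(2) in \<open>auto simp: S_def\<close>)
    from has_color_SomeI[OF this] have "has_color q j ?p" using Some by simp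
    then show ?thesis using p le_prod_encode_2 by blast
  qed
  ultimately have "colored_block_order C S (insert None (Some ` X))"
    using X by unfold_locales auto
  then show ?thesis by blast
qed

text \<open>Membership in a finite set is decidable, so \<open>S\<close> can be independent of the
  horizon; codes confined to a finite set are constant almost everywhere, which excludes nonstandard
  sizes.\<close>

lemma finite_block_order:
  assumes X: "X \<subseteq> UNIV - {0}" and "finite X" "X \<noteq> {}"
  shows "\<exists>S. colored_block_order C S (Some ` X)"
proof -
  define S where "S = (\<lambda>(v :: nat) (j :: nat) p. if pi1 p \<in> X then pi1 p else 0)"
  have dec: "decidable (\<lambda>x. f x \<in> X)" if "computable f" for f
    using \<open>finite X\<close>
  proof (induction X rule: finite_induct)
    case (insert k X)
    then show ?case by (simp only: insert_iff) (intro computable_intros that)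
  qed (simp add: decidable_const)
  interpret block_order C S
    by unfold_locales (auto simp: S_def intro!: computable_intros dec)
  have "\<exists>q\<in>Some ` X. has_color q j p"
    if j: "computable j" "filterlim j at_top cohesive_filter" and p: "computable p"
      and pos: "\<forall>\<^sub>F x in cohesive_filter. 0 < size (j x) (p x)" for j p
  proof -
    from eventually_size[OF j p] pos
    have *: "\<forall>\<^sub>F x in cohesive_filter. pi1 (p x) \<in> X \<and> size (j x) (p x) = pi1 (p x)"
      by eventually_elim (auto simp: S_def split: if_splits)
    then have "\<forall>\<^sub>F x in cohesive_filter. pi1 (p x) \<in> X" by eventually_elim simp
    then obtain k where k: "k \<in> X" "\<forall>\<^sub>F x in cohesive_filter. pi1 (p x) = k"
      by (rule eventually_constI[OF computable_pi1[OF p] \<open>finite X\<close>])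
    from * k(2) have "\<forall>\<^sub>F x in cohesive_filter. size (j x) (p x) = k" by eventually_elim simp
    then show ?thesis using k(1) has_color_SomeI by blast
  qed
  moreover have "\<exists>p. computable p \<and> (\<forall>x. P x \<le> p x) \<and> has_color q j p"
    if q: "q \<in> Some ` X" and j: "computable j" "filterlim j at_top cohesive_filter"
      and P: "computable P" for q j P
  proof -
    obtain k where k: "k \<in> X" "q = Some k" using q by blast
    let ?p = "\<lambda>x. prod_encode (k, P x)"
    have p: "computable ?p" by (intro computable_intros P)
    from eventually_size[OF j p] have "\<forall>\<^sub>F x in cohesive_filter. size (j x) (?p x) = k"
      by eventually_elim (simp add: S_def k)
    from has_color_SomeI[OF this] have "has_color q j ?p" using k(2) by simp
    then show ?thesis using p le_prod_encode_2 by blast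
  qed
  ultimately have "colored_block_order C S (Some ` X)"
    using X \<open>X \<noteq> {}\<close> by unfold_locales auto
  then show ?thesis by blast
qed

end

theorem theorem6p6:
  fixes X C :: "nat set"
  assumes "X \<subseteq> UNIV - {0}"
    and "Sigma2_set X \<or> Pi2_set X"
    and "co_ce_set C"
    and "cohesive C"
  shows "(\<exists>M. computable_linear_order M \<and> M \<simeq> omega \<and>
            cohesive_power C M \<simeq>
              omega \<oplus> shuffle ((\<lambda>k. copy_order Inl (fin_order k)) ` X \<union> {alpha})) \<and>
         (finite X \<and> X \<noteq> {} \<longrightarrow>
           (\<exists>M. computable_linear_order M \<and> M \<simeq> omega \<and>
              cohesive_power C M \<simeq> omega \<oplus> shuffle (fin_order ` X)))"
proof (intro conjI impI)
  interpret co_ce_cohesive C using assms(3,4) by unfold_locales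
  \<comment> \<open>\<open>Inl\<close> embeds the finite orders in the element type of
    \<open>alpha\<close>, since the members of a shuffle share one type.\<close>
  let ?ord = "\<lambda>q. case q of Some k \<Rightarrow> copy_order Inl (fin_order k) | None \<Rightarrow> alpha"
  obtain S where "colored_block_order C S (insert None (Some ` X))"
    using sigma2_block_order pi2_block_order assms(1,2) by blast
  then have "\<exists>M. computable_linear_order M \<and> M \<simeq> omega \<and>
      cohesive_power C M \<simeq> omega \<oplus> shuffle (?ord ` insert None (Some ` X))"
    by (rule colored_block_order.ex_computable_omega)
      (auto intro: represents_copy represents_fin_order represents_alpha)
  moreover have "?ord ` insert None (Some ` X) =
      (\<lambda>k. copy_order Inl (fin_order k)) ` X \<union> {alpha}"
    by (auto simp: image_image)
  ultimately show "\<exists>M. computable_linear_order M \<and> M \<simeq> omega \<and>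
      cohesive_power C M \<simeq>
        omega \<oplus> shuffle ((\<lambda>k. copy_order Inl (fin_order k)) ` X \<union> {alpha})"
    by simp
next
  interpret co_ce_cohesive C using assms(3,4) by unfold_locales
  \<comment> \<open>\<open>None\<close> is not a colour here, so \<open>the\<close> meets only
    values \<open>Some k\<close>.\<close>
  let ?ord = "\<lambda>q. fin_order (the q)"
  assume "finite X \<and> X \<noteq> {}"
  then obtain S where "colored_block_order C S (Some ` X)"
    using finite_block_order assms(1) by blast
  then have "\<exists>M. computable_linear_order M \<and> M \<simeq> omega \<and>
      cohesive_power C M \<simeq> omega \<oplus> shuffle (?ord ` (Some ` X))"
    by (rule colored_block_order.ex_computable_omega) (auto intro: represents_fin_order)
  then show "\<exists>M. computable_linear_order M \<and> M \<simeq> omega \<and>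
      cohesive_power C M \<simeq> omega \<oplus> shuffle (fin_order ` X)"
    by (simp add: image_image)
qed

end
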